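(* Let $p\ge3$, let $C_p$ be the cycle on $p$ vertices, and let $\mathfrak M$ be the coupling of $C_p\circ K_1$ that pairs each leaf with its unique neighbor. The coupled graph $(C_p\circ K_1)^{\mathfrak M}$ allows every symplectic spectrum that can be described by an ordered multiplicity list $\mathbf m=(m_1,\dots,m_q)$ where each $m_i$ equals one or two, $p=\sum_{i=1}^q m_i$, and $\sum_{i=k}^{k'}m_i$ is even for any $1\le k<k'\le q$ such that $m_k=m_{k'}=2$. No other symplectic spectra are allowed. Furthermore, $$\operatorname{M}(C_p)=\operatorname{M}_{\operatorname{Sp}}((C_p\circ K_1)^{\mathfrak M})=\operatorname{Z}_{\operatorname{C}}((C_p\circ K_1)^{\mathfrak M})=\operatorname{Z}_\ell(C_p\circ K_1)=\operatorname{Z}(C_p)=2.$$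
   Context: $\Omega=\begin{bmatrix}O&I_p\\-I_p&O\end{bmatrix}$; a real $2p\times2p$ matrix $S$ is symplectic if $S^\top\Omega S=\Omega$. Positive definite matrices are real symmetric. By Williamson's theorem, for each $2p\times 2p$ positive definite $N$ there is a symplectic $S$ with $S^\top NS=D\oplus D$, $D$ a $p\times p$ diagonal matrix whose diagonal entries are positive and unique up to order; the multiset of these is the symplectic spectrum of $N$, and multiplicity of a symplectic eigenvalue is its number of occurrences on the diagonal of $D$. The ordered multiplicity list of a multiset with distinct elements $\lambda_1<\dots<\lambda_q$ is $(m_1,\dots,m_q)$, $m_i$ being the multiplicity of $\lambda_i$. The corona $H\circ K_1$ is formed from $H$ by joining a new vertex $u_v$ (a leaf) to $v$ for each vertex $v$ of $H$. A coupled graph $G^{\mathfrak C}$ is a graph $G$ of order $2p$ with a coupling $\mathfrak C$, i.e. a partition of $V(G)$ into $p$ unordered pairs; $\mathfrak c(v)$ is the vertex paired with $v$. A representative labeling $L$ of $G^{\mathfrak C}$ is a bijective labeling of $V(G)$ by $1,\dots,2p$ such that each pair of $\mathfrak C$ receives labels $\{k,k+p\}$ for some $k\in\{1,\dots,p\}$. $\mathcal S_+(G^L)$ is the set of positive definite matrices $[n_{ij}]$ such that for $i\neq j$, $n_{ij}\ne0$ if and only if the vertices labeled $i$ and $j$ are adjacent. $G^{\mathfrak C}$ allows a symplectic spectrum $\Lambda$ if there are a representative labeling $L$ and $N\in\mathcal S_+(G^L)$ with symplectic spectrum $\Lambda$. $\operatorname{M}_{\operatorname{Sp}}(G^{\mathfrak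 C})$ is the maximum multiplicity of a symplectic eigenvalue among matrices $N\in\mathcal S_+(G^L)$ (independent of the representative labeling $L$). $\operatorname{M}(H)$ is the maximum nullity (equivalently, maximum eigenvalue multiplicity) over real symmetric matrices whose off-diagonal nonzero pattern is exactly the edge set of $H$ (diagonal arbitrary). Zero forcing numbers are minimum sizes of initial blue sets from which repeated application of a color change rule turns all vertices blue. For $\operatorname{Z}(H)$: a blue vertex $v$ forces white $w$ to blue if $w$ is the only white vertex in the open neighborhood $N(v)$. For $\operatorname{Z}_\ell(G)$: (1) if $u$ is blue and has exactly one white neighbor $w$, then $w$ becomes blue; (2) if $w$ is white, not isolated, and all its neighbors are blue, then $w$ becomes blue. For $\operatorname{Z}_{\operatorname{C}}(G^{\mathfrak C})$: (1) a blue vertex $v$ forces a white $w$ if $w$ is the only white vertex in $N(v)\cup\{\mathfrak c(v)\}$; (2) a white $v$ becomes blue if every vertex in $N(v)\cup\{\mathfrak c(v)\}$ is blue. *)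

theory Defs
  imports
    "Graph_Theory.Pair_Digraph"
    "Jordan_Normal_Form.Matrix_Kernel"
    "HOL-Library.Disjoint_Sets"
    "HOL-Library.Multiset"
begin

section \<open>Graphs and couplings\<close>

text \<open>
  A finite simple graph is a \<open>pair_graph\<close>: a finite vertex set with a symmetric, loop-free set of
  ordered pairs, so that the edge \<open>uv\<close> is represented by the two arcs \<open>(u, v)\<close> and \<open>(v, u)\<close>.
\<close>

definition nbhd :: "'a pair_pre_digraph \<Rightarrow> 'a \<Rightarrow> 'a set" where
  "nbhd G v = {w. (v, w) \<in> parcs G}"

text \<open>This is the simple cycle only for \<open>p \<ge> 3\<close>.\<close>

definition cycle_graph :: "nat \<Rightarrow> nat pair_pre_digraph" where
  "cycle_graph p = \<lparr> pverts = {0..<p},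
     parcs = {(i, j). i < p \<and> j < p \<and> (j = (i + 1) mod p \<or> i = (j + 1) mod p)} \<rparr>"

text \<open>\<open>H \<circ> K\<^sub>1\<close>: \<open>Inl v\<close> is the vertex \<open>v\<close> of \<open>H\<close>, and \<open>Inr v\<close> is the leaf \<open>u\<^sub>v\<close> attached to it.\<close>

definition corona :: "'a pair_pre_digraph \<Rightarrow> ('a + 'a) pair_pre_digraph" where
  "corona H = \<lparr> pverts = Inl ` pverts H \<union> Inr ` pverts H,
     parcs = {(Inl u, Inl v) | u v. (u, v) \<in> parcs H}
           \<union> {(Inl v, Inr v) | v. v \<in> pverts H} \<union> {(Inr v, Inl v) | v. v \<in> pverts H} \<rparr>"

definition coupled_graph :: "'a pair_pre_digraph \<Rightarrow> 'a set set \<Rightarrow> bool" where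
  "coupled_graph G C \<longleftrightarrow> pair_graph G \<and> partition_on (pverts G) C \<and> (\<forall>P\<in>C. card P = 2)"

definition partner :: "'a set set \<Rightarrow> 'a \<Rightarrow> 'a" where
  "partner C v = (THE w. {v, w} \<in> C)"

definition leaf_coupling :: "'a pair_pre_digraph \<Rightarrow> ('a + 'a) set set" where
  "leaf_coupling H = (\<lambda>v. {Inl v, Inr v}) ` pverts H"

lemma pair_graph_cycle_graph:
  assumes "3 \<le> p"
  shows "pair_graph (cycle_graph p)"
proof -
  have fin: "finite (parcs (cycle_graph p))"
    by (rule finite_subset[of _ "{0..<p} \<times> {0..<p}"]) (auto simp: cycle_graph_def)
  have ne: "Suc i mod p \<noteq> i" if "i < p" for i
    using that assms by (cases "Suc i = p") auto
  show ?thesis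
    by unfold_locales
      (use fin ne ne[symmetric] in \<open>auto simp: cycle_graph_def symmetric_def intro!: symI\<close>)
qed

lemma coupled_graph_corona:
  assumes "pair_graph H"
  shows "coupled_graph (corona H) (leaf_coupling H)"
proof -
  interpret pair_graph H by fact
  have "parcs (corona H) \<subseteq> pverts (corona H) \<times> pverts (corona H)"
    by (auto simp: corona_def dest: in_arcsD1 in_arcsD2)
  moreover have "finite (pverts (corona H))"
    using pair_finite_verts by (simp add: corona_def)
  ultimately have fin: "finite (parcs (corona H))"
    by (meson finite_SigmaI finite_subset)
  have sym: "sym (parcs H)"
    using pair_sym_arcs by (simp add: symmetric_def)
  have "pair_graph (corona H)"
    by unfold_locales
      (use fin sym pair_finite_verts pair_no_loops in
        \<open>auto simp: corona_def symmetric_def intro!: symI dest: in_arcsD1 in_arcsD2 symD\<close>)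
  moreover have "partition_on (pverts (corona H)) (leaf_coupling H)"
    by (auto simp: partition_on_def corona_def leaf_coupling_def disjoint_def)
  ultimately show ?thesis
    by (auto simp: coupled_graph_def leaf_coupling_def)
qed

lemma partner_leaf_coupling:
  assumes "v \<in> pverts H"
  shows "partner (leaf_coupling H) (Inl v) = Inr v" "partner (leaf_coupling H) (Inr v) = Inl v"
  using assms by (auto simp: partner_def leaf_coupling_def doubleton_eq_iff intro!: the_equality)


section \<open>Symplectic spectra\<close>

definition symp_form :: "nat \<Rightarrow> real mat" where
  "symp_form p = four_block_mat (0\<^sub>m p p) (1\<^sub>m p) (- 1\<^sub>m p) (0\<^sub>m p p)"

definition symplectic :: "nat \<Rightarrow> real mat \<Rightarrow> bool" where
  "symplectic p S \<longleftrightarrow> S \<in> carrier_mat (2 * p) (2 * p) \<and>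
     transpose_mat S * symp_form p * S = symp_form p"

definition pos_def :: "nat \<Rightarrow> real mat \<Rightarrow> bool" where
  "pos_def n N \<longleftrightarrow> N \<in> carrier_mat n n \<and> transpose_mat N = N \<and>
     (\<forall>x \<in> carrier_vec n. x \<noteq> 0\<^sub>v n \<longrightarrow> 0 < x \<bullet> (N *\<^sub>v x))"

text \<open>
  A relation rather than a function: existence and uniqueness of \<open>\<Lambda>\<close> for a given positive definite
  \<open>N\<close> are the content of Williamson's theorem.
\<close>

definition has_symplectic_spectrum :: "nat \<Rightarrow> real mat \<Rightarrow> real multiset \<Rightarrow> bool" where
  "has_symplectic_spectrum p N \<Lambda> \<longleftrightarrow>
     (\<exists>S D. symplectic p S \<and> D \<in> carrier_mat p p \<and> diagonal_mat D \<and> (\<forall>i<p. 0 < D $$ (i, i)) \<and>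
        transpose_mat S * N * S = four_block_mat D (0\<^sub>m p p) (0\<^sub>m p p) D \<and>
        \<Lambda> = mset (diag_mat D))"

definition ordered_multiplicity_list :: "real multiset \<Rightarrow> nat list" where
  "ordered_multiplicity_list \<Lambda> = map (count \<Lambda>) (sorted_list_of_set (set_mset \<Lambda>))"

text \<open>Labels start at \<open>0\<close>, matching the indexing of matrices; here \<open>p = card C\<close>.\<close>

definition representative_labeling ::
    "'a pair_pre_digraph \<Rightarrow> 'a set set \<Rightarrow> ('a \<Rightarrow> nat) \<Rightarrow> bool" where
  "representative_labeling G C L \<longleftrightarrow> bij_betw L (pverts G) {0..<2 * card C} \<and>
     (\<forall>P\<in>C. \<exists>k<card C. L ` P = {k, k + card C})"

definition has_pattern :: "'a pair_pre_digraph \<Rightarrow> ('a \<Rightarrow> nat) \<Rightarrow> real mat \<Rightarrow> bool" where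
  "has_pattern G L N \<longleftrightarrow> (\<forall>u \<in> pverts G. \<forall>v \<in> pverts G. u \<noteq> v \<longrightarrow>
     (N $$ (L u, L v) \<noteq> 0 \<longleftrightarrow> (u, v) \<in> parcs G))"

definition S_plus :: "'a pair_pre_digraph \<Rightarrow> ('a \<Rightarrow> nat) \<Rightarrow> real mat set" where
  "S_plus G L = {N. pos_def (card (pverts G)) N \<and> has_pattern G L N}"

definition allows_symplectic_spectrum ::
    "'a pair_pre_digraph \<Rightarrow> 'a set set \<Rightarrow> real multiset \<Rightarrow> bool" where
  "allows_symplectic_spectrum G C \<Lambda> \<longleftrightarrow>
     (\<exists>L N. representative_labeling G C L \<and> N \<in> S_plus G L \<and> has_symplectic_spectrum (card C) N \<Lambda>)"

text \<open>
  The maximum for one labeling does not depend on the representative labeling, so it is taken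
  over all of them.
\<close>

definition max_symplectic_multiplicity :: "'a pair_pre_digraph \<Rightarrow> 'a set set \<Rightarrow> nat" where
  "max_symplectic_multiplicity G C = Max {count \<Lambda> x | \<Lambda> x L N.
     representative_labeling G C L \<and> N \<in> S_plus G L \<and>
     has_symplectic_spectrum (card C) N \<Lambda> \<and> x \<in># \<Lambda>}"


section \<open>Maximum nullity\<close>

text \<open>The vertices are matched with the row indices by an arbitrary bijection \<open>L\<close>.\<close>

definition max_nullity :: "'a pair_pre_digraph \<Rightarrow> nat" where
  "max_nullity H = Max {kernel_dim A | A L.
     bij_betw L (pverts H) {0..<card (pverts H)} \<and>
     A \<in> carrier_mat (card (pverts H)) (card (pverts H)) \<and>
     transpose_mat A = A \<and> has_pattern H L A}"


section \<open>Zero forcing\<close>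

text \<open>
  A color change rule \<open>R\<close> is given by \<open>R B w\<close>: with blue set \<open>B\<close>, the white vertex \<open>w\<close> may become
  blue. One step colors one vertex.
\<close>

definition forcing_step :: "'a set \<Rightarrow> ('a set \<Rightarrow> 'a \<Rightarrow> bool) \<Rightarrow> 'a set \<Rightarrow> 'a set \<Rightarrow> bool" where
  "forcing_step V R B B' \<longleftrightarrow> (\<exists>w \<in> V - B. R B w \<and> B' = insert w B)"

definition forcing_number :: "'a set \<Rightarrow> ('a set \<Rightarrow> 'a \<Rightarrow> bool) \<Rightarrow> nat" where
  "forcing_number V R = Min {card B | B. B \<subseteq> V \<and> (forcing_step V R)\<^sup>*\<^sup>* B V}"

definition Z_number :: "'a pair_pre_digraph \<Rightarrow> nat" where
  "Z_number H = forcing_number (pverts H)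
     (\<lambda>B w. \<exists>v \<in> B. nbhd H v - B = {w})"

definition Z_ell_number :: "'a pair_pre_digraph \<Rightarrow> nat" where
  "Z_ell_number G = forcing_number (pverts G)
     (\<lambda>B w. (\<exists>u \<in> B. nbhd G u - B = {w}) \<or>
            (nbhd G w \<noteq> {} \<and> nbhd G w \<subseteq> B))"

definition Z_C_number :: "'a pair_pre_digraph \<Rightarrow> 'a set set \<Rightarrow> nat" where
  "Z_C_number G C = forcing_number (pverts G)
     (\<lambda>B w. (\<exists>v \<in> B. (nbhd G v \<union> {partner C v}) - B = {w}) \<or>
            nbhd G w \<union> {partner C w} \<subseteq> B)"

end

theory Submission
  imports Defs "Jordan_Normal_Form.Schur_Decomposition"
begin

text \<open>
Let \<open>\<Omega>\<close> be the symplectic form and let \<open>N\<close> be a positive definite matrix fitting the corona of a cycle, with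
every leaf coupled to its neighbor. In suitable coordinates the leaf block of \<open>N\<close> and the block that
joins the leaves to the cycle are diagonal, so a symplectic shear followed by a symplectic scaling
turns \<open>N\<close> into \<open>M \<oplus> I\<close>, where \<open>M\<close> is symmetric and fits the cycle (\<open>leaf_elimination\<close>). A symplectic
congruence is a similarity of \<open>\<Omega> N\<close>, and \<open>(\<Omega> (M \<oplus> I))\<^sup>2 = - (M \<oplus> M)\<close>; hence the squares of the symplectic
eigenvalues of \<open>N\<close> are the eigenvalues of \<open>M\<close> (\<open>symplectic_spectrum_char_poly\<close>). Conversely, if \<open>M\<close>
fits the cycle and is positive definite, the matrix with blocks \<open>M + I, I, I, I\<close> fits the corona and
shears to \<open>M \<oplus> I\<close> (\<open>symplectic_realization\<close>). So the question is which spectra occur for symmetric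
matrices of a cycle, that is, for periodic Jacobi matrices.

Restrictions. A null vector of a cycle matrix that vanishes at two adjacent vertices is zero, so no
eigenvalue is triple (\<open>cycle_eigenvalue_not_triple\<close>). Let \<open>l\<close> be a double eigenvalue and delete two
adjacent vertices. The remaining principal minor of \<open>l I - A\<close> is, on the one hand, a square times the
product of \<open>l - d\<close> over the other eigenvalues \<open>d\<close>; on the other hand, an eigenvector that vanishes at one
deleted vertex solves the path system, and Cramer's rule shows that the minor has the sign opposite to
that of the product of all edge weights. So this product of differences has the same sign for all
double eigenvalues (\<open>cycle_double_eigenvalue_sign\<close>): the numbers of eigenvalues below the double ones
have a common parity, which is the condition on the multiplicity list (\<open>cycle_spectrum_admissible\<close>).

Construction. Let \<open>l\<^sub>0 \<le> l\<^sub>1 \<le> \<dots>\<close> be the desired eigenvalues, \<open>f\<close> the monic polynomial with these roots, and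
\<open>\<mu>\<^sub>j\<close> the midpoints of consecutive \<open>l\<^sub>j\<close>, which are distinct. The matrix \<open>diag \<mu>\<close> bordered by a vector \<open>w\<close>
has characteristic polynomial \<open>f\<close> for a suitable corner entry, provided that
\<open>w\<^sub>j\<^sup>2 = - f(\<mu>\<^sub>j) / g'(\<mu>\<^sub>j)\<close> with \<open>g = \<Prod>\<^sub>i (X - \<mu>\<^sub>i)\<close>. Suppose that \<open>w = y + z\<close> with
\<open>y\<^sub>j z\<^sub>j = C / g'(\<mu>\<^sub>j)\<close> and \<open>C \<noteq> 0\<close>. The orthonormal polynomials for the weights \<open>y\<^sub>j\<^sup>2\<close> at the nodes \<open>\<mu>\<^sub>j\<close>
give an orthonormal basis in which \<open>diag \<mu>\<close> is a Jacobi matrix, \<open>y\<close> is a multiple of the first basis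
vector and \<open>z\<close> a multiple of the last, so the bordered matrix becomes a cycle matrix
(\<open>arrow_mat_orthogonally_similar_cycle\<close>). Such \<open>y\<close> and \<open>z\<close> exist if and only if the quadratic equations
\<open>t\<^sup>2 - w\<^sub>j t + C / g'(\<mu>\<^sub>j) = 0\<close> have real roots. For small \<open>C\<close> this can only fail where \<open>w\<^sub>j = 0\<close>, at the double
eigenvalues, and there it is a condition on the sign of \<open>C\<close>, which the parity condition makes
consistent (\<open>ex_cycle_matrix_with_char_poly\<close>).

The numerical parameters follow. A spectrum with one double value is attained and no value is triple,
and the same two facts give the maximum nullity. On the corona, a vertex's partner is one of its
neighbors, so the coupled rule and the leaf rule force in the same way; a set contained in one coupled
pair never forces a vertex outside the pair, while two adjacent cycle vertices force everything.
\<close>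

section \<open>Orthogonal diagonalization of real symmetric matrices\<close>

lemma self_scalar_prod_pos:
  fixes v :: "real vec"
  assumes "v \<in> carrier_vec n" "v \<noteq> 0\<^sub>v n"
  shows "v \<bullet> v > 0"
  using conjugate_square_greater_0_vec[OF assms(1)] assms by simp

text \<open>
Gram-Schmidt applied to a basis that starts with \<open>v\<close>, followed by normalization of the columns.
\<close>

lemma orthonormal_mat_with_first_col:
  fixes v :: "real vec"
  assumes v: "v \<in> carrier_vec n" and v1: "v \<bullet> v = 1"
  shows "\<exists>W \<in> carrier_mat n n. transpose_mat W * W = 1\<^sub>m n \<and> col W 0 = v"
proof -
  have v0: "v \<noteq> 0\<^sub>v n" using v1 by auto
  hence n: "n \<noteq> 0" using v by auto
  interpret cof_vec_space n "TYPE(real)" .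
  define ws where "ws = gram_schmidt n (basis_completion v)"
  from basis_completion[OF v v0]
  have bc: "set (basis_completion v) \<subseteq> carrier_vec n" "distinct (basis_completion v)"
      "lin_indpt (set (basis_completion v))"
    and len: "length (basis_completion v) = n" and hd: "hd (basis_completion v) = v" by auto
  from gram_schmidt_result[OF bc ws_def]
  have ws: "set ws \<subseteq> carrier_vec n" "corthogonal ws" "length ws = n" by (auto simp: len)
  have "ws ! 0 = v"
  proof -
    obtain vs where "basis_completion v = v # vs" using hd len n by (cases "basis_completion v") auto
    hence "hd ws = v" unfolding ws_def using gram_schmidt_hd[OF v] by metis
    thus ?thesis using ws(3) n by (metis hd_conv_nth list.size(3))
  qed
  define c where "c i = 1 / sqrt (ws ! i \<bullet> ws ! i)" for i
  have wsc: "ws ! i \<in> carrier_vec n" if "i < n" for i using ws that by auto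
  have orth: "(ws ! i \<bullet> ws ! j = 0) = (i \<noteq> j)" if "i < n" "j < n" for i j
    using corthogonalD[OF ws(2), of i j] that ws(3) by simp
  have pos: "ws ! i \<bullet> ws ! i > 0" if "i < n" for i
    using orth[OF that that] self_scalar_prod_pos[OF wsc[OF that]] wsc[OF that] by fastforce
  define W where "W = mat_of_cols n (map (\<lambda>i. c i \<cdot>\<^sub>v ws ! i) [0..<n])"
  have W: "W \<in> carrier_mat n n" unfolding W_def by (auto simp: mat_of_cols_def)
  have colW: "col W i = c i \<cdot>\<^sub>v ws ! i" if "i < n" for i
    unfolding W_def using that wsc by (subst col_mat_of_cols) auto
  have "transpose_mat W * W = 1\<^sub>m n"
  proof (rule eq_matI)
    fix i j assume "i < dim_row (1\<^sub>m n :: real mat)" "j < dim_col (1\<^sub>m n :: real mat)"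
    hence ij: "i < n" "j < n" by auto
    have "(transpose_mat W * W) $$ (i, j) = col W i \<bullet> col W j" using W ij by simp
    also have "\<dots> = c i * c j * (ws ! i \<bullet> ws ! j)"
      unfolding colW[OF ij(1)] colW[OF ij(2)] using wsc[OF ij(1)] wsc[OF ij(2)] by simp
    also have "\<dots> = 1\<^sub>m n $$ (i, j)"
      using orth[OF ij] pos[OF ij(1)] ij by (auto simp: c_def)
    finally show "(transpose_mat W * W) $$ (i, j) = 1\<^sub>m n $$ (i, j)" .
  qed (use W in auto)
  moreover have "col W 0 = v"
    using colW[of 0] n \<open>ws ! 0 = v\<close> v1 by (simp add: c_def)
  ultimately show ?thesis using W by auto
qed

text \<open>
The spectral theorem for a matrix whose characteristic polynomial is already known to split, with the
eigenvalues in any prescribed order. Deflation: in an orthonormal basis that starts with a unit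
eigenvector, symmetry makes the matrix block diagonal, and the second block has the remaining factors
as its characteristic polynomial.
\<close>

theorem real_symmetric_diagonalization:
  fixes A :: "real mat"
  assumes "A \<in> carrier_mat n n" and "transpose_mat A = A"
    and "char_poly A = (\<Prod>a\<leftarrow>es. [:- a, 1:])"
  shows "\<exists>Q \<in> carrier_mat n n. transpose_mat Q * Q = 1\<^sub>m n \<and>
           transpose_mat Q * A * Q = mat_diag n (\<lambda>i. es ! i)"
  using assms
proof (induction es arbitrary: n A)
  case Nil
  hence "n = 0" using degree_monic_char_poly[of A n] by auto
  thus ?case using Nil by (intro bexI[of _ "1\<^sub>m n"]) (auto simp: mat_diag_def)
next
  case (Cons e es)
  note A = Cons.prems(1) and sym = Cons.prems(2)
  let ?m = "n - 1"
  have "degree (char_poly A) = Suc (length es)"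
    unfolding Cons.prems(3) using degree_linear_factors[of uminus "e # es"] by simp
  hence n: "n = 1 + ?m" using degree_monic_char_poly[OF A] by auto
  have "eigenvalue A e" unfolding eigenvalue_root_char_poly[OF A] Cons.prems(3) by simp
  then obtain u where u: "u \<in> carrier_vec n" "u \<noteq> 0\<^sub>v n" "A *\<^sub>v u = e \<cdot>\<^sub>v u"
    unfolding eigenvalue_def eigenvector_def using A by auto
  have uu: "u \<bullet> u > 0"
    using u by (simp add: self_scalar_prod_pos)
  define v where "v = (1 / sqrt (u \<bullet> u)) \<cdot>\<^sub>v u"
  have v: "v \<in> carrier_vec n" "v \<bullet> v = 1" "A *\<^sub>v v = e \<cdot>\<^sub>v v"
    using u uu A by (auto simp: v_def mult_mat_vec smult_smult_assoc mult.commute)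
  obtain W where W: "W \<in> carrier_mat n n" "transpose_mat W * W = 1\<^sub>m n" "col W 0 = v"
    using orthonormal_mat_with_first_col[OF v(1,2)] by blast
  have WW: "W * transpose_mat W = 1\<^sub>m n"
    using mat_mult_left_right_inverse[OF _ W(1) W(2)] W(1) by auto
  define A' where "A' = transpose_mat W * A * W"
  have A': "A' \<in> carrier_mat n n" using A W by (auto simp: A'_def)
  have symA': "transpose_mat A' = A'"
    unfolding A'_def using A W sym by (simp add: transpose_mult[of _ n n _ n] assoc_mult_mat[of _ n n _ n _ n])
  have col0: "A' $$ (i, 0) = (if i = 0 then e else 0)" if "i < n" for i
  proof -
    have "A' $$ (i, 0) = (transpose_mat W * (A * W)) $$ (i, 0)"
      unfolding A'_def using A W by (simp add: assoc_mult_mat[of _ n n _ n _ n])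
    also have "\<dots> = col W i \<bullet> (A *\<^sub>v col W 0)" using that A W n by (simp add: mult_mat_vec_def)
    also have "\<dots> = e * (col W i \<bullet> col W 0)" unfolding W(3) v(3) using v W that by simp
    also have "col W i \<bullet> col W 0 = (transpose_mat W * W) $$ (i, 0)" using W(1) that n by simp
    finally show ?thesis unfolding W(2) using that n by auto
  qed
  have row0: "A' $$ (0, i) = (if i = 0 then e else 0)" if "i < n" for i
  proof -
    have "A' $$ (0, i) = transpose_mat A' $$ (i, 0)" using that A' n by simp
    thus ?thesis using col0[OF that] symA' by simp
  qed
  define A3 where "A3 = mat ?m ?m (\<lambda>(i, j). A' $$ (Suc i, Suc j))"
  have A3: "A3 \<in> carrier_mat ?m ?m" by (simp add: A3_def)
  have block: "A' = four_block_mat (mat 1 1 (\<lambda>_. e)) (0\<^sub>m 1 ?m) (0\<^sub>m ?m 1) A3"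
    by (rule eq_matI) (use A' n col0 row0 in \<open>auto simp: A3_def\<close>)
  have symA3: "transpose_mat A3 = A3"
  proof (rule eq_matI)
    fix i j assume "i < dim_row A3" "j < dim_col A3"
    hence ij: "Suc i < n" "Suc j < n" using A3 by auto
    have "A' $$ (Suc j, Suc i) = transpose_mat A' $$ (Suc i, Suc j)" using ij A' by simp
    thus "transpose_mat A3 $$ (i, j) = A3 $$ (i, j)" using symA' ij by (simp add: A3_def)
  qed (use A3 in auto)
  have "similar_mat A A'"
    unfolding similar_mat_def
    by (rule exI[of _ W], rule exI[of _ "transpose_mat W"], rule similar_mat_witI[of _ _ n])
       (use A W WW A' in \<open>auto simp: A'_def assoc_mult_mat[of _ n n _ n _ n]
          simp flip: assoc_mult_mat[of W n n "transpose_mat W" n _ n]\<close>)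
  hence "char_poly A' = [:- e, 1:] * (\<Prod>a\<leftarrow>es. [:- a, 1:])"
    using char_poly_similar Cons.prems(3) by fastforce
  also have "char_poly A' = char_poly (mat 1 1 (\<lambda>_. e)) * char_poly A3"
    unfolding block by (rule char_poly_four_block_zeros_col) (use A3 in auto)
  also have "char_poly (mat 1 1 (\<lambda>_. e)) = [:- e, 1:]"
    by (simp add: char_poly_defs det_def sign_def)
  finally have "char_poly A3 = (\<Prod>a\<leftarrow>es. [:- a, 1:])"
    by (metis mult_cancel_left pCons_eq_0_iff zero_neq_one)
  from Cons.IH[OF A3 symA3 this] obtain Q' where Q': "Q' \<in> carrier_mat ?m ?m"
      "transpose_mat Q' * Q' = 1\<^sub>m ?m" "transpose_mat Q' * A3 * Q' = mat_diag ?m (\<lambda>i. es ! i)"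
    by blast
  define P where "P = four_block_mat (1\<^sub>m 1) (0\<^sub>m 1 ?m) (0\<^sub>m ?m 1) Q'"
  have P: "P \<in> carrier_mat n n" using Q' n by (metis P_def four_block_carrier_mat one_carrier_mat)
  have Pt: "transpose_mat P = four_block_mat (1\<^sub>m 1) (0\<^sub>m 1 ?m) (0\<^sub>m ?m 1) (transpose_mat Q')"
    unfolding P_def using Q' by (subst transpose_four_block_mat[of _ 1 1 _ ?m _ ?m]) auto
  have PtP: "transpose_mat P * P = 1\<^sub>m n"
    unfolding Pt unfolding P_def using Q' n
    by (subst mult_four_block_mat[of _ 1 1 _ ?m _ ?m _ _ 1 _ ?m]) (auto simp: Q'(2))
  have PAP: "transpose_mat P * A' * P = mat_diag n (\<lambda>i. (e # es) ! i)"
  proof -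
    have "transpose_mat P * A' * P =
        four_block_mat (mat 1 1 (\<lambda>_. e)) (0\<^sub>m 1 ?m) (0\<^sub>m ?m 1) (transpose_mat Q' * A3 * Q')"
      unfolding Pt unfolding P_def block using Q' A3
      by (subst mult_four_block_mat[of _ 1 1 _ ?m _ ?m _ _ 1 _ ?m], auto)+
    also have "\<dots> = mat_diag n (\<lambda>i. (e # es) ! i)"
      unfolding Q'(3) by (rule eq_matI) (use n in \<open>auto simp: mat_diag_def nth_Cons'\<close>)
    finally show ?thesis .
  qed
  show ?case
  proof (intro bexI[of _ "W * P"] conjI)
    have t: "transpose_mat (W * P) = transpose_mat P * transpose_mat W"
      using W P by (simp add: transpose_mult[of _ n n _ n])
    have "transpose_mat (W * P) * (W * P) = transpose_mat P * (transpose_mat W * W) * P"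
      unfolding t using W(1) P by (simp add: assoc_mult_mat[of _ n n _ n _ n])
    thus "transpose_mat (W * P) * (W * P) = 1\<^sub>m n" using W(2) P PtP by simp
    have "transpose_mat (W * P) * A * (W * P) = transpose_mat P * A' * P"
      unfolding t A'_def using W(1) P A by (simp add: assoc_mult_mat[of _ n n _ n _ n])
    thus "transpose_mat (W * P) * A * (W * P) = mat_diag n (\<lambda>i. (e # es) ! i)" using PAP by simp
  qed (use W P in auto)
qed


section \<open>Multiple eigenvalues of symmetric matrices of a cycle\<close>

text \<open>
Only entries above the diagonal are described; symmetry covers the rest. For \<open>p \<ge> 3\<close> the vertices are
\<open>0, \<dots>, p - 1\<close> in cyclic order, and the closing edge joins \<open>0\<close> to \<open>p - 1\<close>.
\<close>

definition cycle_pattern :: "nat \<Rightarrow> real mat \<Rightarrow> bool" where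
  "cycle_pattern p A \<longleftrightarrow> A \<in> carrier_mat p p \<and> transpose_mat A = A \<and>
     (\<forall>i<p. \<forall>j<p. i < j \<longrightarrow> (A $$ (i, j) \<noteq> 0 \<longleftrightarrow> j = Suc i \<or> i = 0 \<and> j = p - 1))"

lemma cycle_pattern_sym:
  assumes "cycle_pattern p A" "i < p" "j < p"
  shows "A $$ (i, j) = A $$ (j, i)"
proof -
  have "A $$ (i, j) = transpose_mat A $$ (i, j)" using assms by (simp add: cycle_pattern_def)
  also have "\<dots> = A $$ (j, i)" using assms(2,3) carrier_matD[of A p p] assms(1)[unfolded cycle_pattern_def] by (metis index_transpose_mat(1))
  finally show ?thesis .
qed

lemma cycle_pattern_entry:
  assumes "cycle_pattern p A" "i < j" "j < p"
  shows "A $$ (i, j) \<noteq> 0 \<longleftrightarrow> j = Suc i \<or> i = 0 \<and> j = p - 1"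
proof -
  have "i < p" using assms by simp
  thus ?thesis using assms unfolding cycle_pattern_def by blast
qed

text \<open>
The entries propagate along the cycle: once \<open>x\<close> vanishes at \<open>p - 1\<close> and at \<open>0, \<dots>, i\<close>, the row of vertex
\<open>i\<close> reads \<open>A $$ (i, i + 1) * x (i + 1) = 0\<close>.
\<close>

lemma cycle_kernel_eq_0:
  fixes x :: "nat \<Rightarrow> real"
  assumes A: "cycle_pattern p A" and p: "3 \<le> p"
    and ker: "\<And>i. i < p \<Longrightarrow> (\<Sum>j<p. A $$ (i, j) * x j) = l * x i"
    and x0: "x 0 = 0" and xlast: "x (p - 1) = 0"
    and i: "i < p"
  shows "x i = 0"
  using i
proof (induction i rule: less_induct)
  case (less k)
  show ?case
  proof (cases k)
    case 0
    thus ?thesis using x0 by simp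
  next
    case (Suc i)
    have rest: "A $$ (i, j) * x j = 0" if "j < p" "j \<noteq> Suc i" for j
    proof (cases "j \<le> i")
      case True
      thus ?thesis using less Suc that by simp
    next
      case False
      hence "i < j" "A $$ (i, j) \<noteq> 0 \<longrightarrow> i = 0 \<and> j = p - 1"
        using cycle_pattern_entry[OF A, of i j] that by auto
      thus ?thesis using xlast by auto
    qed
    have "0 = l * x i" using less Suc by simp
    also have "\<dots> = (\<Sum>j<p. A $$ (i, j) * x j)" using ker[of i] less.prems Suc by simp
    also have "\<dots> = A $$ (i, Suc i) * x (Suc i)"
      using less.prems Suc rest by (subst sum.remove[of _ "Suc i"]) (auto intro!: sum.neutral simp del: mult_eq_0_iff)
    finally show ?thesis using cycle_pattern_entry[OF A, of i "Suc i"] less.prems Suc by auto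
  qed
qed

lemma two_equations_three_unknowns:
  fixes a b c a' b' c' :: real
  shows "\<exists>s t r. (s \<noteq> 0 \<or> t \<noteq> 0 \<or> r \<noteq> 0) \<and> s * a + t * b + r * c = 0 \<and> s * a' + t * b' + r * c' = 0"
proof -
  have *: "\<exists>s t r. (s \<noteq> 0 \<or> t \<noteq> 0 \<or> r \<noteq> 0) \<and> s * a + t * b + r * c = 0 \<and> s * a' + t * b' + r * c' = 0"
    if "a \<noteq> 0" for a a' b b' c c' :: real
  proof -
    let ?B = "b' * a - a' * b" and ?C = "c' * a - a' * c"
    have "\<exists>t r. (t \<noteq> 0 \<or> r \<noteq> 0) \<and> t * ?B + r * ?C = 0"
    proof (cases "?B = 0 \<and> ?C = 0")
      case True
      thus ?thesis by (intro exI[of _ 1] exI[of _ 0]) simp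
    next
      case False
      moreover have "?C * ?B + (- ?B) * ?C = 0"
        by (simp only: mult_minus_left mult.commute[of ?C ?B] add.right_inverse)
      ultimately show ?thesis by (intro exI[of _ ?C] exI[of _ "- ?B"]) linarith
    qed
    then obtain t r where nz: "t \<noteq> 0 \<or> r \<noteq> 0" and eq: "t * ?B + r * ?C = 0" by (elim exE conjE)
    define s where "s = - (t * b + r * c) / a"
    have s: "s * a = - (t * b + r * c)" using \<open>a \<noteq> 0\<close> by (simp add: s_def)
    have "(s * a' + t * b' + r * c') * a = (s * a) * a' + (t * b' + r * c') * a"
      by (simp only: ring_distribs mult_ac)
    also have "\<dots> = t * ?B + r * ?C" unfolding s by (simp add: algebra_simps)
    finally have "s * a' + t * b' + r * c' = 0" using eq \<open>a \<noteq> 0\<close> by simp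
    moreover have "s * a + t * b + r * c = 0" using s by simp
    ultimately show ?thesis using nz by (intro exI[of _ s] exI[of _ t] exI[of _ r]) simp
  qed
  consider "a \<noteq> 0" | "a' \<noteq> 0" | "a = 0" "a' = 0" by blast
  thus ?thesis
  proof cases
    case 1
    thus ?thesis by (rule *)
  next
    case 2
    from *[OF this, of b' c' a b c] obtain s t r where
      "s \<noteq> 0 \<or> t \<noteq> 0 \<or> r \<noteq> 0" "s * a' + t * b' + r * c' = 0" "s * a + t * b + r * c = 0"
      by (elim exE conjE)
    thus ?thesis by (intro exI conjI)
  next
    case 3
    thus ?thesis by (intro exI[of _ 1] exI[of _ 0]) simp
  qed
qed

text \<open>
The matrix identities \<open>Q\<^sup>T Q = I\<close>, \<open>Q Q\<^sup>T = I\<close>, \<open>A Q = Q D\<close> and \<open>A = Q D Q\<^sup>T\<close> as sums of entries.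
\<close>

lemma orthonormal_eigenbasis_entries:
  fixes A Q :: "real mat"
  assumes A: "A \<in> carrier_mat p p" and Q: "Q \<in> carrier_mat p p"
    and QQ: "transpose_mat Q * Q = 1\<^sub>m p" and QAQ: "transpose_mat Q * A * Q = mat_diag p d"
  shows "\<And>k l. k < p \<Longrightarrow> l < p \<Longrightarrow> (\<Sum>i<p. Q $$ (i, k) * Q $$ (i, l)) = (if k = l then 1 else 0)"
    and "\<And>i j. i < p \<Longrightarrow> j < p \<Longrightarrow> (\<Sum>k<p. Q $$ (i, k) * Q $$ (j, k)) = (if i = j then 1 else 0)"
    and "\<And>i k. i < p \<Longrightarrow> k < p \<Longrightarrow> (\<Sum>j<p. A $$ (i, j) * Q $$ (j, k)) = d k * Q $$ (i, k)"
    and "\<And>i j. i < p \<Longrightarrow> j < p \<Longrightarrow> A $$ (i, j) = (\<Sum>k<p. d k * Q $$ (i, k) * Q $$ (j, k))"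
proof -
  have Qt: "transpose_mat Q \<in> carrier_mat p p" using Q by simp
  have QQ': "Q * transpose_mat Q = 1\<^sub>m p"
    using mat_mult_left_right_inverse[OF Qt Q QQ] .
  have AQ: "A * Q = Q * mat_diag p d"
  proof -
    have "Q * mat_diag p d = (Q * transpose_mat Q) * (A * Q)"
      unfolding QAQ[symmetric] using A Q by (simp add: assoc_mult_mat[of _ p p _ p _ p])
    thus ?thesis unfolding QQ' using A Q by simp
  qed
  have AA: "A = Q * mat_diag p d * transpose_mat Q"
  proof -
    have "A * Q * transpose_mat Q = A * (Q * transpose_mat Q)"
      using A Q by (simp add: assoc_mult_mat[of _ p p _ p _ p])
    thus ?thesis using AQ QQ' A by simp
  qed
  show "(\<Sum>i<p. Q $$ (i, k) * Q $$ (i, l)) = (if k = l then 1 else 0)" if "k < p" "l < p" for k l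
    using arg_cong[OF QQ, of "\<lambda>M. M $$ (k, l)"] that Q
    by (simp add: scalar_prod_def atLeast0LessThan)
  show "(\<Sum>k<p. Q $$ (i, k) * Q $$ (j, k)) = (if i = j then 1 else 0)" if "i < p" "j < p" for i j
    using arg_cong[OF QQ', of "\<lambda>M. M $$ (i, j)"] that Q
    by (simp add: scalar_prod_def atLeast0LessThan)
  show "(\<Sum>j<p. A $$ (i, j) * Q $$ (j, k)) = d k * Q $$ (i, k)" if "i < p" "k < p" for i k
    using arg_cong[OF AQ, of "\<lambda>M. M $$ (i, k)"] that Q A
    by (simp add: mat_diag_mult_right[of _ p] scalar_prod_def atLeast0LessThan mult.commute)
  show "A $$ (i, j) = (\<Sum>k<p. d k * Q $$ (i, k) * Q $$ (j, k))" if "i < p" "j < p" for i j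
    using arg_cong[OF AA, of "\<lambda>M. M $$ (i, j)"] that Q
    by (simp add: mat_diag_mult_right[of _ p] scalar_prod_def atLeast0LessThan mult_ac)
qed

text \<open>
In a three-dimensional eigenspace some nonzero combination would vanish at the adjacent vertices \<open>0\<close> and
\<open>p - 1\<close>.
\<close>

lemma cycle_eigenvalue_not_triple:
  assumes A: "cycle_pattern p A" and p: "3 \<le> p"
    and orth: "\<And>k l. k < p \<Longrightarrow> l < p \<Longrightarrow> (\<Sum>i<p. q i k * q i l) = (if k = l then 1 else 0)"
    and eig: "\<And>i k. i < p \<Longrightarrow> k < p \<Longrightarrow> (\<Sum>j<p. A $$ (i, j) * q j k) = d k * q i k"
    and "a < p" "b < p" "c < p" "a \<noteq> b" "a \<noteq> c" "b \<noteq> c"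
  shows "\<not> (d a = d b \<and> d a = (d c :: real))"
proof
  assume d: "d a = d b \<and> d a = d c"
  obtain s t r where str: "s \<noteq> 0 \<or> t \<noteq> 0 \<or> r \<noteq> 0"
    "s * q 0 a + t * q 0 b + r * q 0 c = 0"
    "s * q (p-1) a + t * q (p-1) b + r * q (p-1) c = 0"
    using two_equations_three_unknowns[of "q 0 a" "q 0 b" "q 0 c" "q (p-1) a" "q (p-1) b" "q (p-1) c"]
    by (elim exE conjE)
  define x where "x i = s * q i a + t * q i b + r * q i c" for i
  have dd: "d b = d a" "d c = d a" using d by auto
  have x: "x i = 0" if "i < p" for i
  proof (rule cycle_kernel_eq_0[OF A p _ _ _ that, where l = "d a"])
    fix i assume i: "i < p"
    have "(\<Sum>j<p. A $$ (i, j) * x j) = s * (\<Sum>j<p. A $$ (i, j) * q j a)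
        + t * (\<Sum>j<p. A $$ (i, j) * q j b) + r * (\<Sum>j<p. A $$ (i, j) * q j c)"
      by (simp add: x_def sum_distrib_left sum.distrib algebra_simps)
    also have "\<dots> = d a * x i"
      unfolding eig[OF i \<open>a < p\<close>] eig[OF i \<open>b < p\<close>] eig[OF i \<open>c < p\<close>] dd
      by (simp add: x_def algebra_simps)
    finally show "(\<Sum>j<p. A $$ (i, j) * x j) = d a * x i" .
  next
    show "x 0 = 0" "x (p - 1) = 0" unfolding x_def by (rule str)+
  qed
  have "(\<Sum>i<p. x i * q i k) = s * (\<Sum>i<p. q i a * q i k) + t * (\<Sum>i<p. q i b * q i k)
      + r * (\<Sum>i<p. q i c * q i k)" for k
    by (simp add: x_def sum_distrib_left sum.distrib algebra_simps)
  from this[symmetric] have "s * (\<Sum>i<p. q i a * q i k) + t * (\<Sum>i<p. q i b * q i k)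
      + r * (\<Sum>i<p. q i c * q i k) = 0" for k
    by (simp add: x)
  from this[of a] this[of b] this[of c] show False
    using str(1) orth[OF \<open>a < p\<close>] orth[OF \<open>b < p\<close>] orth[OF \<open>c < p\<close>] assms(5-) by simp
qed

text \<open>
Cramer's rule on the path \<open>1, \<dots>, p - 2\<close>. Since \<open>y\<close> vanishes at \<open>p - 1\<close>, its restriction to the path is
mapped by \<open>B\<close> to a vector supported at the first path vertex, and the cofactor of the corner of a
tridiagonal matrix is a product of off-diagonal entries.
\<close>

lemma path_minor_of_cycle:
  fixes y :: "nat \<Rightarrow> real"
  assumes A: "cycle_pattern p A" and p: "3 \<le> p"
    and ker: "\<And>i. i < p \<Longrightarrow> (\<Sum>j<p. A $$ (i, j) * y j) = l * y i"
    and ylast: "y (p - 1) = 0"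
  defines "B \<equiv> mat (p - 2) (p - 2) (\<lambda>(i, j). (if i = j then l else 0) - A $$ (Suc i, Suc j))"
  shows "det B * y (p - 2) = y 0 * (\<Prod>i<p - 2. A $$ (i, Suc i))"
proof -
  define n where "n = p - 3"
  have pn: "p - 2 = Suc n" "p - 1 = Suc (Suc n)" "p = Suc (Suc (Suc n))" using p by (auto simp: n_def)
  have B: "B \<in> carrier_mat (Suc n) (Suc n)" by (simp add: B_def pn)
  have Bij: "B $$ (i, j) = (if i = j then l else 0) - A $$ (Suc i, Suc j)"
    if "i < Suc n" "j < Suc n" for i j using that by (simp add: B_def pn)
  have A0: "A $$ (i, j) = 0" if "i < p" "j < p" "i < j" "j \<noteq> Suc i" "j < p - 1 \<or> 0 < i" for i j
    using cycle_pattern_entry[OF A, of i j] that by auto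
  note sym = cycle_pattern_sym[OF A]
  \<comment> \<open>\<open>Y\<close> is the identity with last column replaced by \<open>y\<close> on the path, so \<open>det Y = y (p - 2)\<close>.\<close>
  define Y where "Y = mat (Suc n) (Suc n) (\<lambda>(i, j). if j = n then y (Suc i) else if i = j then 1 else 0)"
  have Y: "Y \<in> carrier_mat (Suc n) (Suc n)" by (simp add: Y_def)
  have "det Y = prod_list (diag_mat Y)"
    by (rule det_upper_triangular[OF _ Y]) (auto simp: Y_def)
  also have "\<dots> = (\<Prod>i<Suc n. Y $$ (i, i))"
    using Y by (simp add: prod_list_diag_prod atLeast0LessThan)
  also have "\<dots> = y (p - 2)" by (simp add: Y_def pn)
  finally have detY: "det Y = y (p - 2)" .
  have col: "(B * Y) $$ (i, j) = B $$ (i, j)" if "i < Suc n" "j < n" for i j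
  proof -
    have "(B * Y) $$ (i, j) = (\<Sum>k<Suc n. B $$ (i, k) * (if k = j then 1 else 0))"
      using that B Y by (auto simp: scalar_prod_def Y_def atLeast0LessThan intro!: sum.cong)
    also have "\<dots> = B $$ (i, j)"
      using that by (subst sum.remove[of _ j]) (auto intro!: sum.neutral)
    finally show ?thesis .
  qed
  have lastcol: "(B * Y) $$ (i, n) = A $$ (Suc i, 0) * y 0" if "i < Suc n" for i
  proof -
    have "(B * Y) $$ (i, n) = (\<Sum>k<Suc n. B $$ (i, k) * y (Suc k))"
      using that B Y by (auto simp: scalar_prod_def Y_def atLeast0LessThan intro!: sum.cong)
    also have "\<dots> = (\<Sum>k<Suc n. (if i = k then l * y (Suc k) else 0)) - (\<Sum>k<Suc n. A $$ (Suc i, Suc k) * y (Suc k))"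
      unfolding sum_subtractf[symmetric] using that
      by (intro sum.cong refl) (simp add: Bij left_diff_distrib)
    also have "(\<Sum>k<Suc n. (if i = k then l * y (Suc k) else 0)) = l * y (Suc i)"
      using that by simp
    also have "(\<Sum>k<Suc n. A $$ (Suc i, Suc k) * y (Suc k)) = l * y (Suc i) - A $$ (Suc i, 0) * y 0"
    proof -
      have "l * y (Suc i) = (\<Sum>j<Suc (Suc (Suc n)). A $$ (Suc i, j) * y j)"
        using ker[of "Suc i"] that pn by simp
      also have "\<dots> = (\<Sum>j<Suc (Suc n). A $$ (Suc i, j) * y j)" using ylast pn by simp
      also have "\<dots> = A $$ (Suc i, 0) * y 0 + (\<Sum>k<Suc n. A $$ (Suc i, Suc k) * y (Suc k))"
        by (rule sum.lessThan_Suc_shift)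
      finally show ?thesis by linarith
    qed
    finally show ?thesis by simp
  qed
  have BY: "B * Y \<in> carrier_mat (Suc n) (Suc n)" using B Y by simp
  have "det (B * Y) = (\<Sum>i<Suc n. (B * Y) $$ (i, n) * cofactor (B * Y) i n)"
    by (rule laplace_expansion_column[OF BY]) simp
  also have "\<dots> = (B * Y) $$ (0, n) * cofactor (B * Y) 0 n"
    using A0 sym pn lastcol by (subst sum.remove[of _ 0]) (auto intro!: sum.neutral)
  also have "(B * Y) $$ (0, n) = y 0 * A $$ (0, 1)" using lastcol[of 0] sym[of 1 0] pn by simp
  also have "cofactor (B * Y) 0 n = (\<Prod>i<n. A $$ (Suc i, Suc (Suc i)))"
  proof -
    let ?E = "mat_delete (B * Y) 0 n"
    have E: "?E \<in> carrier_mat n n" using BY mat_delete_carrier[of "B * Y" "Suc n" "Suc n" 0 n] by simp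
    have Eij: "?E $$ (i, j) = B $$ (Suc i, j)" if "i < n" "j < n" for i j
      using that BY B Y col[of "Suc i" j] by (simp add: mat_delete_def)
    have "det ?E = prod_list (diag_mat ?E)"
    proof (rule det_upper_triangular[OF _ E], rule upper_triangularI)
      fix i j assume "j < i" "i < dim_row ?E"
      thus "?E $$ (i, j) = 0" using E Eij Bij pn A0[of "Suc j" "Suc (Suc i)"] sym[of "Suc j" "Suc (Suc i)"] by auto
    qed
    also have "\<dots> = (\<Prod>i<n. ?E $$ (i, i))"
      using carrier_matD(1)[OF E] unfolding prod_list_diag_prod atLeast0LessThan by metis
    also have "\<dots> = (\<Prod>i<n. - A $$ (Suc i, Suc (Suc i)))"
    proof (rule prod.cong[OF refl])
      fix i assume i: "i \<in> {..<n}"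
      thus "?E $$ (i, i) = - A $$ (Suc i, Suc (Suc i))"
        using Eij[of i i] Bij[of "Suc i" i] sym[of "Suc i" "Suc (Suc i)"] pn by simp
    qed
    also have "\<dots> = (-1) ^ n * (\<Prod>i<n. A $$ (Suc i, Suc (Suc i)))"
      by (simp add: prod_uminus)
    finally show ?thesis by (simp add: cofactor_def mult.assoc[symmetric] power_add[symmetric])
  qed
  also have "y 0 * A $$ (0, 1) * (\<Prod>i<n. A $$ (Suc i, Suc (Suc i))) = y 0 * (\<Prod>i<p - 2. A $$ (i, Suc i))"
    unfolding pn(1) by (simp add: prod.lessThan_Suc_shift del: prod.lessThan_Suc)
  finally show ?thesis using det_mult[OF B Y] detY by simp
qed

text \<open>
The sign rule for double eigenvalues. The minor on the path \<open>1, \<dots>, p - 2\<close> of \<open>l I - A\<close> equals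
\<open>(det Y)\<^sup>2 \<Prod>\<^sub>k (l - d\<^sub>k)\<close>, the product over the other eigenvalues. Its other value comes from an eigenvector
that vanishes at \<open>p - 1\<close>: the row of \<open>p - 1\<close> relates the entries at \<open>0\<close> and \<open>p - 2\<close>, which closes the cycle
and turns the path product into minus the product of all edge weights, up to a square.
\<close>

lemma cycle_double_eigenvalue_sign:
  fixes d :: "nat \<Rightarrow> real"
  assumes A: "cycle_pattern p A" and p: "3 \<le> p"
    and Q: "Q \<in> carrier_mat p p" "transpose_mat Q * Q = 1\<^sub>m p" "transpose_mat Q * A * Q = mat_diag p d"
    and d: "d (p - 2) = l" "d (p - 1) = l"
  shows "(\<Prod>k<p - 2. l - d k) * ((\<Prod>i<p - 1. A $$ (i, Suc i)) * A $$ (0, p - 1)) < 0"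
proof -
  have cA: "A \<in> carrier_mat p p" using A by (simp add: cycle_pattern_def)
  note ent = orthonormal_eigenbasis_entries[OF cA Q]
  let ?n = "p - 2"
  define B where "B = mat ?n ?n (\<lambda>(i, j). (if i = j then l else 0) - A $$ (Suc i, Suc j))"
  define Y where "Y = mat ?n ?n (\<lambda>(i, k). Q $$ (Suc i, k))"
  have Y: "Y \<in> carrier_mat ?n ?n" by (simp add: Y_def)
  \<comment> \<open>The two columns of \<open>Q\<close> that belong to \<open>l\<close> have weight \<open>l - l = 0\<close> and drop out.\<close>
  have B: "B = Y * mat_diag ?n (\<lambda>k. l - d k) * transpose_mat Y"
  proof (rule eq_matI)
    fix i j assume "i < dim_row (Y * mat_diag ?n (\<lambda>k. l - d k) * transpose_mat Y)"
      "j < dim_col (Y * mat_diag ?n (\<lambda>k. l - d k) * transpose_mat Y)"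
    hence ij: "i < ?n" "j < ?n" by (auto simp: Y_def)
    hence ij': "Suc i < p" "Suc j < p" by auto
    have "B $$ (i, j) = l * (\<Sum>k<p. Q $$ (Suc i, k) * Q $$ (Suc j, k))
        - (\<Sum>k<p. d k * Q $$ (Suc i, k) * Q $$ (Suc j, k))"
      unfolding ent(2)[OF ij'] ent(4)[OF ij', symmetric] using ij by (simp add: B_def)
    also have "\<dots> = (\<Sum>k<p. (l - d k) * Q $$ (Suc i, k) * Q $$ (Suc j, k))"
      by (simp only: sum_distrib_left sum_subtractf[symmetric] left_diff_distrib mult.assoc)
    also have "\<dots> = (\<Sum>k<?n. (l - d k) * Q $$ (Suc i, k) * Q $$ (Suc j, k))"
    proof (rule sum.mono_neutral_right)
      show "\<forall>k\<in>{..<p} - {..<?n}. (l - d k) * Q $$ (Suc i, k) * Q $$ (Suc j, k) = 0"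
      proof
        fix k assume "k \<in> {..<p} - {..<?n}"
        hence "k = p - 1 \<or> k = p - 2" by auto
        thus "(l - d k) * Q $$ (Suc i, k) * Q $$ (Suc j, k) = 0" by (elim disjE) (simp_all only: d, simp_all)
      qed
    qed auto
    also have "\<dots> = (\<Sum>k<?n. Y $$ (i, k) * (l - d k) * Y $$ (j, k))"
      by (rule sum.cong) (use ij in \<open>simp_all add: Y_def\<close>)
    also have "\<dots> = (Y * mat_diag ?n (\<lambda>k. l - d k) * transpose_mat Y) $$ (i, j)"
      unfolding mat_diag_mult_right[OF Y] using ij carrier_matD[OF Y]
      by (simp add: scalar_prod_def atLeast0LessThan)
    finally show "B $$ (i, j) = (Y * mat_diag ?n (\<lambda>k. l - d k) * transpose_mat Y) $$ (i, j)" .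
  qed (auto simp: B_def Y_def)
  have "det (mat_diag ?n (\<lambda>k. l - d k)) = (\<Prod>k<?n. l - d k)"
    by (subst det_upper_triangular[of _ ?n])
       (auto simp: mat_diag_def prod_list_diag_prod atLeast0LessThan)
  hence detB: "det B = (det Y)\<^sup>2 * (\<Prod>k<?n. l - d k)"
    unfolding B using Y by (simp add: det_mult[of _ ?n] det_transpose power2_eq_square)
  let ?u = "\<lambda>i. Q $$ (i, p - 2)" and ?v = "\<lambda>i. Q $$ (i, p - 1)"
  \<comment> \<open>Some combination of the two eigenvectors for \<open>l\<close> vanishes at the vertex \<open>p - 1\<close>.\<close>
  have "\<exists>s t. (s \<noteq> 0 \<or> t \<noteq> 0) \<and> s * ?u (p - 1) + t * ?v (p - 1) = 0"
  proof (cases "?u (p - 1) = 0")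
    case True
    thus ?thesis by (intro exI[of _ 1] exI[of _ 0]) simp
  next
    case False
    thus ?thesis by (intro exI[of _ "?v (p - 1)"] exI[of _ "- ?u (p - 1)"]) simp
  qed
  then obtain s t where st: "s \<noteq> 0 \<or> t \<noteq> 0" "s * ?u (p - 1) + t * ?v (p - 1) = 0"
    by (elim exE conjE)
  define y where "y i = s * ?u i + t * ?v i" for i
  have ylast: "y (p - 1) = 0" unfolding y_def by (rule st)
  have lt: "p - 2 < p" "p - 1 < p" "p - 1 \<noteq> p - 2" using p by auto
  have y0: "\<exists>i<p. y i \<noteq> 0"
  proof (rule ccontr)
    assume "\<not> ?thesis"
    hence z: "y i = 0" if "i < p" for i using that by blast
    have "(\<Sum>i<p. y i * ?u i) = s * (\<Sum>i<p. ?u i * ?u i) + t * (\<Sum>i<p. ?v i * ?u i)"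
      "(\<Sum>i<p. y i * ?v i) = s * (\<Sum>i<p. ?u i * ?v i) + t * (\<Sum>i<p. ?v i * ?v i)"
      by (simp_all add: y_def sum_distrib_left sum.distrib algebra_simps)
    hence "(\<Sum>i<p. y i * ?u i) = s" "(\<Sum>i<p. y i * ?v i) = t"
      unfolding ent(1)[OF lt(1,1)] ent(1)[OF lt(1,2)] ent(1)[OF lt(2,1)] ent(1)[OF lt(2,2)]
      using lt(3) by simp_all
    thus False using st(1) by (simp add: z)
  qed
  have ker: "(\<Sum>j<p. A $$ (i, j) * y j) = l * y i" if "i < p" for i
  proof -
    have "(\<Sum>j<p. A $$ (i, j) * y j) =
       s * (\<Sum>j<p. A $$ (i, j) * ?u j) + t * (\<Sum>j<p. A $$ (i, j) * ?v j)"
      by (simp add: y_def sum_distrib_left sum.distrib algebra_simps)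
    thus ?thesis unfolding ent(3)[OF that lt(1)] ent(3)[OF that lt(2)] d y_def
      by (simp add: algebra_simps)
  qed
  have "y 0 \<noteq> 0" using cycle_kernel_eq_0[OF A p ker _ ylast] y0 by metis
  let ?P = "\<Prod>i<p - 2. A $$ (i, Suc i)"
  let ?c = "A $$ (0, p - 1)" and ?b = "A $$ (p - 2, p - 1)"
  have minor: "det B * y (p - 2) = y 0 * ?P"
    unfolding B_def by (rule path_minor_of_cycle[OF A p ker ylast])
  have last_row: "?b * y (p - 2) = - ?c * y 0"
  proof -
    have "0 = (\<Sum>j<p. A $$ (p - 1, j) * y j)" using ker[of "p - 1"] ylast p by simp
    also have "\<dots> = A $$ (p - 1, 0) * y 0 + A $$ (p - 1, p - 2) * y (p - 2)"
    proof -
      have "A $$ (p - 1, j) * y j = 0" if "j < p" "j \<noteq> 0" "j \<noteq> p - 2" for j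
      proof (cases "j = p - 1")
        case False
        hence "j < p - 1" "p - 1 < p" "p - 1 \<noteq> Suc j" using that by auto
        hence "A $$ (j, p - 1) = 0" using cycle_pattern_entry[OF A, of j "p - 1"] that(2) by blast
        thus ?thesis using cycle_pattern_sym[OF A, of j "p - 1"] that by simp
      qed (simp add: ylast del: One_nat_def)
      hence "(\<Sum>j<p. A $$ (p - 1, j) * y j) = (\<Sum>j\<in>{0, p - 2}. A $$ (p - 1, j) * y j)"
        using p by (intro sum.mono_neutral_right) auto
      also have "\<dots> = A $$ (p - 1, 0) * y 0 + A $$ (p - 1, p - 2) * y (p - 2)"
        using p by (subst sum.insert) auto
      finally show ?thesis .
    qed
    finally show ?thesis
      using cycle_pattern_sym[OF A, of 0 "p - 1"] cycle_pattern_sym[OF A, of "p - 2" "p - 1"] p by simp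
  qed
  have "A $$ (i, Suc i) \<noteq> 0" if "i < p - 2" for i
    using cycle_pattern_entry[OF A, of i "Suc i"] that by simp
  hence nzP: "?P \<noteq> 0" by simp
  have nzc: "?c \<noteq> 0" using cycle_pattern_entry[OF A, of 0 "p - 1"] p by fastforce
  have "p - 2 < p - 1" "p - 1 < p" "p - 1 = Suc (p - 2)" using p by auto
  hence nzb: "?b \<noteq> 0" using cycle_pattern_entry[OF A, of "p - 2" "p - 1"] by blast
  note nz = nzP nzc nzb
  have full: "(\<Prod>i<p - 1. A $$ (i, Suc i)) = ?P * ?b"
  proof -
    have *: "Suc (p - 2) = p - 1" using p by simp
    show ?thesis using prod.lessThan_Suc[of "\<lambda>i. A $$ (i, Suc i)" "p - 2"] unfolding * .
  qed
  have "det B * (- ?c * y 0) = ?b * (det B * y (p - 2))" unfolding last_row[symmetric] by simp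
  also have "\<dots> = ?b * ?P * y 0" unfolding minor by simp
  finally have "(det B * ?c) * y 0 = (- ?b * ?P) * y 0" by simp
  hence c: "det B * ?c = - ?b * ?P" using \<open>y 0 \<noteq> 0\<close> unfolding mult_cancel_right by blast
  have "det B * (?P * ?b * ?c) = (det B * ?c) * (?b * ?P)" by simp
  also have "\<dots> = - (?b * ?P)\<^sup>2" unfolding c by (simp add: power2_eq_square)
  finally have "det B * (?P * ?b * ?c) = - (?b * ?P)\<^sup>2" .
  moreover have "- (?b * ?P)\<^sup>2 < 0" using nz by simp
  ultimately have "det B * (?P * ?b * ?c) < 0" by (simp only:)
  hence neg: "(det Y)\<^sup>2 * ((\<Prod>k<?n. l - d k) * (?P * ?b * ?c)) < 0"
    unfolding detB by (simp only: mult.assoc)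
  have "(\<Prod>k<?n. l - d k) * (?P * ?b * ?c) < 0"
  proof (rule ccontr)
    assume "\<not> ?thesis"
    hence "0 \<le> (det Y)\<^sup>2 * ((\<Prod>k<?n. l - d k) * (?P * ?b * ?c))"
      by (intro mult_nonneg_nonneg[OF zero_le_power2]) linarith
    with neg show False by linarith
  qed
  thus ?thesis unfolding full .
qed


section \<open>Lagrange interpolation and discrete orthogonal polynomials\<close>

text \<open>
The derivative of \<open>\<Prod>\<^sub>i (X - \<mu> i)\<close> at the node \<open>\<mu> j\<close>.
\<close>

definition node_product :: "nat \<Rightarrow> (nat \<Rightarrow> real) \<Rightarrow> nat \<Rightarrow> real" where
  "node_product n \<mu> j = (\<Prod>i\<in>{..<n} - {j}. \<mu> j - \<mu> i)"

definition lagrange_factor :: "nat \<Rightarrow> (nat \<Rightarrow> real) \<Rightarrow> nat \<Rightarrow> real poly" where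
  "lagrange_factor n \<mu> j = (\<Prod>i\<in>{..<n} - {j}. [:- \<mu> i, 1:])"

lemma node_product_nonzero:
  assumes "inj_on \<mu> {..<n}" "j < n"
  shows "node_product n \<mu> j \<noteq> 0"
  using assms by (auto simp: node_product_def dest: inj_onD)

lemma poly_lagrange_factor:
  assumes "j < n" "k < n"
  shows "poly (lagrange_factor n \<mu> j) (\<mu> k) = (if k = j then node_product n \<mu> j else 0)"
  using assms by (auto simp: lagrange_factor_def node_product_def poly_prod)

lemma monic_prod_linear:
  fixes \<mu> :: "nat \<Rightarrow> real"
  assumes "finite I"
  shows "degree (\<Prod>i\<in>I. [:- \<mu> i, 1:]) = card I" "lead_coeff (\<Prod>i\<in>I. [:- \<mu> i, 1:]) = 1"
proof -
  show "degree (\<Prod>i\<in>I. [:- \<mu> i, 1:]) = card I"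
    using assms by (subst degree_prod_eq_sum_degree) auto
  show "lead_coeff (\<Prod>i\<in>I. [:- \<mu> i, 1:]) = 1"
    by (simp add: lead_coeff_prod)
qed

lemma poly_eqI_on_inj_points:
  fixes p q :: "real poly"
  assumes inj: "inj_on \<mu> {..<n}" and deg: "degree p < n" "degree q < n"
    and eq: "\<And>j. j < n \<Longrightarrow> poly p (\<mu> j) = poly q (\<mu> j)"
  shows "p = q"
proof (rule ccontr)
  assume "p \<noteq> q"
  hence nz: "p - q \<noteq> 0" by simp
  have "card (\<mu> ` {..<n}) \<le> card {x. poly (p - q) x = 0}"
    using poly_roots_finite[OF nz] eq by (intro card_mono) auto
  also have "\<dots> \<le> degree (p - q)" by (rule card_poly_roots_bound[OF nz])
  also have "\<dots> < n" using degree_diff_less deg by blast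
  finally show False using inj by (simp add: card_image)
qed

lemma lagrange_interpolation:
  assumes inj: "inj_on \<mu> {..<n}" and deg: "degree p < n"
  shows "p = (\<Sum>j<n. smult (poly p (\<mu> j) / node_product n \<mu> j) (lagrange_factor n \<mu> j))"
proof (rule poly_eqI_on_inj_points[OF inj deg])
  have "degree (lagrange_factor n \<mu> j) < n" if "j < n" for j
    using monic_prod_linear(1)[of "{..<n} - {j}" \<mu>] that by (simp add: lagrange_factor_def)
  thus "degree (\<Sum>j<n. smult (poly p (\<mu> j) / node_product n \<mu> j) (lagrange_factor n \<mu> j)) < n"
    using deg by (intro degree_sum_less) (auto intro: le_less_trans[OF degree_smult_le])
next
  fix k assume k: "k < n"
  have "poly (\<Sum>j<n. smult (poly p (\<mu> j) / node_product n \<mu> j) (lagrange_factor n \<mu> j)) (\<mu> k)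
      = (\<Sum>j<n. if j = k then poly p (\<mu> j) else 0)"
    unfolding poly_sum using k node_product_nonzero[OF inj]
    by (intro sum.cong refl) (auto simp: poly_lagrange_factor)
  thus "poly p (\<mu> k) = poly (\<Sum>j<n. smult (poly p (\<mu> j) / node_product n \<mu> j) (lagrange_factor n \<mu> j)) (\<mu> k)"
    using k by simp
qed

text \<open>
The leading term of Lagrange interpolation. This is what makes the vector with entries
\<open>C / (y j * node_product n \<mu> j)\<close> orthogonal to all polynomials of degree below \<open>n - 1\<close>.
\<close>

lemma sum_over_node_products:
  assumes inj: "inj_on \<mu> {..<n}" and deg: "degree p < n"
  shows "(\<Sum>j<n. poly p (\<mu> j) / node_product n \<mu> j) = coeff p (n - 1)"
proof -
  have "coeff (lagrange_factor n \<mu> j) (n - 1) = 1" if "j < n" for j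
    using monic_prod_linear[of "{..<n} - {j}" \<mu>] that by (simp add: lagrange_factor_def)
  hence "coeff (\<Sum>j<n. smult (poly p (\<mu> j) / node_product n \<mu> j) (lagrange_factor n \<mu> j)) (n - 1)
    = (\<Sum>j<n. poly p (\<mu> j) / node_product n \<mu> j)"
    by (simp add: coeff_sum)
  thus ?thesis using lagrange_interpolation[OF inj deg] by simp
qed

text \<open>
The inner product of \<open>L\<^sup>2\<close> for the discrete measure with weight \<open>w j\<close> at the node \<open>\<mu> j\<close>; for positive
weights it is definite on polynomials of degree below \<open>n\<close>.
\<close>

definition discrete_ip :: "nat \<Rightarrow> (nat \<Rightarrow> real) \<Rightarrow> (nat \<Rightarrow> real) \<Rightarrow> real poly \<Rightarrow> real poly \<Rightarrow> real" where
  "discrete_ip n \<mu> w p q = (\<Sum>j<n. w j * poly p (\<mu> j) * poly q (\<mu> j))"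

lemma discrete_ip_simps:
  "discrete_ip n \<mu> w (p + p') q = discrete_ip n \<mu> w p q + discrete_ip n \<mu> w p' q"
  "discrete_ip n \<mu> w (p - p') q = discrete_ip n \<mu> w p q - discrete_ip n \<mu> w p' q"
  "discrete_ip n \<mu> w (smult c p) q = c * discrete_ip n \<mu> w p q"
  "discrete_ip n \<mu> w (\<Sum>i\<in>I. f i) q = (\<Sum>i\<in>I. discrete_ip n \<mu> w (f i) q)"
proof -
  show "discrete_ip n \<mu> w (p + p') q = discrete_ip n \<mu> w p q + discrete_ip n \<mu> w p' q"
    by (simp add: discrete_ip_def sum.distrib algebra_simps)
  show "discrete_ip n \<mu> w (p - p') q = discrete_ip n \<mu> w p q - discrete_ip n \<mu> w p' q"
    by (simp add: discrete_ip_def sum_subtractf algebra_simps)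
  show "discrete_ip n \<mu> w (smult c p) q = c * discrete_ip n \<mu> w p q"
    by (simp add: discrete_ip_def sum_distrib_left algebra_simps)
  show "discrete_ip n \<mu> w (\<Sum>i\<in>I. f i) q = (\<Sum>i\<in>I. discrete_ip n \<mu> w (f i) q)"
    unfolding discrete_ip_def poly_sum sum_distrib_left sum_distrib_right by (rule sum.swap)
qed

lemma discrete_ip_smult_right: "discrete_ip n \<mu> w p (smult c q) = c * discrete_ip n \<mu> w p q"
  by (simp add: discrete_ip_def sum_distrib_left algebra_simps)

lemma discrete_ip_commute: "discrete_ip n \<mu> w p q = discrete_ip n \<mu> w q p"
  by (simp add: discrete_ip_def mult_ac)

lemma discrete_ip_pos:
  assumes inj: "inj_on \<mu> {..<n}" and w: "\<And>j. j < n \<Longrightarrow> 0 < w j" and "p \<noteq> 0" "degree p < n"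
  shows "0 < discrete_ip n \<mu> w p p"
proof -
  have "\<exists>j<n. poly p (\<mu> j) \<noteq> 0"
  proof (rule ccontr)
    assume "\<not> ?thesis"
    hence "p = 0" using assms(4) by (intro poly_eqI_on_inj_points[OF inj assms(4)]) auto
    thus False using assms by simp
  qed
  then obtain j where j: "j < n" "poly p (\<mu> j) \<noteq> 0" by blast
  have "0 < w j * (poly p (\<mu> j) * poly p (\<mu> j))" using j w not_real_square_gt_zero[of "poly p (\<mu> j)"] by (intro mult_pos_pos[OF w[OF j(1)]]) blast
  thus ?thesis unfolding discrete_ip_def mult.assoc
    using j by (intro sum_pos2[of _ j]) (auto intro!: mult_nonneg_nonneg[OF less_imp_le[OF w] zero_le_square])
qed

text \<open>
Gram-Schmidt on the powers of \<open>X\<close>. Orthogonality to the earlier orthogonal polynomials extends to all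
polynomials of smaller degree by removing leading terms one at a time.
\<close>

lemma ex_orthogonal_poly:
  assumes inj: "inj_on \<mu> {..<n}" and w: "\<And>j. j < n \<Longrightarrow> 0 < w j" and "k < n"
  shows "\<exists>p. degree p = k \<and> lead_coeff p = 1 \<and> (\<forall>q. degree q < k \<longrightarrow> discrete_ip n \<mu> w p q = 0)"
  using \<open>k < n\<close>
proof (induction k rule: less_induct)
  case (less k)
  hence "\<forall>i\<in>{..<k}. \<exists>p. degree p = i \<and> lead_coeff p = 1 \<and> (\<forall>q. degree q < i \<longrightarrow> discrete_ip n \<mu> w p q = 0)"
    by auto
  from bchoice[OF this] obtain P where "\<forall>i\<in>{..<k}. degree (P i) = i \<and> lead_coeff (P i) = 1 \<and>
      (\<forall>q. degree q < i \<longrightarrow> discrete_ip n \<mu> w (P i) q = 0)" by blast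
  hence P: "\<And>i. i < k \<Longrightarrow> degree (P i) = i" "\<And>i. i < k \<Longrightarrow> lead_coeff (P i) = 1"
      "\<And>i q. i < k \<Longrightarrow> degree q < i \<Longrightarrow> discrete_ip n \<mu> w (P i) q = 0"
    by blast+
  have orth: "discrete_ip n \<mu> w (P i) (P j) = 0" if "i < k" "j < k" "i \<noteq> j" for i j
    using P(3)[of i "P j"] P(3)[of j "P i"] P(1) that discrete_ip_commute[of n \<mu> w "P i"] by (metis nat_neq_iff)
  have pos: "discrete_ip n \<mu> w (P i) (P i) \<noteq> 0" if "i < k" for i
  proof -
    have "P i \<noteq> 0" "degree (P i) < n" using P(1,2)[OF that] that less.prems by auto
    with discrete_ip_pos[of \<mu> n w "P i", OF inj w] show ?thesis by simp
  qed
  define R where "R = (\<Sum>i<k. smult (discrete_ip n \<mu> w (monom 1 k) (P i) / discrete_ip n \<mu> w (P i) (P i)) (P i))"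
  define p where "p = monom 1 k - R"
  have coeffR: "coeff R m = 0" if "k \<le> m" for m
    unfolding R_def coeff_sum using P(1) that by (intro sum.neutral) (auto simp: coeff_eq_0)
  have deg: "degree p = k"
  proof (rule antisym)
    show "degree p \<le> k" by (rule degree_le) (auto simp: p_def coeffR)
    show "k \<le> degree p" by (rule le_degree) (auto simp: p_def coeffR)
  qed
  have lead: "lead_coeff p = 1" unfolding deg by (simp add: p_def coeffR)
  have orthP: "discrete_ip n \<mu> w p (P j) = 0" if "j < k" for j
  proof -
    have "discrete_ip n \<mu> w R (P j) = (\<Sum>i<k. if i = j then discrete_ip n \<mu> w (monom 1 k) (P j) else 0)"
      unfolding R_def discrete_ip_simps using orth pos that by (intro sum.cong refl) auto
    also have "\<dots> = discrete_ip n \<mu> w (monom 1 k) (P j)" using that by simp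
    finally show ?thesis by (simp add: p_def discrete_ip_simps)
  qed
  have "discrete_ip n \<mu> w p q = 0" if "degree q < k" for q
    using that
  proof (induction "degree q" arbitrary: q rule: less_induct)
    case (less q)
    define c where "c = lead_coeff q"
    define r where "r = q - smult c (P (degree q))"
    have q: "q = r + smult c (P (degree q))" by (simp add: r_def)
    have r: "degree r < degree q \<or> r = 0"
    proof (cases "degree q = 0")
      case True
      have "degree r = 0"
        unfolding r_def using True P(1)[of "degree q"] less.prems
        by (metis degree_diff_le degree_smult_le le_zero_eq)
      moreover have "coeff r 0 = 0" using P(1,2)[of "degree q"] less.prems True by (simp add: r_def c_def)
      ultimately show ?thesis by (metis leading_coeff_0_iff)
    next
      case False
      have "degree r \<le> degree q"
        unfolding r_def using P(1)[of "degree q"] less.prems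
        by (metis degree_diff_le degree_smult_le order_refl)
      moreover have "coeff r (degree q) = 0" using P(1,2)[of "degree q"] less.prems by (simp add: r_def c_def)
      ultimately show ?thesis by (metis leading_coeff_0_iff le_neq_implies_less)
    qed
    have "discrete_ip n \<mu> w p r = 0"
    proof (cases "r = 0")
      case True
      thus ?thesis by (simp add: discrete_ip_def)
    next
      case False
      thus ?thesis using r less by simp
    qed
    moreover have "discrete_ip n \<mu> w p (P (degree q)) = 0" using orthP less.prems by simp
    ultimately show ?case
      by (subst q, subst discrete_ip_commute) (simp add: discrete_ip_simps discrete_ip_commute[of n \<mu> w _ p])
  qed
  thus ?case using deg lead by blast
qed


section \<open>Cycle matrices with a prescribed spectrum\<close>

lemma transpose_congruence:
  fixes U M :: "'a :: comm_semiring_0 mat"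
  assumes "U \<in> carrier_mat n m" "M \<in> carrier_mat n n"
  shows "transpose_mat (transpose_mat U * M * U) = transpose_mat U * transpose_mat M * U"
proof -
  have "transpose_mat (transpose_mat U * M * U) = transpose_mat U * transpose_mat (transpose_mat U * M)"
    using assms by (intro transpose_mult[of _ m n _ m]) auto
  also have "transpose_mat (transpose_mat U * M) = transpose_mat M * U"
    using assms by (subst transpose_mult[of _ m n _ n]) auto
  finally show ?thesis using assms by (simp add: assoc_mult_mat[of _ m n _ n _ m])
qed

definition arrow_mat :: "nat \<Rightarrow> (nat \<Rightarrow> real) \<Rightarrow> (nat \<Rightarrow> real) \<Rightarrow> real \<Rightarrow> real mat" where
  "arrow_mat n \<mu> w \<alpha> = mat (Suc n) (Suc n) (\<lambda>(i, j).
     if i = n then (if j = n then \<alpha> else w j)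
     else if j = n then w i else if i = j then \<mu> i else 0)"

lemma arrow_mat_carrier [simp]: "arrow_mat n \<mu> w \<alpha> \<in> carrier_mat (Suc n) (Suc n)"
  by (simp add: arrow_mat_def)

text \<open>
The entries \<open>y j * q k (\<mu> j)\<close>, with \<open>q k\<close> the orthonormal polynomials for the weights \<open>(y j)\<^sup>2\<close>, form an
orthogonal matrix. In this basis multiplication by \<open>X\<close> is tridiagonal with nonzero off-diagonal
entries, because \<open>X q\<^sub>k\<close> has degree \<open>k + 1\<close>. The border \<open>y + z\<close> meets only the first and the last basis
vector: \<open>y\<close> represents the constant polynomial \<open>1\<close>, and \<open>z\<close> extracts the coefficient of degree
\<open>n - 1\<close>. Adding the border therefore closes the path to a cycle.
\<close>

lemma arrow_mat_orthogonally_similar_cycle: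
  fixes y z :: "nat \<Rightarrow> real"
  assumes n: "2 \<le> n" and inj: "inj_on \<mu> {..<n}"
    and yz: "\<And>j. j < n \<Longrightarrow> y j * z j = C / node_product n \<mu> j" and C: "C \<noteq> 0"
  shows "\<exists>A. cycle_pattern (Suc n) A \<and> similar_mat A (arrow_mat n \<mu> (\<lambda>j. y j + z j) \<alpha>)"
proof -
  let ?w = "\<lambda>j. (y j)\<^sup>2" and ?discrete_ip = "discrete_ip n \<mu> (\<lambda>j. (y j)\<^sup>2)"
  let ?X = "[:0, 1:] :: real poly"
  have y0: "y j \<noteq> 0" if "j < n" for j
    using yz[OF that] C node_product_nonzero[OF inj that] by auto
  have w: "0 < ?w j" if "j < n" for j using y0[OF that] by simp
  have "\<forall>k\<in>{..<n}. \<exists>p. degree p = k \<and> lead_coeff p = 1 \<and> (\<forall>q. degree q < k \<longrightarrow> ?discrete_ip p q = 0)"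
    using ex_orthogonal_poly[where w = ?w, OF inj w] by blast
  from bchoice[OF this] obtain P where "\<forall>k\<in>{..<n}. degree (P k) = k \<and> lead_coeff (P k) = 1 \<and>
      (\<forall>q. degree q < k \<longrightarrow> ?discrete_ip (P k) q = 0)" by blast
  hence degP: "\<And>k. k < n \<Longrightarrow> degree (P k) = k" and leadP: "\<And>k. k < n \<Longrightarrow> lead_coeff (P k) = 1"
    and orthP: "\<And>k q. k < n \<Longrightarrow> degree q < k \<Longrightarrow> ?discrete_ip (P k) q = 0" by blast+
  have posP: "0 < ?discrete_ip (P k) (P k)" if "k < n" for k
  proof -
    have "P k \<noteq> 0" "degree (P k) < n" using degP[OF that] leadP[OF that] that by auto
    thus ?thesis using discrete_ip_pos[of \<mu> n ?w "P k", OF inj w] by blast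
  qed
  define N where "N k = sqrt (?discrete_ip (P k) (P k))" for k
  have N: "N k > 0" "N k * N k = ?discrete_ip (P k) (P k)" if "k < n" for k
    using posP[OF that] by (auto simp: N_def)
  define q where "q k = smult (1 / N k) (P k)" for k
  have degq: "degree (q k) = k" if "k < n" for k using degP[OF that] N[OF that] by (simp add: q_def)
  have orthq: "?discrete_ip (q k) r = 0" if "k < n" "degree r < k" for k r
    using orthP[OF that] by (simp add: q_def discrete_ip_simps)
  have qq: "?discrete_ip (q k) (q k) = 1" if "k < n" for k
    using N(1)[OF that] unfolding q_def discrete_ip_simps discrete_ip_smult_right N(2)[OF that, symmetric] by simp
  have ortho: "?discrete_ip (q k) (q l) = (if k = l then 1 else 0)" if "k < n" "l < n" for k l
    using orthq[of k "q l"] orthq[of l "q k"] degq that qq discrete_ip_commute[of n \<mu> ?w "q k" "q l"]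
    by (cases k l rule: linorder_cases) auto
  have step: "?discrete_ip (pCons 0 (q k)) (q l) \<noteq> 0 \<longleftrightarrow> l = Suc k" if "k < l" "l < n" for k l
  proof (cases "l = Suc k")
    case False
    have "degree (pCons 0 (q k)) < l"
      using degq[of k] degree_pCons_le[of 0 "q k"] that False by simp
    hence "?discrete_ip (q l) (pCons 0 (q k)) = 0" using orthq that by blast
    thus ?thesis using False discrete_ip_commute[of n \<mu> ?w "q l"] by simp
  next
    case True
    define c where "c = N l / N k"
    have c: "c \<noteq> 0" using N(1)[of k] N(1)[of l] that by (simp add: c_def)
    define r where "r = pCons 0 (q k) - smult c (q l)"
    have dl: "degree (pCons 0 (q k)) \<le> l" "degree (smult c (q l)) \<le> l"
      using degq[of k] degq[of l] degree_pCons_le[of 0 "q k"] True that by auto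
    have "degree r \<le> l" unfolding r_def using dl by (rule degree_diff_le)
    moreover have "coeff r l = 0"
      using leadP[of k] leadP[of l] degP[of k] degP[of l] that True N(1)[of l]
      by (simp add: r_def q_def c_def)
    ultimately have "degree r < l"
      using True by (metis leading_coeff_0_iff le_neq_implies_less degree_0 zero_less_Suc)
    hence "?discrete_ip (q l) r = 0" using orthq that by blast
    hence "?discrete_ip r (q l) = 0" using discrete_ip_commute[of n \<mu> ?w "q l"] by simp
    hence "?discrete_ip (pCons 0 (q k)) (q l) = c"
      using qq[OF \<open>l < n\<close>] by (simp add: r_def discrete_ip_simps)
    thus ?thesis using c True by simp
  qed
  have border: "(\<Sum>j<n. (y j + z j) * (y j * poly (q k) (\<mu> j))) \<noteq> 0 \<longleftrightarrow> n = Suc k \<or> k = 0" if "k < n" for k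
  proof -
    have "(\<Sum>j<n. (y j + z j) * (y j * poly (q k) (\<mu> j)))
        = ?discrete_ip 1 (q k) + (\<Sum>j<n. (y j * z j) * poly (q k) (\<mu> j))"
      by (simp add: discrete_ip_def power2_eq_square sum.distrib algebra_simps)
    also have "(\<Sum>j<n. (y j * z j) * poly (q k) (\<mu> j)) = C * (\<Sum>j<n. poly (q k) (\<mu> j) / node_product n \<mu> j)"
      unfolding sum_distrib_left by (intro sum.cong refl) (simp add: yz)
    also have "\<dots> = C * coeff (q k) (n - 1)"
      using sum_over_node_products[OF inj, of "q k"] degq[OF that] that by simp
    finally have eq: "(\<Sum>j<n. (y j + z j) * (y j * poly (q k) (\<mu> j))) = ?discrete_ip 1 (q k) + C * coeff (q k) (n - 1)" .
    show ?thesis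
    proof (cases "k = 0")
      case True
      have "coeff (q k) (n - 1) = 0" using degq[OF that] True n by (intro coeff_eq_0) simp
      moreover have "?discrete_ip 1 (q k) \<noteq> 0"
      proof -
        have "P 0 = 1" using degP[of 0] leadP[of 0] n monic_degree_0[of "P 0"] by auto
        hence "?discrete_ip 1 (q k) = ?discrete_ip (P k) (P k) / N k" unfolding q_def discrete_ip_smult_right True by simp
        thus ?thesis using N(1)[OF that] posP[OF that] by simp
      qed
      ultimately show ?thesis using eq True by simp
    next
      case False
      hence "?discrete_ip (q k) 1 = 0" using orthq that by simp
      hence "?discrete_ip 1 (q k) = 0" using discrete_ip_commute[of n \<mu> ?w 1] by simp
      moreover have "coeff (q k) (n - 1) \<noteq> 0 \<longleftrightarrow> n = Suc k"
      proof (cases "n = Suc k")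
        case True
        thus ?thesis using degP[OF that] leadP[OF that] N(1)[OF that] by (simp add: q_def)
      next
        case neq: False
        thus ?thesis using degq[OF that] that by (simp add: coeff_eq_0)
      qed
      ultimately show ?thesis using eq C False by simp
    qed
  qed
  define U where "U = mat (Suc n) (Suc n) (\<lambda>(j, k).
    if j < n \<and> k < n then y j * poly (q k) (\<mu> j) else if j = k then 1 else 0)"
  have U: "U \<in> carrier_mat (Suc n) (Suc n)" by (simp add: U_def)
  have Ujk: "U $$ (j, k) = y j * poly (q k) (\<mu> j)" if "j < n" "k < n" for j k
    using that by (simp add: U_def)
  have Ujn: "U $$ (j, n) = (if j = n then 1 else 0)" "U $$ (n, j) = (if j = n then 1 else 0)" if "j < Suc n" for j
    using that by (auto simp: U_def)
  have UU: "transpose_mat U * U = 1\<^sub>m (Suc n)"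
  proof (rule eq_matI)
    fix k l assume "k < dim_row (1\<^sub>m (Suc n) :: real mat)" "l < dim_col (1\<^sub>m (Suc n) :: real mat)"
    hence kl: "k < Suc n" "l < Suc n" by auto
    have "(transpose_mat U * U) $$ (k, l) = (\<Sum>j<n. U $$ (j, k) * U $$ (j, l)) + U $$ (n, k) * U $$ (n, l)"
      using kl U by (simp add: scalar_prod_def atLeast0LessThan[symmetric])
    also have "\<dots> = 1\<^sub>m (Suc n) $$ (k, l)"
    proof (cases "k < n \<and> l < n")
      case True
      hence "(\<Sum>j<n. U $$ (j, k) * U $$ (j, l)) = ?discrete_ip (q k) (q l)"
        unfolding discrete_ip_def by (intro sum.cong refl) (simp add: Ujk power2_eq_square)
      thus ?thesis using ortho[of k l] True kl by (simp add: Ujn)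
    next
      case False
      hence "(\<Sum>j<n. U $$ (j, k) * U $$ (j, l)) = 0"
        using kl by (intro sum.neutral) (auto simp: U_def)
      thus ?thesis using False kl by (auto simp: Ujn)
    qed
    finally show "(transpose_mat U * U) $$ (k, l) = 1\<^sub>m (Suc n) $$ (k, l)" .
  qed (use U in auto)
  let ?M = "arrow_mat n \<mu> (\<lambda>j. y j + z j) \<alpha>"
  have Ut: "transpose_mat U \<in> carrier_mat (Suc n) (Suc n)" using U by simp
  have UU': "U * transpose_mat U = 1\<^sub>m (Suc n)"
    using mat_mult_left_right_inverse[OF Ut U UU] .
  define A where "A = transpose_mat U * ?M * U"
  have A: "A \<in> carrier_mat (Suc n) (Suc n)" unfolding A_def using mult_carrier_mat[OF mult_carrier_mat[OF Ut arrow_mat_carrier] U] .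
  have "transpose_mat ?M = ?M" by (rule eq_matI) (auto simp: arrow_mat_def)
  hence symA: "transpose_mat A = A"
    unfolding A_def transpose_congruence[OF U arrow_mat_carrier] by simp
  have MU: "(?M * U) $$ (i, k) = (if i < n then if k < n then \<mu> i * (y i * poly (q k) (\<mu> i)) else y i + z i
      else if k < n then (\<Sum>j<n. (y j + z j) * (y j * poly (q k) (\<mu> j))) else \<alpha>)"
    if "i < Suc n" "k < Suc n" for i k
  proof -
    have "(?M * U) $$ (i, k) = (\<Sum>j<n. ?M $$ (i, j) * U $$ (j, k)) + ?M $$ (i, n) * U $$ (n, k)"
      using that U by (simp add: scalar_prod_def arrow_mat_def atLeast0LessThan[symmetric])
    moreover have "(\<Sum>j<n. ?M $$ (i, j) * U $$ (j, k)) = (if k < n then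
       (if i < n then \<mu> i * (y i * poly (q k) (\<mu> i)) else (\<Sum>j<n. (y j + z j) * (y j * poly (q k) (\<mu> j)))) else 0)"
    proof (cases "k < n")
      case False
      thus ?thesis using that by (auto simp: U_def intro!: sum.neutral)
    next
      case k: True
      show ?thesis
      proof (cases "i < n")
        case True
        hence "(\<Sum>j<n. ?M $$ (i, j) * U $$ (j, k)) = (\<Sum>j<n. if i = j then \<mu> i * (y i * poly (q k) (\<mu> i)) else 0)"
          using k by (intro sum.cong refl) (auto simp: arrow_mat_def Ujk)
        thus ?thesis using True k by simp
      next
        case False
        thus ?thesis using k that by (auto simp: arrow_mat_def Ujk intro!: sum.cong)
      qed
    qed
    ultimately show ?thesis using that Ujn by (auto simp: arrow_mat_def)
  qed
  have Akl: "A $$ (k, l) = (if l < n then ?discrete_ip (pCons 0 (q k)) (q l)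
      else (\<Sum>j<n. (y j + z j) * (y j * poly (q k) (\<mu> j))))" if "k < n" "l < Suc n" for k l
  proof -
    have X: "?M * U \<in> carrier_mat (Suc n) (Suc n)" using mult_carrier_mat[OF arrow_mat_carrier U] .
    have "(transpose_mat U * X) $$ (k, l) = (\<Sum>i<n. U $$ (i, k) * X $$ (i, l)) + U $$ (n, k) * X $$ (n, l)"
      if "X \<in> carrier_mat (Suc n) (Suc n)" for X
      using that U \<open>k < n\<close> \<open>l < Suc n\<close> by (simp add: scalar_prod_def atLeast0LessThan[symmetric])
    from this[OF X] have "A $$ (k, l) = (\<Sum>i<n. U $$ (i, k) * (?M * U) $$ (i, l)) + U $$ (n, k) * (?M * U) $$ (n, l)"
      unfolding A_def assoc_mult_mat[OF Ut arrow_mat_carrier U] .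
    also have "\<dots> = (\<Sum>i<n. (y i * poly (q k) (\<mu> i)) * (?M * U) $$ (i, l))"
      using that by (simp add: Ujk Ujn)
    also have "\<dots> = (if l < n then ?discrete_ip (pCons 0 (q k)) (q l)
      else (\<Sum>j<n. (y j + z j) * (y j * poly (q k) (\<mu> j))))"
      using that unfolding discrete_ip_def
      by (auto simp: MU power2_eq_square intro!: sum.cong)
    finally show ?thesis .
  qed
  have "cycle_pattern (Suc n) A"
    unfolding cycle_pattern_def
  proof (intro conjI A symA allI impI)
    fix i j assume "i < Suc n" "j < Suc n" "i < j"
    thus "A $$ (i, j) \<noteq> 0 \<longleftrightarrow> j = Suc i \<or> i = 0 \<and> j = Suc n - 1"
      using step[of i j] border[of i] Akl[of i j] by (cases "j < n") (auto simp: less_Suc_eq)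
  qed
  moreover have "similar_mat A ?M"
    unfolding similar_mat_def A_def
    by (rule exI[of _ "transpose_mat U"], rule exI[of _ U], rule similar_mat_witI[OF UU UU' refl])
       (use U in auto)
  ultimately show ?thesis by blast
qed

text \<open>
Away from the nodes, the Schur complement of the diagonal block gives the secular function
\<open>x - \<alpha> - \<Sum>\<^sub>j w\<^sub>j\<^sup>2 / (x - \<mu>\<^sub>j)\<close> times the product of the \<open>x - \<mu>\<^sub>i\<close>; two polynomials that agree at all but
finitely many points are equal.
\<close>

lemma char_poly_arrow_mat:
  "char_poly (arrow_mat n \<mu> w \<alpha>) =
     [:- \<alpha>, 1:] * (\<Prod>i<n. [:- \<mu> i, 1:]) - (\<Sum>j<n. smult ((w j)\<^sup>2) (lagrange_factor n \<mu> j))"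
    (is "?L = ?R")
proof (rule ccontr)
  assume "?L \<noteq> ?R"
  hence fin: "finite {x. poly (?L - ?R) x = 0}" by (intro poly_roots_finite) simp
  have "poly (?L - ?R) x = 0" if x: "x \<notin> \<mu> ` {..<n}" for x
  proof -
    have nz: "x - \<mu> i \<noteq> 0" if "i < n" for i using x that by auto
    define D where "D = mat_diag n (\<lambda>i. x - \<mu> i)"
    define c where "c = mat n 1 (\<lambda>(i, j). - w i)"
    define r where "r = mat 1 n (\<lambda>(i, j). - w j)"
    define v where "v = mat n 1 (\<lambda>(i, j). w i / (x - \<mu> i))"
    define a where "a = mat 1 1 (\<lambda>_. x - \<alpha>)"
    have carr: "D \<in> carrier_mat n n" "c \<in> carrier_mat n 1" "r \<in> carrier_mat 1 n"
      "v \<in> carrier_mat n 1" "a \<in> carrier_mat 1 1"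
      by (auto simp: D_def c_def r_def v_def a_def)
    define E where "E = four_block_mat D c r a"
    \<comment> \<open>Multiplication by \<open>F\<close> adds multiples of the first \<open>n\<close> columns to the last one and clears it above the corner.\<close>
    define F where "F = four_block_mat (1\<^sub>m n) v (0\<^sub>m 1 n) (1\<^sub>m 1)"
    have E: "E \<in> carrier_mat (n + 1) (n + 1)" and F: "F \<in> carrier_mat (n + 1) (n + 1)"
      using carr by (auto simp: E_def F_def)
    have Dv: "D * v + c = 0\<^sub>m n 1"
      unfolding D_def mat_diag_mult_left[OF carr(4)]
      by (rule eq_matI) (use nz in \<open>auto simp: v_def c_def\<close>)
    have "E * F = four_block_mat D (D * v + c) r (r * v + a)"
      unfolding E_def F_def using carr
      by (subst mult_four_block_mat[of _ n n _ 1 _ 1 _ _ n _ 1]) auto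
    also have "det \<dots> = det D * det (r * v + a)"
      using carr Dv by (intro det_four_block_mat_upper_right_zero) auto
    also have "det D = (\<Prod>i<n. x - \<mu> i)"
      by (subst det_upper_triangular[of _ n])
         (auto simp: D_def mat_diag_def prod_list_diag_prod atLeast0LessThan)
    also have "det (r * v + a) = (x - \<alpha>) - (\<Sum>j<n. (w j)\<^sup>2 / (x - \<mu> j))"
    proof -
      have "r * v + a \<in> carrier_mat 1 1" using carr by auto
      hence "det (r * v + a) = (r * v + a) $$ (0, 0)" by (rule det_single)
      thus ?thesis
        using carr by (simp add: scalar_prod_def r_def v_def a_def atLeast0LessThan power2_eq_square sum_negf)
    qed
    finally have "det E * det F = (\<Prod>i<n. x - \<mu> i) * ((x - \<alpha>) - (\<Sum>j<n. (w j)\<^sup>2 / (x - \<mu> j)))"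
      using det_mult[OF E F] by simp
    moreover have "det F = 1"
      unfolding F_def using carr by (subst det_four_block_mat_lower_left_zero[of _ n _ 1]) auto
    moreover have "E = - char_matrix (arrow_mat n \<mu> w \<alpha>) x"
      by (rule eq_matI) (auto simp: E_def D_def c_def r_def a_def char_matrix_def arrow_mat_def mat_diag_def)
    ultimately have "poly ?L x = (\<Prod>i<n. x - \<mu> i) * ((x - \<alpha>) - (\<Sum>j<n. (w j)\<^sup>2 / (x - \<mu> j)))"
      by (simp add: char_poly_matrix[OF arrow_mat_carrier])
    also have "\<dots> = (x - \<alpha>) * (\<Prod>i<n. x - \<mu> i) - (\<Sum>j<n. (w j)\<^sup>2 * ((\<Prod>i<n. x - \<mu> i) / (x - \<mu> j)))"
      by (simp add: right_diff_distrib sum_distrib_left mult_ac)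
    also have "(\<Sum>j<n. (w j)\<^sup>2 * ((\<Prod>i<n. x - \<mu> i) / (x - \<mu> j))) = (\<Sum>j<n. (w j)\<^sup>2 * poly (lagrange_factor n \<mu> j) x)"
    proof (rule sum.cong[OF refl])
      fix j assume j: "j \<in> {..<n}"
      have "(\<Prod>i<n. x - \<mu> i) = (x - \<mu> j) * poly (lagrange_factor n \<mu> j) x"
        using j by (simp add: lagrange_factor_def poly_prod prod.remove[of "{..<n}" j])
      thus "(w j)\<^sup>2 * ((\<Prod>i<n. x - \<mu> i) / (x - \<mu> j)) = (w j)\<^sup>2 * poly (lagrange_factor n \<mu> j) x"
        using nz[of j] j by simp
    qed
    finally show ?thesis by (simp add: poly_prod poly_sum algebra_simps)
  qed
  hence "UNIV \<subseteq> \<mu> ` {..<n} \<union> {x. poly (?L - ?R) x = 0}" by blast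
  hence "finite (UNIV :: real set)" using fin by (meson finite_UnI finite_imageI finite_lessThan finite_subset)
  thus False using infinite_UNIV_char_0 by blast
qed

lemma prod_diff_sign:
  fixes a :: "nat \<Rightarrow> real"
  assumes "\<And>i. i \<in> J \<Longrightarrow> x < a i"
  shows "0 < (- 1) ^ card J * (\<Prod>i\<in>J. x - a i)"
proof -
  have "(\<Prod>i\<in>J. x - a i) = (\<Prod>i\<in>J. - (a i - x))" by simp
  also have "\<dots> = (- 1) ^ card J * (\<Prod>i\<in>J. a i - x)" by (rule prod_uminus)
  finally have "(- 1) ^ card J * (\<Prod>i\<in>J. x - a i) = (\<Prod>i\<in>J. a i - x)"
    by (simp add: mult.assoc[symmetric] power_add[symmetric])
  thus ?thesis using assms by (auto intro!: prod_pos)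
qed

text \<open>
The inverse eigenvalue problem for periodic Jacobi matrices. The midpoints \<open>\<mu>\<close> of consecutive eigenvalues
interlace with them and coincide with an eigenvalue exactly at the double ones, so \<open>r\<close> is positive
except there, where it is zero. It remains to split the border into \<open>y + z\<close> over the reals, which is
where the parity hypothesis enters.
\<close>

theorem ex_cycle_matrix_with_char_poly:
  fixes l :: "nat \<Rightarrow> real"
  assumes p: "3 \<le> p"
    and mono: "\<And>i j. i \<le> j \<Longrightarrow> j < p \<Longrightarrow> l i \<le> l j"
    and no_triple: "\<And>i. Suc (Suc i) < p \<Longrightarrow> l i < l (Suc (Suc i))"
    and parity: "\<And>i j. i < j \<Longrightarrow> Suc j < p \<Longrightarrow> l i = l (Suc i) \<Longrightarrow> l j = l (Suc j) \<Longrightarrow> even (j - i)"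
  shows "\<exists>A. cycle_pattern p A \<and> char_poly A = (\<Prod>i<p. [:- l i, 1:])"
proof -
  define n where "n = p - 1"
  have pn: "p = Suc n" and n: "2 \<le> n" using p by (auto simp: n_def)
  define \<mu> where "\<mu> j = (l j + l (Suc j)) / 2" for j
  define f where "f = (\<Prod>i<p. [:- l i, 1:])"
  define g where "g = (\<Prod>i<n. [:- \<mu> i, 1:])"
  have mu_less: "\<mu> i < \<mu> j" if "i < j" "j < n" for i j
  proof -
    define k where "k = j - 1"
    have k: "j = Suc k" using that by (simp add: k_def)
    have "l i \<le> l k" "l k < l (Suc j)" "l (Suc i) \<le> l j"
      using that k pn mono[of i k] no_triple[of k] mono[of "Suc i" j] by auto
    thus ?thesis by (simp add: \<mu>_def)
  qed
  have inj: "inj_on \<mu> {..<n}"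
    by (rule linorder_inj_onI) (use mu_less in \<open>fastforce+\<close>)
  have denom_sign: "0 < (- 1) ^ (n - Suc j) * node_product n \<mu> j" if "j < n" for j
  proof -
    have split: "{..<n} - {j} = {..<j} \<union> {Suc j..<n}" using that by auto
    have "node_product n \<mu> j = (\<Prod>i<j. \<mu> j - \<mu> i) * (\<Prod>i\<in>{Suc j..<n}. \<mu> j - \<mu> i)"
      unfolding node_product_def split by (rule prod.union_disjoint) auto
    moreover have "0 < (\<Prod>i<j. \<mu> j - \<mu> i)" using mu_less that by (intro prod_pos) auto
    moreover have "0 < (- 1) ^ card {Suc j..<n} * (\<Prod>i\<in>{Suc j..<n}. \<mu> j - \<mu> i)"
      using mu_less by (intro prod_diff_sign) auto
    ultimately show ?thesis by (metis card_atLeastLessThan mult.left_commute mult_pos_pos)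
  qed
  have f_sign: "0 < (- 1) ^ (n - j) * poly f (\<mu> j)" if "j < n" "l j < l (Suc j)" for j
  proof -
    have split: "{..<p} = {..j} \<union> {Suc j..<p}" using that pn by auto
    have "(\<Prod>i<p. \<mu> j - l i) = (\<Prod>i\<le>j. \<mu> j - l i) * (\<Prod>i\<in>{Suc j..<p}. \<mu> j - l i)"
      unfolding split by (rule prod.union_disjoint) auto
    hence "poly f (\<mu> j) = (\<Prod>i\<le>j. \<mu> j - l i) * (\<Prod>i\<in>{Suc j..<p}. \<mu> j - l i)"
      by (simp add: f_def poly_prod)
    moreover have "l i < \<mu> j" if "i \<le> j" for i
      using mono[of i j] that \<open>j < n\<close> \<open>l j < l (Suc j)\<close> pn by (simp add: \<mu>_def)
    hence "0 < (\<Prod>i\<le>j. \<mu> j - l i)" by (intro prod_pos) auto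
    moreover have "\<mu> j < l i" if "Suc j \<le> i" "i < p" for i
      using mono[of "Suc j" i] that \<open>l j < l (Suc j)\<close> by (simp add: \<mu>_def)
    hence "0 < (- 1) ^ card {Suc j..<p} * (\<Prod>i\<in>{Suc j..<p}. \<mu> j - l i)"
      by (intro prod_diff_sign) auto
    moreover have "card {Suc j..<p} = n - j" using pn by simp
    ultimately show ?thesis by (metis mult.left_commute mult_pos_pos)
  qed
  have f_double: "poly f (\<mu> j) = 0" if "j < n" "l j = l (Suc j)" for j
    using that pn by (auto simp: f_def poly_prod \<mu>_def intro!: bexI[of _ j])
  \<comment> \<open>The squares of the border entries, forced by the value of the characteristic polynomial at the nodes.\<close>
  define r where "r j = - poly f (\<mu> j) / node_product n \<mu> j" for j
  have r_pos: "0 < r j" if "j < n" "l j < l (Suc j)" for j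
  proof -
    have e: "n - j = Suc (n - Suc j)" using that by simp
    have "r j = ((- 1) ^ (n - j) * poly f (\<mu> j)) / ((- 1) ^ (n - Suc j) * node_product n \<mu> j)"
      unfolding e r_def by simp
    thus ?thesis using f_sign[OF that] denom_sign[OF that(1)] by simp
  qed
  have r_double: "r j = 0" if "j < n" "l j = l (Suc j)" for j using f_double[OF that] by (simp add: r_def)
  have l_cases: "l j < l (Suc j) \<or> l j = l (Suc j)" if "j < n" for j
    using mono[of j "Suc j"] that pn by fastforce
  have denom_nz: "node_product n \<mu> j \<noteq> 0" if "j < n" for j using node_product_nonzero[OF inj that] .
  \<comment> \<open>At a double eigenvalue \<open>r\<close> vanishes, so \<open>C\<close> must have the sign opposite to the node product; by parity all these node products have the same sign.\<close>
  obtain \<sigma> :: real where \<sigma>: "\<bar>\<sigma>\<bar> = 1" "\<And>j. j < n \<Longrightarrow> l j = l (Suc j) \<Longrightarrow> \<sigma> / node_product n \<mu> j < 0"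
  proof (cases "\<exists>k<n. l k = l (Suc k)")
    case False
    thus thesis by (intro that[of 1]) auto
  next
    case True
    then obtain k where k: "k < n" "l k = l (Suc k)" by blast
    have sgn: "0 < (- 1) ^ (n - Suc k) * node_product n \<mu> j" if "j < n" "l j = l (Suc j)" for j
    proof -
      have "even (n - Suc k) = even (n - Suc j)"
        using parity[of j k] parity[of k j] that k pn by (cases j k rule: linorder_cases) auto
      hence "(- 1 :: real) ^ (n - Suc k) = (- 1) ^ (n - Suc j)" by (simp add: minus_one_power_iff)
      thus ?thesis using denom_sign[OF that(1)] by simp
    qed
    show thesis
    proof (rule that[of "- ((- 1) ^ (n - Suc k))"])
      show "\<bar>- ((- 1) ^ (n - Suc k)) :: real\<bar> = 1" by (simp add: power_abs)
      fix j assume "j < n" "l j = l (Suc j)"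
      moreover have "0 < a / b" if "0 < a * b" for a b :: real
        using that by (simp add: zero_less_divide_iff zero_less_mult_iff)
      ultimately show "- ((- 1) ^ (n - Suc k)) / node_product n \<mu> j < 0"
        using sgn[of j] by (simp only: minus_divide_left[symmetric] neg_less_0_iff_less)
    qed
  qed
  \<comment> \<open>At the remaining nodes \<open>r\<close> is positive, and a small \<open>C\<close> of either sign keeps the discriminant nonnegative.\<close>
  define h where "h j = r j * \<bar>node_product n \<mu> j\<bar> / 4" for j
  define \<epsilon> where "\<epsilon> = Min (insert 1 (h ` {j. j < n \<and> l j < l (Suc j)}))"
  have eps: "0 < \<epsilon>" "\<And>j. j < n \<Longrightarrow> l j < l (Suc j) \<Longrightarrow> \<epsilon> \<le> h j"
  proof -
    show "0 < \<epsilon>" unfolding \<epsilon>_def using r_pos denom_nz by (subst Min_gr_iff) (auto simp: h_def)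
    show "\<epsilon> \<le> h j" if "j < n" "l j < l (Suc j)" for j unfolding \<epsilon>_def using that by (intro Min_le) auto
  qed
  define C where "C = \<sigma> * \<epsilon>"
  have C: "C \<noteq> 0" using \<sigma>(1) eps(1) by (auto simp: C_def)
  define d where "d j = r j - 4 * (C / node_product n \<mu> j)" for j
  have r_nonneg: "0 \<le> r j" if "j < n" for j
    using l_cases[OF that] r_pos[OF that] r_double[OF that] by auto
  have d_nonneg: "0 \<le> d j" if "j < n" for j
    using l_cases[OF that]
  proof
    assume "l j = l (Suc j)"
    hence "C / node_product n \<mu> j < 0" "r j = 0"
      using \<sigma>(2)[OF that] r_double[OF that] eps(1) by (auto simp: C_def mult_less_0_iff divide_less_0_iff)
    thus ?thesis by (simp add: d_def)
  next
    assume lt: "l j < l (Suc j)"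
    have "4 * (C / node_product n \<mu> j) \<le> \<bar>4 * (C / node_product n \<mu> j)\<bar>" by (rule abs_ge_self)
    also have "\<dots> = 4 * \<epsilon> / \<bar>node_product n \<mu> j\<bar>"
      using \<sigma>(1) eps(1) by (simp add: C_def abs_mult abs_divide)
    also have "\<dots> \<le> 4 * h j / \<bar>node_product n \<mu> j\<bar>"
      using eps(2)[OF that lt] by (intro divide_right_mono) auto
    also have "\<dots> = r j" using denom_nz[OF that] by (simp add: h_def)
    finally show ?thesis by (simp add: d_def)
  qed
  \<comment> \<open>The two roots of \<open>X\<^sup>2 - sqrt (r j) X + C / node_product n \<mu> j\<close>, whose discriminant is \<open>d j\<close>.\<close>
  define y where "y j = (sqrt (r j) + sqrt (d j)) / 2" for j
  define z where "z j = (sqrt (r j) - sqrt (d j)) / 2" for j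
  have yz: "y j * z j = C / node_product n \<mu> j" if "j < n" for j
  proof -
    have "y j * z j = ((sqrt (r j))\<^sup>2 - (sqrt (d j))\<^sup>2) / 4"
      by (simp add: y_def z_def power2_eq_square algebra_simps)
    also have "\<dots> = (r j - d j) / 4" using r_nonneg[OF that] d_nonneg[OF that] by simp
    finally show ?thesis by (simp add: d_def)
  qed
  \<comment> \<open>This corner entry cancels the coefficient of degree \<open>n\<close> in \<open>H\<close>, leaving a polynomial that is determined by its values at the nodes.\<close>
  define \<alpha> where "\<alpha> = coeff (pCons 0 g - f) n"
  have degg: "degree g = n" "lead_coeff g = 1" and degf: "degree f = Suc n" "lead_coeff f = 1"
    using monic_prod_linear[of "{..<n}" \<mu>] monic_prod_linear[of "{..<p}" l] by (auto simp: g_def f_def pn)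
  define H where "H = [:- \<alpha>, 1:] * g - f"
  have "coeff H m = 0" if m: "n \<le> m" for m
  proof -
    consider "m = n" | "m = Suc n" | "Suc n < m" using m by linarith
    thus ?thesis
    proof cases
      case 1
      thus ?thesis using degg by (simp add: H_def \<alpha>_def)
    next
      case 2
      thus ?thesis using degg degf by (simp add: H_def coeff_eq_0)
    next
      case 3
      hence "coeff g m = 0" "coeff f m = 0" "coeff (pCons 0 g) m = 0"
        using degg degf by (auto simp: coeff_eq_0 coeff_pCons split: nat.split)
      thus ?thesis by (simp add: H_def)
    qed
  qed
  hence degH: "degree H < n" using n by (intro le_less_trans[OF degree_le[of "n - 1"]]) auto
  have "poly H (\<mu> j) = - poly f (\<mu> j)" if "j < n" for j
    using that by (auto simp: H_def g_def poly_prod)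
  hence "H = (\<Sum>j<n. smult (r j) (lagrange_factor n \<mu> j))"
    using lagrange_interpolation[OF inj degH] by (simp add: r_def)
  also have "\<dots> = (\<Sum>j<n. smult ((y j + z j)\<^sup>2) (lagrange_factor n \<mu> j))"
  proof (rule sum.cong[OF refl])
    fix j assume "j \<in> {..<n}"
    moreover have "y j + z j = sqrt (r j)" by (simp add: y_def z_def field_simps)
    ultimately show "smult (r j) (lagrange_factor n \<mu> j) = smult ((y j + z j)\<^sup>2) (lagrange_factor n \<mu> j)"
      using r_nonneg[of j] by simp
  qed
  finally have "char_poly (arrow_mat n \<mu> (\<lambda>j. y j + z j) \<alpha>) = f"
    unfolding char_poly_arrow_mat by (simp add: H_def g_def)
  moreover obtain A where "cycle_pattern p A" "similar_mat A (arrow_mat n \<mu> (\<lambda>j. y j + z j) \<alpha>)"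
    using arrow_mat_orthogonally_similar_cycle[OF n inj yz C] unfolding pn by blast
  ultimately show ?thesis using char_poly_similar f_def by metis
qed


section \<open>Symplectic congruence\<close>

lemma symp_form_carrier [simp]: "symp_form p \<in> carrier_mat (2 * p) (2 * p)"
  unfolding symp_form_def mult_2 by (intro four_block_carrier_mat) auto

lemma symp_form_dim [simp]: "dim_row (symp_form p) = 2 * p" "dim_col (symp_form p) = 2 * p"
  using symp_form_carrier[of p] by (auto simp del: symp_form_carrier)

lemma symp_form_entry:
  assumes "i < 2 * p" "j < 2 * p"
  shows "symp_form p $$ (i, j) = (if j = i + p then 1 else if i = j + p then - 1 else 0)"
  using assms by (auto simp: symp_form_def)

lemma transpose_symp_form_mult: "transpose_mat (symp_form p) * symp_form p = 1\<^sub>m (2 * p)"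
proof -
  have "transpose_mat (symp_form p) = four_block_mat (0\<^sub>m p p) (- 1\<^sub>m p) (1\<^sub>m p) (0\<^sub>m p p)"
    unfolding symp_form_def by (subst transpose_four_block_mat[of _ p p _ p _ p]) (auto simp: transpose_uminus)
  also have "\<dots> * symp_form p = four_block_mat (1\<^sub>m p) (0\<^sub>m p p) (0\<^sub>m p p) (1\<^sub>m p)"
  proof -
    have "- 0\<^sub>m p p = (0\<^sub>m p p :: real mat)" by (rule eq_matI) auto
    thus ?thesis unfolding symp_form_def
      by (subst mult_four_block_mat[of _ p p _ p _ p _ _ p _ p]) auto
  qed
  also have "\<dots> = 1\<^sub>m (2 * p)" by (rule eq_matI) auto
  finally show ?thesis .
qed

text \<open>
The inverse of \<open>S\<close> is \<open>\<Omega>\<^sup>T S\<^sup>T \<Omega>\<close>. The last property is that \<open>S\<^sup>T\<close> is symplectic too, in the form needed to move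
\<open>\<Omega>\<close> past the inverse.
\<close>

lemma symplectic_inverse:
  assumes "symplectic p S"
  obtains T where "T \<in> carrier_mat (2 * p) (2 * p)" "S * T = 1\<^sub>m (2 * p)" "T * S = 1\<^sub>m (2 * p)"
    "T * symp_form p = symp_form p * transpose_mat S"
proof -
  let ?n = "2 * p" and ?J = "symp_form p"
  let ?Jt = "transpose_mat ?J"
  have S: "S \<in> carrier_mat ?n ?n" and SJS: "transpose_mat S * ?J * S = ?J"
    using assms by (auto simp: symplectic_def)
  have J: "?J \<in> carrier_mat ?n ?n" and Jt: "?Jt \<in> carrier_mat ?n ?n" by auto
  have St: "transpose_mat S \<in> carrier_mat ?n ?n" using S by simp
  have JtJ: "?Jt * ?J = 1\<^sub>m ?n" by (rule transpose_symp_form_mult)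
  have Jt_neg: "?J = (- 1) \<cdot>\<^sub>m ?Jt"
    by (rule eq_matI) (auto simp: symp_form_entry)
  define T where "T = ?Jt * transpose_mat S * ?J"
  have T: "T \<in> carrier_mat ?n ?n" unfolding T_def by (intro mult_carrier_mat[OF mult_carrier_mat[OF Jt St] J])
  have "T * S = ?Jt * (transpose_mat S * ?J * S)"
    unfolding T_def using J Jt S St by (simp add: assoc_mult_mat[of _ ?n ?n _ ?n _ ?n])
  hence TS: "T * S = 1\<^sub>m ?n" using SJS JtJ by simp
  have "T * ?J = ?J * transpose_mat S"
  proof -
    have JJ: "?J * ?J = (- 1) \<cdot>\<^sub>m 1\<^sub>m ?n"
    proof -
      have "?J * ?J = ((- 1) \<cdot>\<^sub>m ?Jt) * ?J" using Jt_neg by simp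
      also have "\<dots> = (- 1) \<cdot>\<^sub>m (?Jt * ?J)" using J Jt by (simp add: mult_smult_assoc_mat[of _ ?n ?n _ ?n])
      finally show ?thesis using JtJ by simp
    qed
    have "T * ?J = ?Jt * transpose_mat S * (?J * ?J)"
      unfolding T_def by (rule assoc_mult_mat[OF mult_carrier_mat[OF Jt St] J J])
    also have "\<dots> = (- 1) \<cdot>\<^sub>m (?Jt * transpose_mat S)"
      unfolding JJ mult_smult_distrib[OF mult_carrier_mat[OF Jt St] one_carrier_mat]
        right_mult_one_mat[OF mult_carrier_mat[OF Jt St]] ..
    also have "\<dots> = ((- 1) \<cdot>\<^sub>m ?Jt) * transpose_mat S"
      using Jt St by (simp add: mult_smult_assoc_mat[of _ ?n ?n _ ?n])
    finally show ?thesis using Jt_neg by simp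
  qed
  thus ?thesis using that[OF T mat_mult_left_right_inverse[OF T S TS] TS] by blast
qed

text \<open>
\<open>S\<^sup>-\<^sup>1 (\<Omega> N) S = \<Omega> S\<^sup>T N S\<close>: this carries the invariants of similarity, such as the characteristic polynomial,
over to symplectic congruence.
\<close>

lemma symplectic_congruence_similar:
  assumes S: "symplectic p S" and N: "N \<in> carrier_mat (2 * p) (2 * p)"
    and K: "transpose_mat S * N * S = K"
  shows "similar_mat (symp_form p * N) (symp_form p * K)"
proof -
  let ?n = "2 * p" and ?J = "symp_form p"
  have S': "S \<in> carrier_mat ?n ?n" "transpose_mat S \<in> carrier_mat ?n ?n" using S by (auto simp: symplectic_def)
  obtain T where T: "T \<in> carrier_mat ?n ?n" "S * T = 1\<^sub>m ?n" "T * S = 1\<^sub>m ?n"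
    and TJ: "T * ?J = ?J * transpose_mat S"
    by (rule symplectic_inverse[OF S])
  have J: "?J \<in> carrier_mat ?n ?n" by simp
  have "T * (?J * N) * S = (T * ?J) * N * S"
    using assoc_mult_mat[OF T(1) J N] by simp
  also have "\<dots> = ?J * (transpose_mat S * N * S)"
    unfolding TJ using J S' N by (simp add: assoc_mult_mat[of _ ?n ?n _ ?n _ ?n])
  finally have eq: "?J * K = T * (?J * N) * S" using K by simp
  have JN: "?J * N \<in> carrier_mat ?n ?n" using mult_carrier_mat[OF J N] .
  have "K \<in> carrier_mat ?n ?n"
    unfolding K[symmetric] using mult_carrier_mat[OF mult_carrier_mat[OF S'(2) N] S'(1)] .
  hence "similar_mat (?J * K) (?J * N)"
    unfolding similar_mat_def
    using similar_mat_witI[OF T(3,2) eq mult_carrier_mat[OF J] JN T(1) S'(1)] by blast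
  thus ?thesis by (rule similar_mat_sym)
qed

lemma char_poly_four_block_diag:
  fixes X :: "real mat"
  assumes "X \<in> carrier_mat p p" "Y \<in> carrier_mat p p"
  shows "char_poly (four_block_mat X (0\<^sub>m p p) (0\<^sub>m p p) Y) = char_poly X * char_poly Y"
proof -
  have "char_poly_matrix (four_block_mat X (0\<^sub>m p p) (0\<^sub>m p p) Y)
      = four_block_mat (char_poly_matrix X) (0\<^sub>m p p) (0\<^sub>m p p) (char_poly_matrix Y)"
    by (rule eq_matI) (use assms in \<open>auto simp: char_poly_matrix_def one_poly_def\<close>)
  moreover have "det (four_block_mat (char_poly_matrix X) (0\<^sub>m p p) (0\<^sub>m p p) (char_poly_matrix Y))
      = det (char_poly_matrix X) * det (char_poly_matrix Y)"
    using assms by (intro det_four_block_mat_lower_left_zero[of _ p _ p]) auto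
  ultimately show ?thesis unfolding char_poly_def by metis
qed

text \<open>
Squaring decouples the two halves and replaces symplectic eigenvalues by ordinary ones.
\<close>

lemma symp_form_mult_diag_block_squared:
  assumes "X \<in> carrier_mat p p" "Y \<in> carrier_mat p p"
  defines "K \<equiv> symp_form p * four_block_mat X (0\<^sub>m p p) (0\<^sub>m p p) Y"
  shows "K * K = four_block_mat (- (Y * X)) (0\<^sub>m p p) (0\<^sub>m p p) (- (X * Y))"
proof -
  have K: "K = four_block_mat (0\<^sub>m p p) Y (- X) (0\<^sub>m p p)"
    unfolding K_def symp_form_def using assms
    by (subst mult_four_block_mat[of _ p p _ p _ p _ _ p _ p]) auto
  show ?thesis
    unfolding K using assms
    by (subst mult_four_block_mat[of _ p p _ p _ p _ _ p _ p]) auto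
qed

lemma monic_square_eq:
  fixes f g :: "real poly"
  assumes "f * f = g * g" "lead_coeff f = 1" "lead_coeff g = 1"
  shows "f = g"
proof -
  have "(f - g) * (f + g) = 0" using assms(1) by (simp add: algebra_simps)
  moreover have "f + g \<noteq> 0"
  proof
    assume "f + g = 0"
    hence "f = - g" by (simp add: eq_neg_iff_add_eq_0)
    thus False using assms by simp
  qed
  ultimately show ?thesis by simp
qed

lemma diagonal_mat_eq_mat_diag:
  assumes "diagonal_mat D" "D \<in> carrier_mat p p"
  shows "D = mat_diag p (\<lambda>i. diag_mat D ! i)"
  by (rule eq_matI) (use assms in \<open>auto simp: diagonal_mat_def mat_diag_def diag_mat_def\<close>)

text \<open>
Both \<open>M \<oplus> I\<close> and \<open>D \<oplus> D\<close> are symplectically congruent to \<open>N\<close>, so the squares of their products with \<open>\<Omega>\<close>,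
namely \<open>- (M \<oplus> M)\<close> and \<open>- (D\<^sup>2 \<oplus> D\<^sup>2)\<close>, are similar. The characteristic polynomials of \<open>- M\<close> and \<open>- D\<^sup>2\<close> are
then monic with equal squares.
\<close>

lemma symplectic_spectrum_char_poly:
  assumes S: "symplectic p S" and N: "N \<in> carrier_mat (2 * p) (2 * p)" and M: "M \<in> carrier_mat p p"
    and SNS: "transpose_mat S * N * S = four_block_mat M (0\<^sub>m p p) (0\<^sub>m p p) (1\<^sub>m p)"
    and spec: "has_symplectic_spectrum p N \<Lambda>"
  shows "\<exists>ds. \<Lambda> = mset ds \<and> length ds = p \<and> (\<forall>d\<in>set ds. 0 < d) \<and> char_poly (- M) = (\<Prod>d\<leftarrow>ds. [:d\<^sup>2, 1:])"
proof -
  obtain S' D where S': "symplectic p S'" and D: "D \<in> carrier_mat p p" "diagonal_mat D" "\<forall>i<p. 0 < D $$ (i, i)"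
    and S'NS': "transpose_mat S' * N * S' = four_block_mat D (0\<^sub>m p p) (0\<^sub>m p p) D"
    and \<Lambda>: "\<Lambda> = mset (diag_mat D)"
    using spec unfolding has_symplectic_spectrum_def by blast
  let ?K = "symp_form p * four_block_mat M (0\<^sub>m p p) (0\<^sub>m p p) (1\<^sub>m p)"
  let ?K' = "symp_form p * four_block_mat D (0\<^sub>m p p) (0\<^sub>m p p) D"
  have "similar_mat ?K ?K'"
    using symplectic_congruence_similar[OF S N SNS] symplectic_congruence_similar[OF S' N S'NS']
    by (meson similar_mat_sym similar_mat_trans)
  then obtain P Q where wit: "similar_mat_wit ?K ?K' P Q" unfolding similar_mat_def by blast
  have carr: "?K \<in> carrier_mat (2 * p) (2 * p)" "?K' \<in> carrier_mat (2 * p) (2 * p)"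
    using mult_carrier_mat[OF symp_form_carrier] four_block_carrier_mat[OF M one_carrier_mat]
      four_block_carrier_mat[OF D(1) D(1)] by (auto simp: mult_2)
  have "similar_mat (?K ^\<^sub>m 2) (?K' ^\<^sub>m 2)"
    unfolding similar_mat_def using similar_mat_wit_pow[OF wit, of 2] by blast
  moreover have "?K ^\<^sub>m 2 = ?K * ?K" "?K' ^\<^sub>m 2 = ?K' * ?K'"
    using carr by (simp_all add: numeral_2_eq_2)
  ultimately have "char_poly (?K * ?K) = char_poly (?K' * ?K')"
    using char_poly_similar by metis
  moreover have "?K * ?K = four_block_mat (- M) (0\<^sub>m p p) (0\<^sub>m p p) (- M)"
    using symp_form_mult_diag_block_squared[OF M one_carrier_mat] M by simp
  moreover have "?K' * ?K' = four_block_mat (- (D * D)) (0\<^sub>m p p) (0\<^sub>m p p) (- (D * D))"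
    using symp_form_mult_diag_block_squared[OF D(1) D(1)] .
  moreover have DD: "- (D * D) \<in> carrier_mat p p" "- M \<in> carrier_mat p p" using D(1) M by auto
  ultimately have "char_poly (- M) * char_poly (- M) = char_poly (- (D * D)) * char_poly (- (D * D))"
    using char_poly_four_block_diag[OF DD(1,1)] char_poly_four_block_diag[OF DD(2,2)] by simp
  moreover have monic: "lead_coeff (char_poly X) = 1" if "X \<in> carrier_mat p p" for X :: "real mat"
    using degree_monic_char_poly[OF that] by auto
  ultimately have "char_poly (- M) = char_poly (- (D * D))"
    using monic_square_eq[OF _ monic[OF DD(2)] monic[OF DD(1)]] by blast
  also have "\<dots> = (\<Prod>d\<leftarrow>diag_mat D. [:d\<^sup>2, 1:])"
  proof -
    have eq: "- (D * D) = mat_diag p (\<lambda>i. - (diag_mat D ! i)\<^sup>2)"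
    proof -
      define f where "f i = diag_mat D ! i" for i
      have "D = mat_diag p f" using diagonal_mat_eq_mat_diag[OF D(2,1)] unfolding f_def .
      hence "D * D = mat_diag p (\<lambda>i. f i * f i)" by (metis mat_diag_diag)
      thus ?thesis unfolding f_def[symmetric]
        by (intro eq_matI) (simp_all add: mat_diag_def power2_eq_square)
    qed
    have "char_poly (- (D * D)) = (\<Prod>a\<leftarrow>diag_mat (- (D * D)). [:- a, 1:])"
      by (rule char_poly_upper_triangular[OF DD(1)]) (auto simp: eq mat_diag_def)
    also have "diag_mat (- (D * D)) = map (\<lambda>d. - d\<^sup>2) (diag_mat D)"
      by (rule nth_equalityI) (use D(1) in \<open>auto simp: eq mat_diag_def diag_mat_def\<close>)
    finally show ?thesis by (simp add: o_def)
  qed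
  finally have "char_poly (- M) = (\<Prod>d\<leftarrow>diag_mat D. [:d\<^sup>2, 1:])" .
  moreover have "length (diag_mat D) = p" "\<forall>d\<in>set (diag_mat D). 0 < d"
    using D by (auto simp: diag_mat_def)
  ultimately show ?thesis using \<Lambda> by blast
qed

text \<open>
The quadratic form of \<open>N\<close> at \<open>S y\<close> is the diagonal form \<open>D \<oplus> D\<close> at \<open>y\<close>, and \<open>S\<close> is invertible.
\<close>

lemma pos_def_if_has_symplectic_spectrum:
  assumes N: "N \<in> carrier_mat (2 * p) (2 * p)" "transpose_mat N = N"
    and spec: "has_symplectic_spectrum p N \<Lambda>"
  shows "pos_def (2 * p) N"
  unfolding pos_def_def
proof (intro conjI ballI impI N)
  fix x :: "real vec" assume x: "x \<in> carrier_vec (2 * p)" "x \<noteq> 0\<^sub>v (2 * p)"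
  obtain S D where S: "symplectic p S" and D: "D \<in> carrier_mat p p" "diagonal_mat D" "\<forall>i<p. 0 < D $$ (i, i)"
    and SNS: "transpose_mat S * N * S = four_block_mat D (0\<^sub>m p p) (0\<^sub>m p p) D"
    using spec unfolding has_symplectic_spectrum_def by blast
  let ?n = "2 * p"
  obtain T where T: "T \<in> carrier_mat ?n ?n" "S * T = 1\<^sub>m ?n"
    by (rule symplectic_inverse[OF S])
  have S': "S \<in> carrier_mat ?n ?n" "transpose_mat S \<in> carrier_mat ?n ?n" using S by (auto simp: symplectic_def)
  define y where "y = T *\<^sub>v x"
  have y: "y \<in> carrier_vec ?n" using T x by (simp add: y_def)
  have Sy: "S *\<^sub>v y = x" unfolding y_def using assoc_mult_mat_vec[OF S'(1) T(1) x(1)] T(2) x(1) by simp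
  have y0: "y \<noteq> 0\<^sub>v ?n" using Sy x S' by auto
  define K where "K = four_block_mat D (0\<^sub>m p p) (0\<^sub>m p p) D"
  have K: "K \<in> carrier_mat ?n ?n" using four_block_carrier_mat[OF D(1) D(1)] by (simp add: K_def mult_2)
  have Kij: "K $$ (i, j) = 0" if "i < ?n" "j < ?n" "i \<noteq> j" for i j
    using that D(1,2) unfolding K_def diagonal_mat_def by auto
  have Kpos: "0 < K $$ (i, i)" if "i < ?n" for i
    using that D(1,3) unfolding K_def by auto
  have "x \<bullet> (N *\<^sub>v x) = (S *\<^sub>v y) \<bullet> (N *\<^sub>v (S *\<^sub>v y))" using Sy by simp
  also have "\<dots> = y \<bullet> (transpose_mat S *\<^sub>v (N *\<^sub>v (S *\<^sub>v y)))"
  proof -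
    have z: "N *\<^sub>v (S *\<^sub>v y) \<in> carrier_vec ?n" using S' N y by simp
    have "(S *\<^sub>v y) \<bullet> (N *\<^sub>v (S *\<^sub>v y)) = (N *\<^sub>v (S *\<^sub>v y)) \<bullet> (S *\<^sub>v y)"
      using z S'(1) y by (intro comm_scalar_prod) auto
    also have "\<dots> = (transpose_mat S *\<^sub>v (N *\<^sub>v (S *\<^sub>v y))) \<bullet> y"
      by (rule transpose_vec_mult_scalar[OF S'(1) y z, symmetric])
    also have "\<dots> = y \<bullet> (transpose_mat S *\<^sub>v (N *\<^sub>v (S *\<^sub>v y)))"
      using z S'(2) y by (intro comm_scalar_prod) auto
    finally show ?thesis .
  qed
  also have "transpose_mat S *\<^sub>v (N *\<^sub>v (S *\<^sub>v y)) = K *\<^sub>v y"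
    unfolding K_def SNS[symmetric] using S' N y by (simp add: assoc_mult_mat_vec[of _ ?n ?n _ ?n])
  also have "y \<bullet> (K *\<^sub>v y) = (\<Sum>i<?n. K $$ (i, i) * (y $ i)\<^sup>2)"
  proof -
    have "(K *\<^sub>v y) $ i = K $$ (i, i) * y $ i" if "i < ?n" for i
    proof -
      have "(K *\<^sub>v y) $ i = (\<Sum>j<?n. K $$ (i, j) * y $ j)"
        using that K y by (simp add: scalar_prod_def atLeast0LessThan)
      also have "\<dots> = (\<Sum>j\<in>{i}. K $$ (i, j) * y $ j)"
        using that Kij[OF that] by (intro sum.mono_neutral_right) auto
      finally show ?thesis by simp
    qed
    thus ?thesis using K y by (simp add: scalar_prod_def atLeast0LessThan power2_eq_square mult_ac)
  qed
  also have "\<dots> > 0"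
  proof -
    have "\<exists>i<?n. y $ i \<noteq> 0"
    proof (rule ccontr)
      assume "\<not> ?thesis"
      hence "y = 0\<^sub>v ?n" using y by (intro eq_vecI) auto
      thus False using y0 by simp
    qed
    then obtain i where i: "i < ?n" "y $ i \<noteq> 0" by blast
    have "0 < K $$ (i, i) * (y $ i)\<^sup>2" using Kpos[OF i(1)] i(2) by simp
    thus ?thesis using i(1) Kpos by (intro sum_pos2[of _ i]) (simp_all add: less_imp_le)
  qed
  finally show "0 < x \<bullet> (N *\<^sub>v x)" .
qed


section \<open>Symplectic elimination of the leaves\<close>

lemma card_leaf_coupling: "card (leaf_coupling H) = card (pverts H)"
proof -
  have "inj_on (\<lambda>v. {Inl v, Inr v}) (pverts H)"
    by (intro inj_onI) (auto simp: doubleton_eq_iff)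
  thus ?thesis unfolding leaf_coupling_def by (rule card_image)
qed

lemma card_corona:
  assumes "finite (pverts H)"
  shows "card (pverts (corona H)) = 2 * card (pverts H)"
proof -
  have "Inl ` pverts H \<inter> Inr ` pverts H = {}" by auto
  thus ?thesis using assms by (simp add: corona_def card_Un_disjoint card_image)
qed

lemma corona_arcs [simp]:
  "(Inl u, Inl v) \<in> parcs (corona H) \<longleftrightarrow> (u, v) \<in> parcs H"
  "(Inl u, Inr v) \<in> parcs (corona H) \<longleftrightarrow> u = v \<and> v \<in> pverts H"
  "(Inr u, Inl v) \<in> parcs (corona H) \<longleftrightarrow> u = v \<and> v \<in> pverts H"
  "(Inr u, Inr v) \<notin> parcs (corona H)"
  by (auto simp: corona_def)

lemma corona_verts [simp]:
  "Inl v \<in> pverts (corona H) \<longleftrightarrow> v \<in> pverts H"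
  "Inr v \<in> pverts (corona H) \<longleftrightarrow> v \<in> pverts H"
  by (auto simp: corona_def)

text \<open>
Each column of \<open>S\<close> is supported at the two positions \<open>a j\<close> and \<open>b j\<close>, so an entry of the congruent matrix
involves only four entries of \<open>X\<close>.
\<close>

lemma congruence_two_point_columns:
  fixes S X :: "real mat"
  assumes X: "X \<in> carrier_mat n n" and S: "S \<in> carrier_mat n m"
    and ab: "\<And>j. j < m \<Longrightarrow> a j < n" "\<And>j. j < m \<Longrightarrow> b j < n" "\<And>j. j < m \<Longrightarrow> a j \<noteq> b j"
    and Sij: "\<And>i j. i < n \<Longrightarrow> j < m \<Longrightarrow> S $$ (i, j) = (if i = a j then s j else if i = b j then t j else 0)"
    and jk: "j < m" "k < m"
  shows "(transpose_mat S * X * S) $$ (j, k) =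
    s j * s k * X $$ (a j, a k) + s j * t k * X $$ (a j, b k)
    + t j * s k * X $$ (b j, a k) + t j * t k * X $$ (b j, b k)"
proof -
  have two: "(\<Sum>i<n. S $$ (i, l) * f i) = s l * f (a l) + t l * f (b l)" if "l < m" for l f
  proof -
    have "(\<Sum>i<n. S $$ (i, l) * f i) = (\<Sum>i\<in>{a l, b l}. S $$ (i, l) * f i)"
      using ab that by (intro sum.mono_neutral_right) (auto simp: Sij)
    also have "\<dots> = S $$ (a l, l) * f (a l) + S $$ (b l, l) * f (b l)"
      using ab(3)[OF that] by simp
    also have "S $$ (a l, l) = s l" using Sij ab that by simp
    also have "S $$ (b l, l) = t l" using Sij[of "b l" l] ab(2)[OF that] ab(3)[OF that] that by (metis (full_types))
    finally show ?thesis .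
  qed
  have XS: "X * S \<in> carrier_mat n m" using mult_carrier_mat[OF X S] .
  have XSe: "(X * S) $$ (i, k) = s k * X $$ (i, a k) + t k * X $$ (i, b k)" if "i < n" for i
  proof -
    have "(X * S) $$ (i, k) = (\<Sum>l<n. S $$ (l, k) * X $$ (i, l))"
      using that jk X S by (simp add: scalar_prod_def atLeast0LessThan mult.commute)
    thus ?thesis using two[OF jk(2)] by simp
  qed
  have tr: "(transpose_mat S * Y) $$ (j, k) = (\<Sum>i<n. S $$ (i, j) * Y $$ (i, k))"
    if "Y \<in> carrier_mat n m" for Y
    using that jk S by (simp add: scalar_prod_def atLeast0LessThan)
  have "transpose_mat S * X * S = transpose_mat S * (X * S)"
    using S X by (intro assoc_mult_mat[of _ m n _ n _ m]) auto
  hence "(transpose_mat S * X * S) $$ (j, k) = s j * (X * S) $$ (a j, k) + t j * (X * S) $$ (b j, k)"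
    using tr[OF XS] two[OF jk(1)] by simp
  also have "\<dots> = s j * (s k * X $$ (a j, a k) + t k * X $$ (a j, b k))
      + t j * (s k * X $$ (b j, a k) + t k * X $$ (b j, b k))"
    unfolding XSe[OF ab(1)[OF jk(1)]] XSe[OF ab(2)[OF jk(1)]] ..
  finally show ?thesis by (simp add: distrib_left mult.assoc)
qed

text \<open>
The labels of distinct leaves, and of a leaf and a vertex that is not its neighbor, meet at zero entries
of \<open>N\<close>. With \<open>E\<close> the diagonal entry of the leaf of \<open>v\<close> and \<open>B\<close> the entry joining it to \<open>v\<close>, the shear by
\<open>- B / E\<close> within each pair clears \<open>B\<close>, and the scaling by \<open>sqrt E\<close> and its inverse turns \<open>E\<close> into \<open>1\<close>. Both
act inside the pairs of the coupling and are symplectic; between different cycle vertices they only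
multiply entries by nonzero factors, so the pattern of \<open>H\<close> survives.
\<close>

lemma leaf_elimination:
  fixes H :: "nat pair_pre_digraph"
  assumes V: "pverts H = {0..<p}"
    and L: "representative_labeling (corona H) (leaf_coupling H) L"
    and N: "N \<in> S_plus (corona H) L"
  obtains S M where "symplectic p S" "M \<in> carrier_mat p p" "transpose_mat M = M"
    "\<And>u v. u < p \<Longrightarrow> v < p \<Longrightarrow> u \<noteq> v \<Longrightarrow> M $$ (u, v) \<noteq> 0 \<longleftrightarrow> (u, v) \<in> parcs H"
    "transpose_mat S * N * S = four_block_mat M (0\<^sub>m p p) (0\<^sub>m p p) (1\<^sub>m p)"
proof -
  let ?n = "2 * p"
  have cards: "card (leaf_coupling H) = p" "card (pverts (corona H)) = ?n"
    using card_leaf_coupling[of H] card_corona[of H] V by auto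
  have bij: "bij_betw L (pverts (corona H)) {0..<?n}"
    and pairs: "\<forall>P\<in>leaf_coupling H. \<exists>k<p. L ` P = {k, k + p}"
    using L unfolding representative_labeling_def cards by auto
  have Nc: "N \<in> carrier_mat ?n ?n" and Nsym: "transpose_mat N = N"
    and Npos: "\<And>x. x \<in> carrier_vec ?n \<Longrightarrow> x \<noteq> 0\<^sub>v ?n \<Longrightarrow> 0 < x \<bullet> (N *\<^sub>v x)"
    and pat: "has_pattern (corona H) L N"
    using N unfolding S_plus_def pos_def_def cards by auto
  define a where "a v = L (Inl v)" for v
  define b where "b v = L (Inr v)" for v
  have lt: "a v < ?n" "b v < ?n" if "v < p" for v
    using bij_betwE[OF bij] that V by (auto simp: a_def b_def)
  have inj: "L x = L y \<longleftrightarrow> x = y" if "x \<in> pverts (corona H)" "y \<in> pverts (corona H)" for x y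
    using bij_betw_imp_inj_on[OF bij] that by (auto dest: inj_onD)
  have ab: "a u \<noteq> b v" "a u = a v \<longleftrightarrow> u = v" "b u = b v \<longleftrightarrow> u = v" if "u < p" "v < p" for u v
    using that V by (auto simp: a_def b_def inj)
  have "\<forall>v\<in>{..<p}. \<exists>k<p. {a v, b v} = {k, k + p}"
    using pairs V by (auto simp: leaf_coupling_def a_def b_def)
  hence partner: "b v = a v + p \<and> a v < p \<or> a v = b v + p \<and> b v < p" if "v < p" for v
    using that by (fastforce simp: doubleton_eq_iff)
  have diff_pair: "a u \<noteq> a v + p" "a u \<noteq> b v + p" "b u \<noteq> a v + p" "b u \<noteq> b v + p"
    if "u < p" "v < p" "u \<noteq> v" for u v
  proof -
    have ne: "a u \<noteq> a v" "b u \<noteq> b v" "a u \<noteq> b v" "a v \<noteq> b u" using ab that by blast+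
    have *: "x \<noteq> z + p"
      if "y = x + p \<and> x < p \<or> x = y + p \<and> y < p" "y \<noteq> z" for x y z :: nat
      using that by auto
    show "a u \<noteq> a v + p" "a u \<noteq> b v + p"
      using partner[OF that(1)] ne by (intro *[of "b u"]; auto)+
    show "b u \<noteq> a v + p" "b u \<noteq> b v + p"
      using partner[OF that(1)] ne by (intro *[of "a u"]; auto)+
  qed
  have Nsym': "N $$ (i, j) = N $$ (j, i)" if "i < ?n" "j < ?n" for i j
    using arg_cong[OF Nsym, of "\<lambda>A. A $$ (i, j)"] that Nc by simp
  have Nab: "N $$ (a u, b v) = 0" "N $$ (b v, a u) = 0" "N $$ (b u, b v) = 0"
    and Naa: "N $$ (a u, a v) \<noteq> 0 \<longleftrightarrow> (u, v) \<in> parcs H"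
    if "u < p" "v < p" "u \<noteq> v" for u v
  proof -
    have *: "N $$ (L x, L y) \<noteq> 0 \<longleftrightarrow> (x, y) \<in> parcs (corona H)"
      if "x \<in> pverts (corona H)" "y \<in> pverts (corona H)" "x \<noteq> y" for x y
      using pat that unfolding has_pattern_def by blast
    show "N $$ (a u, b v) = 0" "N $$ (b v, a u) = 0" "N $$ (b u, b v) = 0"
        "N $$ (a u, a v) \<noteq> 0 \<longleftrightarrow> (u, v) \<in> parcs H"
      using *[of "Inl u" "Inr v"] *[of "Inr v" "Inl u"] *[of "Inr u" "Inr v"] *[of "Inl u" "Inl v"] that V
      by (auto simp: a_def b_def)
  qed
  define E where "E v = N $$ (b v, b v)" for v
  define B where "B v = N $$ (a v, b v)" for v
  have E: "0 < E v" if "v < p" for v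
  proof -
    have b: "b v < ?n" using lt that by simp
    have "0 < unit_vec ?n (b v) \<bullet> (N *\<^sub>v unit_vec ?n (b v))"
      using b by (intro Npos) (auto simp: unit_vec_nonzero)
    also have "unit_vec ?n (b v) \<bullet> (N *\<^sub>v unit_vec ?n (b v)) = E v"
      using b Nc by (subst scalar_prod_left_unit[of _ ?n]) (auto simp: E_def)
    finally show ?thesis .
  qed
  define vx where "vx j = (if j < p then j else j - p)" for j :: nat
  have vx: "vx j < p" if "j < ?n" for j using that by (auto simp: vx_def)
  \<comment> \<open>The sign records which vertex of the pair carries the smaller label.\<close>
  define \<sigma> where "\<sigma> v = (if b v = a v + p then 1 else - 1 :: real)" for v
  \<comment> \<open>Column \<open>v\<close> of \<open>S\<close> is the scaled and sheared unit vector of the cycle vertex \<open>v\<close>, and column \<open>p + v\<close> is the signed and scaled unit vector of its leaf.\<close>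
  define s where "s j = (if j < p then sqrt (E j) else 0)" for j
  define t where "t j = (if j < p then - B j / sqrt (E j) else \<sigma> (j - p) / sqrt (E (j - p)))" for j
  define S where "S = mat ?n ?n (\<lambda>(i, j). if i = a (vx j) then s j else if i = b (vx j) then t j else 0)"
  have S: "S \<in> carrier_mat ?n ?n" by (simp add: S_def)
  have cong: "(transpose_mat S * X * S) $$ (j, k) =
      s j * s k * X $$ (a (vx j), a (vx k)) + s j * t k * X $$ (a (vx j), b (vx k))
    + t j * s k * X $$ (b (vx j), a (vx k)) + t j * t k * X $$ (b (vx j), b (vx k))"
    if "X \<in> carrier_mat ?n ?n" "j < ?n" "k < ?n" for X j k
    by (rule congruence_two_point_columns[OF that(1) S _ _ _ _ that(2,3)])
       (use lt ab vx in \<open>auto simp: S_def\<close>)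
  have sq: "sqrt (E v) * sqrt (E v) = E v" "sqrt (E v) \<noteq> 0" "\<sigma> v * \<sigma> v = 1" if "v < p" for v
    using E[OF that] by (auto simp: \<sigma>_def)
  have st: "s v = sqrt (E v)" "s (v + p) = 0" "t v = - B v / sqrt (E v)" "t (v + p) = \<sigma> v / sqrt (E v)"
    "v + p \<noteq> v" if "v < p" for v
    using that by (auto simp: s_def t_def)
  let ?J = "symp_form p"
  have J: "?J $$ (a v, a v) = 0" "?J $$ (b v, b v) = 0" "?J $$ (a v, b v) = \<sigma> v" "?J $$ (b v, a v) = - \<sigma> v"
    if "v < p" for v
    using partner[OF that] lt[OF that] that by (auto simp: symp_form_entry \<sigma>_def)
  have J0: "?J $$ (a u, a v) = 0" "?J $$ (b u, b v) = 0" "?J $$ (a u, b v) = 0" "?J $$ (b u, a v) = 0"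
    if "u < p" "v < p" "u \<noteq> v" for u v
  proof -
    have z: "?J $$ (i, j) = 0" if "i < ?n" "j < ?n" "i \<noteq> j + p" "j \<noteq> i + p" for i j
      using that by (simp add: symp_form_entry)
    note uv = diff_pair[OF that] diff_pair[OF that(2,1) that(3)[symmetric]]
    show "?J $$ (a u, a v) = 0" "?J $$ (b u, b v) = 0" "?J $$ (a u, b v) = 0" "?J $$ (b u, a v) = 0"
      by (rule z[OF lt(1)[OF that(1)] lt(1)[OF that(2)] uv(1,5)]
               z[OF lt(2)[OF that(1)] lt(2)[OF that(2)] uv(4,8)]
               z[OF lt(1)[OF that(1)] lt(2)[OF that(2)] uv(2,7)]
               z[OF lt(2)[OF that(1)] lt(1)[OF that(2)] uv(3,6)])+
  qed
  have "transpose_mat S * ?J * S = ?J"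
  proof (rule eq_matI)
    fix j k assume "j < dim_row ?J" "k < dim_col ?J"
    hence jk: "j < ?n" "k < ?n" by auto
    note c = cong[OF symp_form_carrier jk]
    show "(transpose_mat S * ?J * S) $$ (j, k) = ?J $$ (j, k)"
    proof (cases "vx j = vx k")
      case False
      have "?J $$ (j, k) = 0"
        using False jk by (auto simp: symp_form_entry vx_def split: if_splits)
      thus ?thesis unfolding c using J0[OF vx[OF jk(1)] vx[OF jk(2)] False] by simp
    next
      case True
      define v where "v = vx k"
      have v: "v < p" "vx j = v" "vx k = v" using True vx jk by (auto simp: v_def)
      have jk': "j = v \<or> j = v + p" "k = v \<or> k = v + p" using v by (auto simp: vx_def split: if_splits)
      have "?J $$ (j, k) = (if j = v then if k = v then 0 else 1 else if k = v then - 1 else 0)"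
        using jk' v(1) jk by (auto simp: symp_form_entry)
      moreover have "s j * t k * \<sigma> v - t j * s k * \<sigma> v = (if j = v then if k = v then 0 else 1 else if k = v then - 1 else 0)"
        using jk' sq(2,3)[OF v(1)] st[OF v(1)] by (elim disjE) (simp_all only: st[OF v(1)], simp_all)
      ultimately show ?thesis unfolding c v using J[OF v(1)] by simp
    qed
  qed (use S in auto)
  hence sympl: "symplectic p S" using S by (simp add: symplectic_def)
  define M where "M = mat p p (\<lambda>(u, v). if u = v then E u * N $$ (a u, a u) - B u * B u
     else sqrt (E u) * sqrt (E v) * N $$ (a u, a v))"
  have "transpose_mat S * N * S = four_block_mat M (0\<^sub>m p p) (0\<^sub>m p p) (1\<^sub>m p)" (is "?L = ?R")
  proof (rule eq_matI)
    fix j k assume "j < dim_row ?R" "k < dim_col ?R"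
    hence jk: "j < ?n" "k < ?n" by (auto simp: M_def)
    note c = cong[OF Nc jk]
    show "?L $$ (j, k) = ?R $$ (j, k)"
    proof (cases "vx j = vx k")
      case False
      have "?L $$ (j, k) = s j * s k * N $$ (a (vx j), a (vx k))"
        unfolding c using Nab[OF vx[OF jk(1)] vx[OF jk(2)] False] Nab[OF vx[OF jk(2)] vx[OF jk(1)]] False by simp
      also have "\<dots> = ?R $$ (j, k)"
        using False jk by (auto simp: M_def s_def vx_def)
      finally show ?thesis .
    next
      case True
      define v where "v = vx k"
      have v: "v < p" "vx j = v" "vx k = v" using True vx jk by (auto simp: v_def)
      have jk': "j = v \<or> j = v + p" "k = v \<or> k = v + p" using v by (auto simp: vx_def split: if_splits)
      have R: "?R $$ (j, k) = (if j = v then if k = v then E v * N $$ (a v, a v) - B v * B v else 0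
          else if k = v then 0 else 1)"
        using jk' v(1) by (auto simp: M_def)
      have "?L $$ (j, k) = s j * s k * N $$ (a v, a v) + (s j * t k + t j * s k) * B v + t j * t k * E v"
        unfolding c v using Nsym'[OF lt(2,1)[OF v(1)]] by (simp add: B_def E_def distrib_right)
      also have "\<dots> = (if j = v then if k = v then E v * N $$ (a v, a v) - B v * B v else 0
          else if k = v then 0 else 1)"
      proof -
        define e where "e = sqrt (E v)"
        have e: "E v = e * e" "e \<noteq> 0" using sq[OF v(1)] by (auto simp: e_def)
        have ste: "s v = e" "s (v + p) = 0" "t v = - B v / e" "t (v + p) = \<sigma> v / e" "v + p \<noteq> v"
          using st[OF v(1)] by (simp_all add: e_def)
        have c1: "e * e * x + (e * (- B v / e) + - B v / e * e) * B v + - B v / e * (- B v / e) * (e * e)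
            = e * e * x - B v * B v" for x
          using e(2) by (simp add: field_simps)
        have c2: "e * (\<sigma> v / e) * B v + - B v / e * (\<sigma> v / e) * (e * e) = 0"
          "\<sigma> v / e * e * B v + \<sigma> v / e * (- B v / e) * (e * e) = 0"
          using e(2) by (simp_all add: field_simps)
        have c3: "\<sigma> v / e * (\<sigma> v / e) * (e * e) = 1" using e(2) sq(3)[OF v(1)] by (simp add: field_simps)
        show ?thesis
          using jk'
          by (elim disjE) (simp_all only: ste e(1) c1 c2 c3 if_True if_False mult_zero_left mult_zero_right
              add_0_left add_0_right refl simp_thms)
      qed
      finally show ?thesis using R by simp
    qed
  qed (use S in \<open>auto simp: M_def\<close>)
  moreover have "transpose_mat M = M"
    by (rule eq_matI) (use Nsym' lt in \<open>auto simp: M_def\<close>)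
  moreover have "M $$ (u, v) \<noteq> 0 \<longleftrightarrow> (u, v) \<in> parcs H" if "u < p" "v < p" "u \<noteq> v" for u v
    using that Naa[OF that] sq(2)[OF that(1)] sq(2)[OF that(2)] by (simp add: M_def)
  moreover have "M \<in> carrier_mat p p" by (simp add: M_def)
  ultimately show ?thesis using that[OF sympl] by blast
qed


section \<open>Zero forcing\<close>

lemma forcing_number_eqI:
  assumes V: "finite V" and B0: "B0 \<subseteq> V" "(forcing_step V R)\<^sup>*\<^sup>* B0 V" "card B0 = k"
    and lower: "\<And>B. B \<subseteq> V \<Longrightarrow> (forcing_step V R)\<^sup>*\<^sup>* B V \<Longrightarrow> k \<le> card B"
  shows "forcing_number V R = k"
  unfolding forcing_number_def
proof (rule Min_eqI)
  have "{card B |B. B \<subseteq> V \<and> (forcing_step V R)\<^sup>*\<^sup>* B V} \<subseteq> {..card V}"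
    using V by (auto intro: card_mono)
  thus "finite {card B |B. B \<subseteq> V \<and> (forcing_step V R)\<^sup>*\<^sup>* B V}" by (rule finite_subset) simp
qed (use B0 lower in auto)

lemma forcing_stepI:
  "R B w \<Longrightarrow> w \<in> V - B \<Longrightarrow> B' = insert w B \<Longrightarrow> forcing_step V R B B'"
  by (auto simp: forcing_step_def)

lemma forcing_step_invariant:
  assumes "(forcing_step V R)\<^sup>*\<^sup>* B B'" and "I B"
    and "\<And>B w. I B \<Longrightarrow> w \<in> V - B \<Longrightarrow> R B w \<Longrightarrow> I (insert w B)"
  shows "I B'"
  using assms(1,2)
proof (induction rule: rtranclp_induct)
  case (step B B')
  thus ?case using assms(3) by (auto simp: forcing_step_def)
qed

text \<open>
Blue sets never leave \<open>V\<close>, so the rules need to agree only there.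
\<close>

lemma forcing_number_cong:
  assumes "\<And>B w. B \<subseteq> V \<Longrightarrow> w \<in> V \<Longrightarrow> R B w \<longleftrightarrow> R' B w"
  shows "forcing_number V R = forcing_number V R'"
proof -
  have sub: "C \<subseteq> V" if "(forcing_step V P)\<^sup>*\<^sup>* B C" "B \<subseteq> V" for P B C
    using forcing_step_invariant[OF that(1), where I = "\<lambda>B. B \<subseteq> V"] that(2) by blast
  have "(forcing_step V Q)\<^sup>*\<^sup>* B C"
    if "(forcing_step V P)\<^sup>*\<^sup>* B C" "B \<subseteq> V" and PQ: "\<And>B w. B \<subseteq> V \<Longrightarrow> w \<in> V \<Longrightarrow> P B w \<Longrightarrow> Q B w" for P Q B C
    using that(1,2)
  proof (induction rule: rtranclp_induct)
    case (step C C')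
    have "forcing_step V Q C C'"
      using step(2) PQ[OF sub[OF step(1) step(4)]] by (auto simp: forcing_step_def)
    thus ?case using step by (meson rtranclp.rtrancl_into_rtrancl)
  qed simp
  hence "(forcing_step V R)\<^sup>*\<^sup>* B V \<longleftrightarrow> (forcing_step V R')\<^sup>*\<^sup>* B V" if "B \<subseteq> V" for B
    using that assms by blast
  hence "{card B |B. B \<subseteq> V \<and> (forcing_step V R)\<^sup>*\<^sup>* B V} = {card B |B. B \<subseteq> V \<and> (forcing_step V R')\<^sup>*\<^sup>* B V}"
    by blast
  thus ?thesis unfolding forcing_number_def by (rule arg_cong)
qed

lemma card_less_2_cases:
  assumes "\<not> 2 \<le> card B" "finite B"
  obtains "B = {}" | x where "B = {x}"
proof -
  have "card B = 0 \<or> card B = 1" using assms(1) by linarith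
  thus ?thesis
  proof
    assume "card B = 0"
    thus ?thesis using assms(2) that(1) by simp
  next
    assume "card B = 1"
    thus ?thesis using that(2) by (rule card_1_singletonE)
  qed
qed

lemma cycle_graph_verts [simp]: "pverts (cycle_graph p) = {0..<p}"
  by (simp add: cycle_graph_def)

lemma nbhd_cycle_graph:
  assumes "3 \<le> p" "v < p"
  shows "nbhd (cycle_graph p) v = {if Suc v = p then 0 else Suc v, if v = 0 then p - 1 else v - 1}"
proof -
  have "(v, w) \<in> parcs (cycle_graph p) \<longleftrightarrow>
      w = (if Suc v = p then 0 else Suc v) \<or> w = (if v = 0 then p - 1 else v - 1)" for w
  proof (cases "w < p")
    case True
    have "(v, w) \<in> parcs (cycle_graph p) \<longleftrightarrow> w = Suc v mod p \<or> v = Suc w mod p"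
      using assms True by (simp add: cycle_graph_def)
    also have "Suc v mod p = (if Suc v = p then 0 else Suc v)" using assms by simp
    also have "Suc w mod p = (if Suc w = p then 0 else Suc w)" using True by simp
    also have "v = (if Suc w = p then 0 else Suc w) \<longleftrightarrow> w = (if v = 0 then p - 1 else v - 1)"
      using assms True by auto
    finally show ?thesis .
  next
    case False
    thus ?thesis using assms by (auto simp: cycle_graph_def)
  qed
  thus ?thesis by (auto simp: nbhd_def)
qed

lemma nbhd_cycle_graph_inner:
  assumes "3 \<le> p" "Suc (Suc k) < p"
  shows "nbhd (cycle_graph p) (Suc k) = {Suc (Suc k), k}"
  using nbhd_cycle_graph[of p "Suc k"] assms by simp

lemma nbhd_cycle_graph_two:
  assumes "3 \<le> p" "v < p"
  obtains u w where "u \<noteq> w" "u \<noteq> v" "w \<noteq> v" "nbhd (cycle_graph p) v = {u, w}"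
proof -
  let ?u = "if Suc v = p then 0 else Suc v" and ?w = "if v = 0 then p - 1 else v - 1"
  have "?u \<noteq> ?w" "?u \<noteq> v" "?w \<noteq> v" using assms by auto
  thus ?thesis using that nbhd_cycle_graph[OF assms] by blast
qed

text \<open>
A single blue vertex has two white neighbors, so no set with fewer than two vertices forces; two adjacent
blue vertices force their way around the cycle.
\<close>

lemma Z_number_cycle_graph:
  assumes p: "3 \<le> p"
  shows "Z_number (cycle_graph p) = 2"
  unfolding Z_number_def
proof (rule forcing_number_eqI)
  let ?R = "\<lambda>B w. \<exists>v\<in>B. nbhd (cycle_graph p) v - B = {w}"
  let ?V = "pverts (cycle_graph p)"
  show "{0, 1} \<subseteq> ?V" using p by auto
  have steps: "(forcing_step ?V ?R)\<^sup>*\<^sup>* {0, 1} {0..<Suc (Suc k)}" if "Suc (Suc k) \<le> p" for k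
    using that
  proof (induction k)
    case 0
    have "{0, 1} = {0..<Suc (Suc 0)}" by auto
    thus ?case by simp
  next
    case (Suc k)
    have "nbhd (cycle_graph p) (Suc k) - {0..<Suc (Suc k)} = {Suc (Suc k)}"
      unfolding nbhd_cycle_graph_inner[OF p Suc_le_lessD[OF Suc.prems]] by auto
    moreover have "Suc k \<in> {0..<Suc (Suc k)}" by simp
    ultimately have "?R {0..<Suc (Suc k)} (Suc (Suc k))" by (rule bexI)
    moreover have "Suc (Suc k) \<in> ?V - {0..<Suc (Suc k)}" using Suc.prems by simp
    ultimately have "forcing_step ?V ?R {0..<Suc (Suc k)} (insert (Suc (Suc k)) {0..<Suc (Suc k)})"
      by (intro forcing_stepI[OF _ _ refl])
    moreover have "insert (Suc (Suc k)) {0..<Suc (Suc k)} = {0..<Suc (Suc (Suc k))}" by auto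
    ultimately show ?case using Suc.IH Suc.prems rtranclp.rtrancl_into_rtrancl[of _ "{0, 1}"] by simp
  qed
  have e: "Suc (Suc (p - 2)) = p" using p by simp
  show "(forcing_step ?V ?R)\<^sup>*\<^sup>* {0, 1} ?V"
    using steps[of "p - 2"] unfolding e cycle_graph_verts by simp
  show "card {0, 1 :: nat} = 2" by simp
  fix B assume B: "B \<subseteq> ?V" and force: "(forcing_step ?V ?R)\<^sup>*\<^sup>* B ?V"
  show "2 \<le> card B"
  proof (rule ccontr)
    assume "\<not> ?thesis"
    moreover have "finite B" using B finite_subset by auto
    ultimately consider "B = {}" | x where "B = {x}" by (rule card_less_2_cases)
    hence "\<exists>v<p. B \<subseteq> {v}"
    proof cases
      case 1
      thus ?thesis using p by (intro exI[of _ 0]) auto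
    next
      case 2
      thus ?thesis using B by (intro exI[of _ x]) auto
    qed
    then obtain v where v: "v < p" "B \<subseteq> {v}" by blast
    obtain x y where xy: "x \<noteq> y" "x \<noteq> v" "y \<noteq> v" "nbhd (cycle_graph p) v = {x, y}"
      by (rule nbhd_cycle_graph_two[OF p v(1)])
    have "?V \<subseteq> {v}"
    proof (rule forcing_step_invariant[OF force, where I = "\<lambda>B. B \<subseteq> {v}"])
      fix B w assume B: "B \<subseteq> {v}" and "?R B w"
      then obtain u where u: "u \<in> B" "nbhd (cycle_graph p) u - B = {w}" by blast
      have "u = v" using u(1) B by blast
      hence "x \<in> nbhd (cycle_graph p) u - B" "y \<in> nbhd (cycle_graph p) u - B" using xy B by auto
      hence False using u(2) xy(1) by auto
      thus "insert w B \<subseteq> {v}" ..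
    qed (rule v)
    moreover have "0 \<in> ?V" "1 \<in> ?V" using p by auto
    ultimately have "0 = v" "1 = v" by blast+
    thus False by simp
  qed
qed auto

lemma nbhd_corona [simp]:
  assumes "v \<in> pverts H"
  shows "nbhd (corona H) (Inl v) = insert (Inr v) (Inl ` nbhd H v)" "nbhd (corona H) (Inr v) = {Inl v}"
  using assms by (auto simp: nbhd_def corona_def)

text \<open>
The partner of a vertex is one of its neighbors, so the two color change rules are the same.
\<close>

lemma Z_C_number_corona: "Z_C_number (corona H) (leaf_coupling H) = Z_ell_number (corona H)"
  unfolding Z_C_number_def Z_ell_number_def
proof (rule forcing_number_cong)
  have *: "nbhd (corona H) v \<union> {partner (leaf_coupling H) v} = nbhd (corona H) v"
    if "v \<in> pverts (corona H)" for v
    using that by (cases v) (auto simp: partner_leaf_coupling)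
  have nonempty: "nbhd (corona H) v \<noteq> {}" if "v \<in> pverts (corona H)" for v
    using that by (cases v) auto
  fix B w assume B: "B \<subseteq> pverts (corona H)" and w: "w \<in> pverts (corona H)"
  have "(\<exists>v\<in>B. nbhd (corona H) v \<union> {partner (leaf_coupling H) v} - B = {w}) \<longleftrightarrow>
      (\<exists>v\<in>B. nbhd (corona H) v - B = {w})"
  proof (intro bex_cong refl)
    fix v assume "v \<in> B"
    hence "v \<in> pverts (corona H)" using B by blast
    from *[OF this] show "nbhd (corona H) v \<union> {partner (leaf_coupling H) v} - B = {w} \<longleftrightarrow>
      nbhd (corona H) v - B = {w}" by simp
  qed
  thus "((\<exists>v\<in>B. nbhd (corona H) v \<union> {partner (leaf_coupling H) v} - B = {w}) \<or>
       nbhd (corona H) w \<union> {partner (leaf_coupling H) w} \<subseteq> B) \<longleftrightarrow>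
     ((\<exists>u\<in>B. nbhd (corona H) u - B = {w}) \<or> nbhd (corona H) w \<noteq> {} \<and> nbhd (corona H) w \<subseteq> B)"
    using *[OF w] nonempty[OF w] by simp
qed

text \<open>
The sets contained in a single coupled pair are closed under the rule, because a cycle vertex has two
neighbors on the cycle. From two adjacent cycle vertices, leaves and new cycle vertices turn blue
alternately.
\<close>

lemma Z_ell_number_corona_cycle:
  assumes p: "3 \<le> p"
  shows "Z_ell_number (corona (cycle_graph p)) = 2"
  unfolding Z_ell_number_def
proof (rule forcing_number_eqI)
  let ?H = "cycle_graph p"
  let ?G = "corona ?H"
  let ?R = "\<lambda>B w. (\<exists>u\<in>B. nbhd ?G u - B = {w}) \<or> nbhd ?G w \<noteq> {} \<and> nbhd ?G w \<subseteq> B"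
  let ?F = "forcing_step (pverts ?G) ?R"
  define X :: "nat \<Rightarrow> nat \<Rightarrow> (nat + nat) set" where "X k j = Inl ` {0..<k} \<union> Inr ` {0..<j}" for k j
  show "{Inl 0, Inl 1} \<subseteq> pverts ?G" using p by auto
  have leaf: "?F (X k j) (X k (Suc j))" if "j < k" "k \<le> p" for k j
  proof -
    have "nbhd ?G (Inr j) = {Inl j}" using that by (intro nbhd_corona(2)) simp
    moreover have "Inl j \<in> X k j" using that by (simp add: X_def)
    ultimately have "nbhd ?G (Inr j) \<noteq> {}" "nbhd ?G (Inr j) \<subseteq> X k j" by simp_all
    hence "?R (X k j) (Inr j)" by blast
    moreover have "Inr j \<in> pverts ?G - X k j" "X k (Suc j) = insert (Inr j) (X k j)"
      using that by (auto simp: X_def)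
    ultimately show ?thesis by (rule forcing_stepI)
  qed
  have vertex: "?F (X (Suc (Suc k)) (Suc (Suc k))) (X (Suc (Suc (Suc k))) (Suc (Suc k)))" if "Suc (Suc k) < p" for k
  proof -
    let ?B = "X (Suc (Suc k)) (Suc (Suc k))"
    have "nbhd ?G (Inl (Suc k)) = {Inr (Suc k), Inl (Suc (Suc k)), Inl k}"
      using that nbhd_cycle_graph_inner[OF p that] by simp
    moreover have "Inl (Suc k) \<in> ?B" "Inr (Suc k) \<in> ?B" "Inl k \<in> ?B" "Inl (Suc (Suc k)) \<notin> ?B"
      by (simp_all add: X_def image_iff)
    ultimately have "Inl (Suc k) \<in> ?B" "nbhd ?G (Inl (Suc k)) - ?B = {Inl (Suc (Suc k))}" by auto
    hence "?R ?B (Inl (Suc (Suc k)))" by blast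
    moreover have "Inl (Suc (Suc k)) \<in> pverts ?G - ?B" using that by (simp add: X_def image_iff)
    moreover have "X (Suc (Suc (Suc k))) (Suc (Suc k)) = insert (Inl (Suc (Suc k))) ?B"
      using that by (auto simp: X_def)
    ultimately show ?thesis by (rule forcing_stepI)
  qed
  have steps: "?F\<^sup>*\<^sup>* (X 2 0) (X (Suc (Suc k)) (Suc (Suc k)))" if "Suc (Suc k) \<le> p" for k
    using that
  proof (induction k)
    case 0
    have "?F (X 2 0) (X 2 (Suc 0))" by (rule leaf) (use p in auto)
    moreover have "?F (X 2 (Suc 0)) (X 2 (Suc (Suc 0)))" by (rule leaf) (use p in auto)
    ultimately have "?F\<^sup>*\<^sup>* (X 2 0) (X 2 (Suc (Suc 0)))"
      by (rule rtranclp.rtrancl_into_rtrancl[OF r_into_rtranclp])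
    thus ?case unfolding numeral_2_eq_2 .
  next
    case (Suc k)
    let ?k = "Suc (Suc k)"
    have "?F\<^sup>*\<^sup>* (X 2 0) (X ?k ?k)" by (rule Suc.IH) (use Suc.prems in simp)
    moreover have "?F (X ?k ?k) (X (Suc ?k) ?k)" by (rule vertex) (use Suc.prems in simp)
    ultimately have "?F\<^sup>*\<^sup>* (X 2 0) (X (Suc ?k) ?k)" by (rule rtranclp.rtrancl_into_rtrancl)
    moreover have "?F (X (Suc ?k) ?k) (X (Suc ?k) (Suc ?k))" by (rule leaf) (use Suc.prems in simp_all)
    ultimately show ?case by (rule rtranclp.rtrancl_into_rtrancl)
  qed
  have e: "Suc (Suc (p - 2)) = p" using p by simp
  have "?F\<^sup>*\<^sup>* (X 2 0) (X p p)" using steps[of "p - 2"] unfolding e by simp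
  moreover have "X 2 0 = {Inl 0, Inl 1}"
  proof -
    have "{0..<2} = {0, 1 :: nat}" by auto
    thus ?thesis by (simp add: X_def)
  qed
  moreover have "X p p = pverts ?G" by (simp add: X_def corona_def)
  ultimately show "?F\<^sup>*\<^sup>* {Inl 0, Inl 1} (pverts ?G)" by simp
  show "card {Inl 0, Inl 1 :: nat + nat} = 2" by simp
  show fin: "finite (pverts ?G)" by (simp add: corona_def)
  fix B assume B: "B \<subseteq> pverts ?G" and force: "?F\<^sup>*\<^sup>* B (pverts ?G)"
  show "2 \<le> card B"
  proof (rule ccontr)
    assume "\<not> ?thesis"
    moreover have "finite B" using B fin finite_subset by auto
    ultimately consider "B = {}" | x where "B = {x}" by (rule card_less_2_cases)
    hence "\<exists>v<p. B \<subseteq> {Inl v, Inr v}"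
    proof cases
      case 1
      thus ?thesis using p by (intro exI[of _ 0]) auto
    next
      case 2
      show ?thesis
        using B unfolding 2 by (cases x) auto
    qed
    then obtain v where v: "v < p" "B \<subseteq> {Inl v, Inr v}" by blast
    obtain u w where uw: "u \<noteq> w" "u \<noteq> v" "w \<noteq> v" "nbhd ?H v = {u, w}"
      by (rule nbhd_cycle_graph_two[OF p v(1)])
    have "pverts ?G \<subseteq> {Inl v, Inr v}"
    proof (rule forcing_step_invariant[OF force, where I = "\<lambda>B. B \<subseteq> {Inl v, Inr v}"])
      fix B x assume B: "B \<subseteq> {Inl v, Inr v}" and x: "x \<in> pverts ?G - B" and R: "?R B x"
      have "x \<in> {Inl v, Inr v}"
        using R
      proof
        assume "\<exists>u\<in>B. nbhd ?G u - B = {x}"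
        then obtain y where y: "y \<in> B" "nbhd ?G y - B = {x}" by blast
        show ?thesis
        proof (cases "y = Inl v")
          case True
          hence "Inl u \<in> nbhd ?G y - B" "Inl w \<in> nbhd ?G y - B" using B uw v by auto
          hence "Inl u = x" "Inl w = x" unfolding y(2) by blast+
          thus ?thesis using uw(1) by blast
        next
          case False
          hence "y = Inr v" using y B by auto
          thus ?thesis using y(2) v by auto
        qed
      next
        assume "nbhd ?G x \<noteq> {} \<and> nbhd ?G x \<subseteq> B"
        thus ?thesis using B x by (cases x) auto
      qed
      thus "insert x B \<subseteq> {Inl v, Inr v}" using B by blast
    qed (rule v)
    moreover have "Inl u \<in> pverts ?G"
      using uw p v nbhd_cycle_graph[OF p v(1)] by (auto simp: doubleton_eq_iff split: if_splits)
    ultimately have "Inl u \<in> {Inl v, Inr v}" by blast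
    thus False using uw(2) by simp
  qed
qed


section \<open>Bounds on the kernel dimension\<close>

text \<open>
Among any three kernel vectors a nontrivial combination vanishes at the positions \<open>i\<close> and \<open>j\<close>.
\<close>

lemma kernel_dim_le_2:
  fixes A :: "real mat"
  assumes A: "A \<in> carrier_mat p p" and ij: "i < p" "j < p"
    and det: "\<And>x. x \<in> carrier_vec p \<Longrightarrow> A *\<^sub>v x = 0\<^sub>v p \<Longrightarrow> x $ i = 0 \<Longrightarrow> x $ j = 0 \<Longrightarrow> x = 0\<^sub>v p"
  shows "kernel_dim A \<le> 2"
proof (rule ccontr)
  assume big: "\<not> ?thesis"
  interpret K: kernel p p A by unfold_locales (rule A)
  obtain \<beta> where \<beta>: "finite \<beta>" "K.basis \<beta>" using kernel_basis_exists[OF A] by blast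
  hence "3 \<le> card \<beta>" using big K.Ker.dim_basis[of \<beta>] by simp
  then obtain X where X: "X \<subseteq> \<beta>" "card X = 3" by (metis obtain_subset_with_card_n)
  then obtain u v w where uvw: "X = {u, v, w}" "u \<noteq> v" "u \<noteq> w" "v \<noteq> w" by (metis card_3_iff)
  have Xk: "X \<subseteq> mat_kernel A" and indep: "K.lin_indpt \<beta>"
    using \<beta>(2) X(1) unfolding K.Ker.basis_def by auto
  obtain s t r where str: "s \<noteq> 0 \<or> t \<noteq> 0 \<or> r \<noteq> 0"
      "s * u $ i + t * v $ i + r * w $ i = 0" "s * u $ j + t * v $ j + r * w $ j = 0"
    using two_equations_three_unknowns[of "u $ i" "v $ i" "w $ i" "u $ j" "v $ j" "w $ j"] by (elim exE conjE)
  define c where "c z = (if z = u then s else if z = v then t else r)" for z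
  define x where "x = K.lincomb c X"
  have xk: "x \<in> mat_kernel A" unfolding x_def by (rule K.Ker.lincomb_closed[OF Xk]) auto
  have xl: "x $ l = s * u $ l + t * v $ l + r * w $ l" if "l < p" for l
    unfolding x_def K.lincomb_index[OF that Xk] using uvw by (simp add: c_def)
  have "x $ i = 0" "x $ j = 0" unfolding xl[OF ij(1)] xl[OF ij(2)] by (rule str)+
  hence "x = 0\<^sub>v p" using det mat_kernelD[OF A xk] by blast
  moreover have "\<exists>z\<in>X. c z \<noteq> 0" using str(1) uvw by (auto simp: c_def)
  ultimately have "K.lin_dep \<beta>"
    using K.Ker.lin_dep_crit[of X \<beta> c] uvw X(1) unfolding x_def by auto
  thus False using indep by blast
qed

lemma kernel_dim_ge_2:
  fixes A :: "real mat"
  assumes A: "A \<in> carrier_mat p p" and ker: "A *\<^sub>v u = 0\<^sub>v p" "A *\<^sub>v v = 0\<^sub>v p"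
    and uv: "u \<in> carrier_vec p" "v \<in> carrier_vec p" "u \<bullet> u = 1" "v \<bullet> v = 1" "u \<bullet> v = 0"
  shows "2 \<le> kernel_dim A"
proof -
  interpret K: kernel p p A by unfold_locales (rule A)
  have uk: "{u, v} \<subseteq> mat_kernel A" using mat_kernelI[OF A] ker uv by auto
  have neq: "u \<noteq> v" using uv by auto
  have coeffs: "c u = 0 \<and> c v = 0" if "K.lincomb c {u, v} = 0\<^sub>v p" for c
  proof -
    have z: "c u * u $ l + c v * v $ l = 0" if "l < p" for l
      using K.lincomb_index[OF that uk, of c] \<open>K.lincomb c {u, v} = 0\<^sub>v p\<close> that neq by simp
    have "c u * (u \<bullet> u) + c v * (u \<bullet> v) = (\<Sum>l<p. (c u * u $ l + c v * v $ l) * u $ l)"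
      "c u * (u \<bullet> v) + c v * (v \<bullet> v) = (\<Sum>l<p. (c u * u $ l + c v * v $ l) * v $ l)"
      using uv(1,2)
      by (simp_all add: scalar_prod_def atLeast0LessThan sum_distrib_left sum.distrib algebra_simps)
    moreover have "(\<Sum>l<p. (c u * u $ l + c v * v $ l) * u $ l) = 0"
      "(\<Sum>l<p. (c u * u $ l + c v * v $ l) * v $ l) = 0"
      by (intro sum.neutral; simp add: z)+
    ultimately show ?thesis unfolding uv(3-5) by simp
  qed
  have "K.lin_indpt {u, v}"
    by (rule K.Ker.finite_lin_indpt2) (use uk in \<open>auto dest: coeffs\<close>)
  moreover have "K.Ker.fin_dim"
  proof -
    obtain \<beta> where "finite \<beta>" "K.basis \<beta>" using kernel_basis_exists[OF A] by blast
    thus ?thesis unfolding K.Ker.fin_dim_def K.Ker.basis_def by blast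
  qed
  ultimately show ?thesis using K.Ker.li_le_dim(2)[of "{u, v}"] uk neq by simp
qed


section \<open>Admissible spectra and cycle matrices\<close>

lemma cycle_graph_arcs:
  assumes "3 \<le> p" "i < j" "j < p"
  shows "(i, j) \<in> parcs (cycle_graph p) \<longleftrightarrow> j = Suc i \<or> i = 0 \<and> j = p - 1"
proof -
  have "(i, j) \<in> parcs (cycle_graph p) \<longleftrightarrow> j \<in> nbhd (cycle_graph p) i" by (simp add: nbhd_def)
  also have "\<dots> \<longleftrightarrow> j = Suc i \<or> i = 0 \<and> j = p - 1"
    using assms nbhd_cycle_graph[OF assms(1), of i] by auto
  finally show ?thesis .
qed

lemma cycle_patternI:
  assumes "3 \<le> p" "A \<in> carrier_mat p p" "transpose_mat A = A"
    and "\<And>u v. u < p \<Longrightarrow> v < p \<Longrightarrow> u \<noteq> v \<Longrightarrow> A $$ (u, v) \<noteq> 0 \<longleftrightarrow> (u, v) \<in> parcs (cycle_graph p)"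
  shows "cycle_pattern p A"
  unfolding cycle_pattern_def
proof (intro conjI allI impI assms(2,3))
  fix i j assume "i < p" "j < p" "i < j"
  thus "A $$ (i, j) \<noteq> 0 \<longleftrightarrow> j = Suc i \<or> i = 0 \<and> j = p - 1"
    using assms(4)[of i j] cycle_graph_arcs[OF assms(1)] by simp
qed

lemma cycle_patternD:
  assumes "3 \<le> p" and A: "cycle_pattern p A" and uv: "u < p" "v < p" "u \<noteq> v"
  shows "A $$ (u, v) \<noteq> 0 \<longleftrightarrow> (u, v) \<in> parcs (cycle_graph p)"
proof -
  have sym: "(x, y) \<in> parcs (cycle_graph p) \<longleftrightarrow> (y, x) \<in> parcs (cycle_graph p)" for x y
    by (auto simp: cycle_graph_def)
  have less: "A $$ (x, y) \<noteq> 0 \<longleftrightarrow> (x, y) \<in> parcs (cycle_graph p)" if "x < y" "y < p" for x y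
    using cycle_pattern_entry[OF A that] cycle_graph_arcs[OF assms(1) that] by blast
  show ?thesis
  proof (cases "u < v")
    case True
    thus ?thesis using less uv by blast
  next
    case False
    hence "v < u" using uv by simp
    thus ?thesis using less[of v u] uv sym[of u v] cycle_pattern_sym[OF A uv(1,2)] by metis
  qed
qed

text \<open>
The spectra of the theorem without reference to a list: the sum of consecutive multiplicities between two
double values is the number of elements, counted with multiplicity, in the closed interval between them.
\<close>

definition admissible :: "nat \<Rightarrow> real multiset \<Rightarrow> bool" where
  "admissible p \<Lambda> \<longleftrightarrow> size \<Lambda> = p \<and> (\<forall>x\<in>#\<Lambda>. 0 < x) \<and> (\<forall>x. count \<Lambda> x \<le> 2) \<and>
     (\<forall>x y. x < y \<and> count \<Lambda> x = 2 \<and> count \<Lambda> y = 2 \<longrightarrow> even (size {#e \<in># \<Lambda>. x \<le> e \<and> e \<le> y#}))"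

lemma size_filter_eq_sum_count:
  "size (filter_mset P \<Lambda>) = (\<Sum>x\<in>{x \<in> set_mset \<Lambda>. P x}. count \<Lambda> x)"
  unfolding size_multiset_overloaded_eq by (intro sum.cong) auto

lemma admissible_iff_ordered_multiplicity_list:
  "admissible p \<Lambda> \<longleftrightarrow>
    (\<forall>x\<in>#\<Lambda>. 0 < x) \<and>
    (let m = ordered_multiplicity_list \<Lambda>; q = length m in
      (\<forall>i<q. m ! i = 1 \<or> m ! i = 2) \<and> p = (\<Sum>i<q. m ! i) \<and>
      (\<forall>k k'. k < k' \<and> k' < q \<and> m ! k = 2 \<and> m ! k' = 2 \<longrightarrow> even (\<Sum>i=k..k'. m ! i)))"
proof -
  define xs where "xs = sorted_list_of_set (set_mset \<Lambda>)"
  define m where "m = ordered_multiplicity_list \<Lambda>"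
  have xs: "set xs = set_mset \<Lambda>" "distinct xs" "sorted_wrt (<) xs" by (simp_all add: xs_def strict_sorted_iff)
  have m: "length m = length xs" "\<And>i. i < length xs \<Longrightarrow> m ! i = count \<Lambda> (xs ! i)"
    by (simp_all add: m_def ordered_multiplicity_list_def xs_def)
  have less: "xs ! i < xs ! j \<longleftrightarrow> i < j" if "i < length xs" "j < length xs" for i j
    using sorted_wrt_nth_less[OF xs(3), of i j] sorted_wrt_nth_less[OF xs(3), of j i] that
    by (cases i j rule: linorder_cases) auto
  have le: "xs ! i \<le> xs ! j \<longleftrightarrow> i \<le> j" if "i < length xs" "j < length xs" for i j
    using less[OF that(2,1)] by (simp add: not_less[symmetric])
  have sum: "(\<Sum>i=k..k'. m ! i) = size {#e \<in># \<Lambda>. xs ! k \<le> e \<and> e \<le> xs ! k'#}"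
    if "k < k'" "k' < length xs" for k k'
  proof -
    have img: "(\<lambda>i. xs ! i) ` {k..k'} = {x \<in> set_mset \<Lambda>. xs ! k \<le> x \<and> x \<le> xs ! k'}"
    proof (intro equalityI subsetI)
      fix x assume "x \<in> (\<lambda>i. xs ! i) ` {k..k'}"
      thus "x \<in> {x \<in> set_mset \<Lambda>. xs ! k \<le> x \<and> x \<le> xs ! k'}" using that le by (auto simp: xs(1)[symmetric])
    next
      fix x assume x: "x \<in> {x \<in> set_mset \<Lambda>. xs ! k \<le> x \<and> x \<le> xs ! k'}"
      hence "x \<in> set xs" using xs(1) by simp
      then obtain i where "i < length xs" "x = xs ! i" by (auto simp: in_set_conv_nth)
      thus "x \<in> (\<lambda>i. xs ! i) ` {k..k'}" using x le that by auto
    qed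
    have inj: "inj_on (\<lambda>i. xs ! i) {k..k'}" using xs(2) that by (intro inj_onI) (auto simp: nth_eq_iff_index_eq)
    have "size {#e \<in># \<Lambda>. xs ! k \<le> e \<and> e \<le> xs ! k'#} = (\<Sum>i\<in>{k..k'}. count \<Lambda> (xs ! i))"
      unfolding size_filter_eq_sum_count img[symmetric] by (subst sum.reindex[OF inj]) simp
    also have "\<dots> = (\<Sum>i=k..k'. m ! i)" using that by (intro sum.cong refl) (simp add: m)
    finally show ?thesis ..
  qed
  have total: "(\<Sum>i<length xs. m ! i) = size \<Lambda>"
  proof -
    have "(\<Sum>i<length xs. m ! i) = (\<Sum>i<length xs. count \<Lambda> (xs ! i))" by (intro sum.cong refl) (simp add: m)
    also have "\<dots> = sum_list (map (count \<Lambda>) xs)" by (simp add: sum_list_sum_nth atLeast0LessThan)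
    also have "\<dots> = sum (count \<Lambda>) (set_mset \<Lambda>)" using xs(1,2) by (simp add: sum_list_distinct_conv_sum_set)
    finally show ?thesis by (simp add: size_multiset_overloaded_eq)
  qed
  have c1: "(\<forall>i<length xs. m ! i = 1 \<or> m ! i = 2) \<longleftrightarrow> (\<forall>x. count \<Lambda> x \<le> 2)"
  proof -
    have "(\<forall>i<length xs. m ! i = 1 \<or> m ! i = 2) \<longleftrightarrow> (\<forall>x\<in>set xs. count \<Lambda> x = 1 \<or> count \<Lambda> x = 2)"
      by (simp add: all_set_conv_all_nth m(2))
    also have "\<dots> \<longleftrightarrow> (\<forall>x\<in>#\<Lambda>. count \<Lambda> x \<le> 2)"
    proof (unfold xs(1), intro ball_cong refl)
      fix x assume "x \<in># \<Lambda>"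
      hence "0 < count \<Lambda> x" by simp
      thus "count \<Lambda> x = 1 \<or> count \<Lambda> x = 2 \<longleftrightarrow> count \<Lambda> x \<le> 2" by linarith
    qed
    also have "\<dots> \<longleftrightarrow> (\<forall>x. count \<Lambda> x \<le> 2)" by (metis le0 not_in_iff)
    finally show ?thesis .
  qed
  have c2: "(\<forall>k k'. k < k' \<and> k' < length xs \<and> m ! k = 2 \<and> m ! k' = 2 \<longrightarrow> even (\<Sum>i=k..k'. m ! i)) \<longleftrightarrow>
     (\<forall>x y. x < y \<and> count \<Lambda> x = 2 \<and> count \<Lambda> y = 2 \<longrightarrow> even (size {#e \<in># \<Lambda>. x \<le> e \<and> e \<le> y#}))"
     (is "?L \<longleftrightarrow> ?R")
  proof
    assume L: ?L
    show ?R
    proof (intro allI impI, elim conjE)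
      fix x y assume xy: "x < y" "count \<Lambda> x = 2" "count \<Lambda> y = 2"
      hence "x \<in> set xs" "y \<in> set xs" using xs(1) by (auto simp flip: count_greater_zero_iff)
      then obtain i j where ij: "i < length xs" "x = xs ! i" "j < length xs" "y = xs ! j"
        by (auto simp: in_set_conv_nth)
      have "i < j" using ij xy(1) less by blast
      thus "even (size {#e \<in># \<Lambda>. x \<le> e \<and> e \<le> y#})"
        using L[rule_format, of i j] ij xy m(2)[of i] m(2)[of j] sum[of i j] by simp
    qed
  next
    assume R: ?R
    show ?L
    proof (intro allI impI, elim conjE)
      fix k k' assume k: "k < k'" "k' < length xs" "m ! k = 2" "m ! k' = 2"
      hence "xs ! k < xs ! k'" "count \<Lambda> (xs ! k) = 2" "count \<Lambda> (xs ! k') = 2" using less m(2) by auto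
      thus "even (\<Sum>i=k..k'. m ! i)" unfolding sum[OF k(1,2)] using R by blast
    qed
  qed
  show ?thesis
    unfolding Let_def m_def[symmetric] m(1) c1 c2 total admissible_def by auto
qed

text \<open>
Turns the parity of an interval between double values into a comparison of the numbers of elements below
its endpoints.
\<close>

lemma size_filter_interval:
  assumes "x < (y :: real)"
  shows "size {#e \<in># \<Lambda>. x \<le> e \<and> e \<le> y#} + size {#e \<in># \<Lambda>. e < x#} = size {#e \<in># \<Lambda>. e < y#} + count \<Lambda> y"
  using assms by (induction \<Lambda>) auto

lemma prod_diff_squares_sign:
  fixes ds :: "real list"
  assumes "0 < x" "\<And>d. d \<in> set ds \<Longrightarrow> 0 < d \<and> d \<noteq> x"
  shows "0 < (- 1) ^ size {#e \<in># mset ds. e < x#} * (\<Prod>d\<leftarrow>ds. d\<^sup>2 - x\<^sup>2)"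
  using assms(2)
proof (induction ds)
  case (Cons d ds)
  let ?P = "(- 1) ^ size {#e \<in># mset ds. e < x#} * (\<Prod>d\<leftarrow>ds. d\<^sup>2 - x\<^sup>2)"
  have IH: "0 < ?P" using Cons by simp
  have d: "0 < d" "d \<noteq> x" using Cons.prems[of d] by auto
  show ?case
  proof (cases "d < x")
    case True
    hence "0 < x\<^sup>2 - d\<^sup>2" using d by (simp add: power_strict_mono)
    hence "0 < (x\<^sup>2 - d\<^sup>2) * ?P" using IH by (rule mult_pos_pos)
    thus ?thesis using True by (simp add: algebra_simps)
  next
    case False
    hence "0 < d\<^sup>2 - x\<^sup>2" using \<open>0 < x\<close> d by (simp add: power_strict_mono)
    hence "0 < (d\<^sup>2 - x\<^sup>2) * ?P" using IH by (rule mult_pos_pos)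
    thus ?thesis using False by (simp add: algebra_simps)
  qed
qed simp

lemma prod_neg_squares_mset_cong:
  assumes "mset ds = mset es"
  shows "(\<Prod>d\<leftarrow>ds. [:d\<^sup>2, 1:]) = (\<Prod>d\<leftarrow>es. [:d\<^sup>2, 1 :: real:])"
proof -
  have "mset (map (\<lambda>d. [:d\<^sup>2, 1:]) ds) = mset (map (\<lambda>d. [:d\<^sup>2, 1:]) es)" using assms by simp
  thus ?thesis by (metis prod_mset_prod_list)
qed

lemma diagonalize_cycle_matrix:
  assumes A: "cycle_pattern p A" and cp: "char_poly A = (\<Prod>d\<leftarrow>ds. [:d\<^sup>2, 1:])"
    and es: "mset es = mset ds" and len: "length ds = p"
  obtains Q where "Q \<in> carrier_mat p p" "transpose_mat Q * Q = 1\<^sub>m p"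
    "transpose_mat Q * A * Q = mat_diag p (\<lambda>i. - (es ! i)\<^sup>2)"
proof -
  have Ac: "A \<in> carrier_mat p p" "transpose_mat A = A" using A by (auto simp: cycle_pattern_def)
  have "char_poly A = (\<Prod>a\<leftarrow>map (\<lambda>d. - d\<^sup>2) es. [:- a, 1:])"
    unfolding cp prod_neg_squares_mset_cong[OF es[symmetric]] by (simp add: o_def)
  from real_symmetric_diagonalization[OF Ac this] obtain Q where
    Q: "Q \<in> carrier_mat p p" "transpose_mat Q * Q = 1\<^sub>m p"
      "transpose_mat Q * A * Q = mat_diag p (\<lambda>i. map (\<lambda>d. - d\<^sup>2) es ! i)" by blast
  have "length es = p" using es len by (metis mset_eq_length)
  hence "mat_diag p (\<lambda>i. map (\<lambda>d. - d\<^sup>2) es ! i) = mat_diag p (\<lambda>i. - (es ! i)\<^sup>2)"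
    by (intro eq_matI) (auto simp: mat_diag_def)
  thus ?thesis using Q that by metis
qed

text \<open>
The eigenvalues are \<open>- d\<^sup>2\<close>, as they come from \<open>- M\<close>. Listing the copies of one value in convenient positions
is harmless because diagonalization allows any order of the eigenvalues. By the sign rule, the parity of
the number of elements below a double value is determined by the sign of one fixed product of entries.
\<close>

lemma cycle_spectrum_admissible:
  assumes p: "3 \<le> p" and A: "cycle_pattern p A" and len: "length ds = p"
    and pos: "\<And>d. d \<in> set ds \<Longrightarrow> 0 < d" and cp: "char_poly A = (\<Prod>d\<leftarrow>ds. [:d\<^sup>2, 1:])"
  shows "admissible p (mset ds)"
proof -
  have Ac: "A \<in> carrier_mat p p" using A by (auto simp: cycle_pattern_def)
  have count: "count (mset ds) x \<le> 2" for x
  proof (rule ccontr)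
    assume "\<not> ?thesis"
    hence "3 \<le> count (mset ds) x" by simp
    hence "replicate_mset 3 x \<subseteq># mset ds"
      by (simp add: count_le_replicate_mset_subset_eq[symmetric])
    hence "{#x, x, x#} \<subseteq># mset ds" by (simp add: numeral_3_eq_3)
    then obtain R where "mset ds = {#x, x, x#} + R" by (metis subset_mset.add_diff_inverse)
    moreover obtain rest where "mset rest = R" using ex_mset by blast
    ultimately have es: "mset (x # x # x # rest) = mset ds" by simp
    obtain Q where Q: "Q \<in> carrier_mat p p" "transpose_mat Q * Q = 1\<^sub>m p"
      "transpose_mat Q * A * Q = mat_diag p (\<lambda>i. - ((x # x # x # rest) ! i)\<^sup>2)"
      by (rule diagonalize_cycle_matrix[OF A cp es len])
    note ent = orthonormal_eigenbasis_entries[OF Ac Q]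
    have "\<not> (- ((x # x # x # rest) ! 0)\<^sup>2 = - ((x # x # x # rest) ! 1)\<^sup>2 \<and>
        - ((x # x # x # rest) ! 0)\<^sup>2 = - ((x # x # x # rest) ! 2)\<^sup>2)"
      by (rule cycle_eigenvalue_not_triple[OF A p ent(1) ent(3)]) (use p in auto)
    thus False by simp
  qed
  \<comment> \<open>The product of all edge weights, whose sign is the reference for every double eigenvalue.\<close>
  define c where "c = (\<Prod>i<p - 1. A $$ (i, Suc i)) * A $$ (0, p - 1)"
  have double: "(- 1) ^ size {#e \<in># mset ds. e < x#} * c < 0" if x: "count (mset ds) x = 2" for x
  proof -
    have "replicate_mset 2 x \<subseteq># mset ds"
      using x by (simp add: count_le_replicate_mset_subset_eq[symmetric])
    hence "{#x, x#} \<subseteq># mset ds" by (simp add: numeral_2_eq_2)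
    then obtain R where R: "mset ds = {#x, x#} + R" by (metis subset_mset.add_diff_inverse)
    then obtain rest where rest: "mset rest = R" using ex_mset by blast
    have es: "mset (rest @ [x, x]) = mset ds" using R rest by simp
    have "count R x = 0" using x R by simp
    hence notin: "x \<notin> set rest" using rest by (metis not_in_iff set_mset_mset)
    have lr: "length rest = p - 2" using mset_eq_length[OF es] len by simp
    have sub: "d \<in> set ds" if "d \<in> set rest \<or> d = x" for d
      using mset_eq_setD[OF es] that by auto
    obtain Q where Q: "Q \<in> carrier_mat p p" "transpose_mat Q * Q = 1\<^sub>m p"
      "transpose_mat Q * A * Q = mat_diag p (\<lambda>i. - ((rest @ [x, x]) ! i)\<^sup>2)"
      by (rule diagonalize_cycle_matrix[OF A cp es len])
    have "p - 1 = Suc (p - 2)" using p by simp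
    hence "(\<Prod>k<p - 2. - x\<^sup>2 - - ((rest @ [x, x]) ! k)\<^sup>2) * c < 0"
      unfolding c_def
      by (intro cycle_double_eigenvalue_sign[OF A p Q]) (simp_all add: nth_append lr)
    also have "(\<Prod>k<p - 2. - x\<^sup>2 - - ((rest @ [x, x]) ! k)\<^sup>2) = (\<Prod>k<p - 2. (rest ! k)\<^sup>2 - x\<^sup>2)"
      using lr by (intro prod.cong refl) (simp add: nth_append)
    also have "\<dots> = (\<Prod>d\<leftarrow>rest. d\<^sup>2 - x\<^sup>2)"
      using lr by (simp add: prod.list_conv_set_nth atLeast0LessThan)
    finally have neg: "(\<Prod>d\<leftarrow>rest. d\<^sup>2 - x\<^sup>2) * c < 0" .
    have "0 < (- 1) ^ size {#e \<in># mset rest. e < x#} * (\<Prod>d\<leftarrow>rest. d\<^sup>2 - x\<^sup>2)"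
      using sub pos notin by (intro prod_diff_squares_sign) auto
    moreover have "{#e \<in># mset ds. e < x#} = {#e \<in># mset rest. e < x#}"
      unfolding R rest by simp
    ultimately show ?thesis using neg by (cases "even (size {#e \<in># mset rest. e < x#})") (auto simp: mult_less_0_iff)
  qed
  have "even (size {#e \<in># mset ds. x \<le> e \<and> e \<le> y#})"
    if xy: "x < y" "count (mset ds) x = 2" "count (mset ds) y = 2" for x y
  proof -
    have "even (size {#e \<in># mset ds. e < x#}) = even (size {#e \<in># mset ds. e < y#})"
    proof (rule ccontr)
      assume "\<not> ?thesis"
      thus False using double[OF xy(2)] double[OF xy(3)] by auto
    qed
    moreover have "size {#e \<in># mset ds. x \<le> e \<and> e \<le> y#} + size {#e \<in># mset ds. e < x#} =
        size {#e \<in># mset ds. e < y#} + 2"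
      using size_filter_interval[OF xy(1), of "mset ds"] xy(3) by simp
    ultimately show ?thesis by (metis even_add even_numeral)
  qed
  thus ?thesis unfolding admissible_def using len pos count by auto
qed

text \<open>
In the sorted list, a double value occupies two consecutive positions, and the interval from one double
value to another occupies a block of consecutive positions, so its size determines the parity of the
distance between the two positions.
\<close>

lemma admissible_cycle_matrix:
  assumes p: "3 \<le> p" and adm: "admissible p \<Lambda>"
  obtains A ds where "cycle_pattern p A" "mset ds = \<Lambda>" "length ds = p"
    "char_poly A = (\<Prod>d\<leftarrow>ds. [:- d\<^sup>2, 1:])"
proof -
  define ds where "ds = sorted_list_of_multiset \<Lambda>"
  have ds: "mset ds = \<Lambda>" "sorted ds" by (simp_all add: ds_def)
  have len: "length ds = p" using ds(1) adm by (metis admissible_def size_mset)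
  have pos: "0 < ds ! i" if "i < p" for i
    using adm that len ds(1) by (auto simp: admissible_def)
  have mono: "ds ! i \<le> ds ! j" if "i \<le> j" "j < p" for i j
    using ds(2) that len by (simp add: sorted_nth_mono)
  have size: "size (filter_mset P \<Lambda>) = card {i. i < p \<and> P (ds ! i)}" for P
    unfolding ds(1)[symmetric] mset_filter[symmetric] size_mset length_filter_conv_card len ..
  have count: "count \<Lambda> x = card {i. i < p \<and> ds ! i = x}" for x
    using size[of "\<lambda>e. e = x"] by (simp add: filter_eq_replicate_mset)
  have no3: False if "i < j" "j < k" "k < p" "ds ! i = ds ! j" "ds ! j = ds ! k" for i j k
  proof -
    have "card {i, j, k} \<le> card {m. m < p \<and> ds ! m = ds ! k}" using that by (intro card_mono) auto
    moreover have "card {i, j, k} = 3" using that by simp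
    moreover have "count \<Lambda> (ds ! k) \<le> 2" using adm by (simp add: admissible_def)
    ultimately show False using count[of "ds ! k"] by simp
  qed
  have "\<exists>A. cycle_pattern p A \<and> char_poly A = (\<Prod>i<p. [:- (ds ! i)\<^sup>2, 1:])"
  proof (rule ex_cycle_matrix_with_char_poly[OF p])
    show "(ds ! i)\<^sup>2 \<le> (ds ! j)\<^sup>2" if "i \<le> j" "j < p" for i j
      using mono[OF that] pos[of i] that by (simp add: power_mono)
    show "(ds ! i)\<^sup>2 < (ds ! Suc (Suc i))\<^sup>2" if "Suc (Suc i) < p" for i
    proof -
      have "ds ! i \<le> ds ! Suc i" "ds ! Suc i \<le> ds ! Suc (Suc i)" using mono that by auto
      moreover have "\<not> (ds ! i = ds ! Suc i \<and> ds ! Suc i = ds ! Suc (Suc i))"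
        using no3[of i "Suc i" "Suc (Suc i)"] that by auto
      ultimately have "ds ! i < ds ! Suc (Suc i)" by linarith
      thus ?thesis using pos[of i] that by (simp add: power_strict_mono)
    qed
    show "even (j - i)" if ij: "i < j" "Suc j < p"
      "(ds ! i)\<^sup>2 = (ds ! Suc i)\<^sup>2" "(ds ! j)\<^sup>2 = (ds ! Suc j)\<^sup>2" for i j
    proof -
      have eq: "ds ! i = ds ! Suc i" "ds ! j = ds ! Suc j"
        using ij pos[of i] pos[of "Suc i"] pos[of j] pos[of "Suc j"] by (auto simp: power2_eq_iff)
      have Si: "Suc i < p" using ij by simp
      have "ds ! i \<noteq> ds ! j" using no3[of i j "Suc j"] ij eq by auto
      hence less: "ds ! i < ds ! j" using mono[of i j] ij by simp
      have two: "count \<Lambda> (ds ! k) = 2" if "Suc k < p" "ds ! k = ds ! Suc k" for k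
      proof -
        have "card {k, Suc k} \<le> card {m. m < p \<and> ds ! m = ds ! k}" using that by (intro card_mono) auto
        hence "2 \<le> count \<Lambda> (ds ! k)" using count by simp
        thus ?thesis using adm by (simp add: admissible_def le_antisym)
      qed
      have "{m. m < p \<and> ds ! i \<le> ds ! m \<and> ds ! m \<le> ds ! j} = {i..Suc j}"
      proof (intro equalityI subsetI)
        fix m assume "m \<in> {i..Suc j}"
        thus "m \<in> {m. m < p \<and> ds ! i \<le> ds ! m \<and> ds ! m \<le> ds ! j}"
          using mono[of i m] mono[of m "Suc j"] ij eq by auto
      next
        fix m assume m: "m \<in> {m. m < p \<and> ds ! i \<le> ds ! m \<and> ds ! m \<le> ds ! j}"
        have "\<not> m < i"
        proof
          assume "m < i"
          hence "ds ! m \<le> ds ! i" using Si by (intro mono) auto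
          hence "ds ! m = ds ! i" using m by auto
          from no3[OF \<open>m < i\<close> lessI Si this eq(1)] show False .
        qed
        moreover have "\<not> Suc j < m"
        proof
          assume "Suc j < m"
          hence "ds ! Suc j \<le> ds ! m" using m by (intro mono) auto
          hence "ds ! Suc j = ds ! m" using m eq(2) by auto
          from no3[OF lessI \<open>Suc j < m\<close> _ eq(2) this] show False using m by simp
        qed
        ultimately show "m \<in> {i..Suc j}" by auto
      qed
      hence "size {#e \<in># \<Lambda>. ds ! i \<le> e \<and> e \<le> ds ! j#} = Suc (Suc j) - i"
        unfolding size by simp
      moreover have "even (size {#e \<in># \<Lambda>. ds ! i \<le> e \<and> e \<le> ds ! j#})"
        using adm less two[OF Si eq(1)] two[OF ij(2) eq(2)]
        unfolding admissible_def by blast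
      ultimately show "even (j - i)" using ij by simp
    qed
  qed
  then obtain A where "cycle_pattern p A" "char_poly A = (\<Prod>i<p. [:- (ds ! i)\<^sup>2, 1:])" by blast
  moreover have "(\<Prod>i<p. [:- (ds ! i)\<^sup>2, 1:]) = (\<Prod>d\<leftarrow>ds. [:- d\<^sup>2, 1:])"
    using len by (simp add: prod.list_conv_set_nth atLeast0LessThan)
  ultimately show ?thesis using that[of A ds] ds len by simp
qed


section \<open>Symplectic spectra of the corona of a cycle\<close>

lemma mat_add_uminus_self:
  assumes "X \<in> carrier_mat n m"
  shows "X + - X = 0\<^sub>m n m" "- X + X = (0\<^sub>m n m :: 'a :: ring mat)"
  using assms by (auto intro!: eq_matI)

text \<open>
With \<open>Q\<close> diagonalizing \<open>A\<close> and \<open>D = diag ds\<close>, the factors \<open>Q D\<^sup>-\<^sup>1\<^sup>/\<^sup>2\<close> and \<open>Q D\<^sup>1\<^sup>/\<^sup>2\<close> balance \<open>A \<oplus> I\<close> to \<open>D \<oplus> D\<close>, since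
\<open>D\<^sup>-\<^sup>1\<^sup>/\<^sup>2 D\<^sup>2 D\<^sup>-\<^sup>1\<^sup>/\<^sup>2 = D = D\<^sup>1\<^sup>/\<^sup>2 D\<^sup>1\<^sup>/\<^sup>2\<close>.
\<close>

lemma symplectic_realization:
  assumes A: "A \<in> carrier_mat p p" "transpose_mat A = A"
    and len: "length ds = p" and pos: "\<And>d. d \<in> set ds \<Longrightarrow> 0 < d"
    and cp: "char_poly A = (\<Prod>d\<leftarrow>ds. [:- d\<^sup>2, 1:])"
  shows "has_symplectic_spectrum p (four_block_mat (A + 1\<^sub>m p) (1\<^sub>m p) (1\<^sub>m p) (1\<^sub>m p)) (mset ds)"
proof -
  have "char_poly A = (\<Prod>a\<leftarrow>map power2 ds. [:- a, 1:])" unfolding cp by (simp add: o_def)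
  from real_symmetric_diagonalization[OF A this] obtain Q where Q: "Q \<in> carrier_mat p p"
    "transpose_mat Q * Q = 1\<^sub>m p" "transpose_mat Q * A * Q = mat_diag p (\<lambda>i. map power2 ds ! i)" by blast
  define r where "r i = sqrt (ds ! i)" for i
  have r: "0 < r i" "r i * r i = ds ! i" if "i < p" for i
    using pos[of "ds ! i"] that len by (auto simp: r_def)
  define R where "R = mat_diag p r"
  define R' where "R' = mat_diag p (\<lambda>i. 1 / r i)"
  have Rc: "R \<in> carrier_mat p p" "R' \<in> carrier_mat p p" by (simp_all add: R_def R'_def)
  have Rt: "transpose_mat R = R" "transpose_mat R' = R'"
    by (auto simp: R_def R'_def mat_diag_def intro!: eq_matI)
  define D where "D = mat_diag p (\<lambda>i. ds ! i)"
  have Dc: "D \<in> carrier_mat p p" by (simp add: D_def)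
  have RR: "R * R = D" "R' * R = 1\<^sub>m p" "R * R' = 1\<^sub>m p" "R' * mat_diag p (\<lambda>i. map power2 ds ! i) * R' = D"
  proof -
    have "R' * mat_diag p (\<lambda>i. map power2 ds ! i) * R' = mat_diag p (\<lambda>i. 1 / r i * (map power2 ds ! i) * (1 / r i))"
      by (simp add: R'_def)
    also have "\<dots> = D"
    proof (rule eq_matI)
      fix i j assume "i < dim_row D" "j < dim_col D"
      hence ij: "i < p" "j < p" using Dc by auto
      have "1 / r j * (ds ! j)\<^sup>2 * (1 / r j) = ds ! j"
        unfolding r(2)[OF ij(2), symmetric] using r(1)[OF ij(2)] by (simp add: power2_eq_square)
      thus "mat_diag p (\<lambda>i. 1 / r i * (map power2 ds ! i) * (1 / r i)) $$ (i, j) = D $$ (i, j)"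
        using ij len by (simp add: mat_diag_def D_def)
    qed (use Dc in \<open>auto simp: mat_diag_def\<close>)
    finally show "R' * mat_diag p (\<lambda>i. map power2 ds ! i) * R' = D" .
    show "R * R = D"
      unfolding R_def D_def mat_diag_diag by (rule eq_matI) (auto simp: mat_diag_def r(2))
    show "R' * R = 1\<^sub>m p" "R * R' = 1\<^sub>m p"
      unfolding R_def R'_def mat_diag_diag
      by (rule eq_matI; use r(1) in \<open>force simp: mat_diag_def\<close>)+
  qed
  define P where "P = Q * R"
  define P' where "P' = Q * R'"
  have Qt: "transpose_mat Q \<in> carrier_mat p p" using Q(1) by simp
  have Pc: "P \<in> carrier_mat p p" "P' \<in> carrier_mat p p" using Q(1) Rc by (auto simp: P_def P'_def)
  hence Ptc: "transpose_mat P \<in> carrier_mat p p" "transpose_mat P' \<in> carrier_mat p p" by auto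
  have Pt: "transpose_mat P = R * transpose_mat Q" "transpose_mat P' = R' * transpose_mat Q"
    unfolding P_def P'_def using transpose_mult[OF Q(1) Rc(1)] transpose_mult[OF Q(1) Rc(2)] Rt by simp_all
  have sand: "(X * transpose_mat Q) * (Q * Y) = X * Y" if "X \<in> carrier_mat p p" "Y \<in> carrier_mat p p" for X Y
  proof -
    have "(X * transpose_mat Q) * (Q * Y) = X * (transpose_mat Q * Q) * Y"
      using that Q(1) Qt by (simp add: assoc_mult_mat[of _ p p _ p _ p])
    thus ?thesis using Q(2) that by simp
  qed
  have PP: "transpose_mat P * P = D" "transpose_mat P' * P = 1\<^sub>m p" "transpose_mat P * P' = 1\<^sub>m p"
    unfolding Pt unfolding P_def P'_def using sand Rc RR by simp_all
  have PAP: "transpose_mat P' * (A * P') = D"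
  proof -
    have "transpose_mat P' * (A * P') = R' * (transpose_mat Q * A * Q) * R'"
      unfolding Pt unfolding P'_def using Q(1) Qt Rc A(1)
      by (simp add: assoc_mult_mat[of _ p p _ p _ p])
    thus ?thesis unfolding Q(3) using RR by simp
  qed
  let ?Z = "0\<^sub>m p p :: real mat"
  define N where "N = four_block_mat (A + 1\<^sub>m p) (1\<^sub>m p) (1\<^sub>m p) (1\<^sub>m p)"
  \<comment> \<open>The shear with lower left block \<open>- I\<close>, applied after the block diagonal matrix of \<open>P'\<close> and \<open>P\<close>.\<close>
  define S where "S = four_block_mat P' ?Z (- P') P"
  have S: "S \<in> carrier_mat (2 * p) (2 * p)" unfolding S_def mult_2 using Pc by (intro four_block_carrier_mat)
  have N: "N \<in> carrier_mat (2 * p) (2 * p)" unfolding N_def mult_2 using A by (intro four_block_carrier_mat) auto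
  have St: "transpose_mat S = four_block_mat (transpose_mat P') (- transpose_mat P') ?Z (transpose_mat P)"
    unfolding S_def using Pc by (subst transpose_four_block_mat[of _ p p _ p _ p]) (auto simp: transpose_uminus)
  have Stc: "transpose_mat S \<in> carrier_mat (2 * p) (2 * p)" using S by simp
  have AP: "A * P' \<in> carrier_mat p p" using mult_carrier_mat[OF A(1) Pc(2)] .
  have NS: "N * S = four_block_mat (A * P') P ?Z P"
  proof -
    have "(A + 1\<^sub>m p) * P' + 1\<^sub>m p * (- P') = A * P'"
    proof -
      have "(A + 1\<^sub>m p) * P' = A * P' + P'" using A(1) Pc by (simp add: add_mult_distrib_mat[of _ p p])
      hence "(A + 1\<^sub>m p) * P' + 1\<^sub>m p * (- P') = A * P' + (P' + - P')"
        using AP Pc by (simp add: assoc_add_mat[of _ p p])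
      thus ?thesis using AP mat_add_uminus_self[OF Pc(2)] by simp
    qed
    moreover have "(A + 1\<^sub>m p) * ?Z + 1\<^sub>m p * P = P" "1\<^sub>m p * P' + 1\<^sub>m p * (- P') = ?Z" "1\<^sub>m p * ?Z + 1\<^sub>m p * P = P"
      using A(1) Pc mat_add_uminus_self[OF Pc(2)] by simp_all
    ultimately show ?thesis
      unfolding N_def S_def using A(1) Pc by (subst mult_four_block_mat[of _ p p _ p _ p _ _ p _ p]) auto
  qed
  have SNS: "transpose_mat S * N * S = four_block_mat D ?Z ?Z D"
  proof -
    have neg: "- transpose_mat P' \<in> carrier_mat p p" using Ptc by simp
    have "transpose_mat S * (N * S) = four_block_mat
        (transpose_mat P' * (A * P') + - transpose_mat P' * ?Z) (transpose_mat P' * P + - transpose_mat P' * P)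
        (?Z * (A * P') + transpose_mat P * ?Z) (?Z * P + transpose_mat P * P)"
      unfolding NS St
      by (rule mult_four_block_mat[OF Ptc(2) neg zero_carrier_mat Ptc(1) AP Pc(1) zero_carrier_mat Pc(1)])
    also have "transpose_mat P' * P + - transpose_mat P' * P = ?Z"
      using mat_add_uminus_self[OF mult_carrier_mat[OF Ptc(2) Pc(1)]] Ptc Pc by simp
    also have "transpose_mat P' * (A * P') + - transpose_mat P' * ?Z = D"
      unfolding PAP right_mult_zero_mat[OF neg] by (rule right_add_zero_mat[OF Dc])
    also have "?Z * (A * P') + transpose_mat P * ?Z = ?Z"
      unfolding left_mult_zero_mat[OF AP] right_mult_zero_mat[OF Ptc(1)] by simp
    also have "?Z * P + transpose_mat P * P = D" unfolding PP using Pc Dc by simp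
    finally have "transpose_mat S * (N * S) = four_block_mat D ?Z ?Z D" .
    thus ?thesis using assoc_mult_mat[OF Stc N S] by simp
  qed
  have JS: "symp_form p * S = four_block_mat (- P') P (- P') ?Z"
    unfolding symp_form_def S_def using Pc
    by (subst mult_four_block_mat[of _ p p _ p _ p _ _ p _ p]) auto
  have "transpose_mat S * (symp_form p * S) = symp_form p"
  proof -
    have Xc: "transpose_mat P' * P' \<in> carrier_mat p p" using mult_carrier_mat[OF Ptc(2) Pc(2)] .
    have "transpose_mat P' * (- P') + (- transpose_mat P') * (- P') = ?Z"
      using mat_add_uminus_self[OF Xc] Ptc Pc by simp
    moreover have "transpose_mat P' * P + (- transpose_mat P') * ?Z = 1\<^sub>m p"
      "?Z * (- P') + transpose_mat P * (- P') = - 1\<^sub>m p"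
      "?Z * P + transpose_mat P * ?Z = ?Z"
    proof -
      have "- ?Z = ?Z" by (rule eq_matI) auto
      thus "transpose_mat P' * P + (- transpose_mat P') * ?Z = 1\<^sub>m p"
        "?Z * (- P') + transpose_mat P * (- P') = - 1\<^sub>m p"
        "?Z * P + transpose_mat P * ?Z = ?Z"
        using Ptc Pc PP by simp_all
    qed
    ultimately show ?thesis
      unfolding JS St unfolding symp_form_def using Pc Ptc
      by (subst mult_four_block_mat[of _ p p _ p _ p _ _ p _ p]) auto
  qed
  hence "symplectic p S" unfolding symplectic_def using S assoc_mult_mat[OF Stc symp_form_carrier S] by simp
  moreover have "diagonal_mat D" "\<forall>i<p. 0 < D $$ (i, i)"
    using pos len by (auto simp: D_def diagonal_mat_def mat_diag_def)
  moreover have "mset ds = mset (diag_mat D)"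
  proof -
    have "diag_mat D = ds" by (rule nth_equalityI) (use len in \<open>auto simp: D_def diag_mat_def mat_diag_def\<close>)
    thus ?thesis by simp
  qed
  ultimately show ?thesis
    unfolding has_symplectic_spectrum_def N_def[symmetric] using SNS Dc by blast
qed

lemma admissible_spectrum_allowed:
  assumes p: "3 \<le> p" and adm: "admissible p \<Lambda>"
  shows "allows_symplectic_spectrum (corona (cycle_graph p)) (leaf_coupling (cycle_graph p)) \<Lambda>"
proof -
  let ?H = "cycle_graph p"
  obtain A ds where A: "cycle_pattern p A" and ds: "mset ds = \<Lambda>" "length ds = p"
    and cp: "char_poly A = (\<Prod>d\<leftarrow>ds. [:- d\<^sup>2, 1:])"
    by (rule admissible_cycle_matrix[OF p adm])
  have Ac: "A \<in> carrier_mat p p" "transpose_mat A = A" using A by (auto simp: cycle_pattern_def)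
  define N where "N = four_block_mat (A + 1\<^sub>m p) (1\<^sub>m p) (1\<^sub>m p) (1\<^sub>m p)"
  define L where "L x = (case x of Inl v \<Rightarrow> v | Inr v \<Rightarrow> v + p)" for x
  have pos: "0 < d" if "d \<in> set ds" for d using adm ds(1) that by (auto simp: admissible_def)
  have spec: "has_symplectic_spectrum p N \<Lambda>"
    unfolding N_def ds(1)[symmetric] by (rule symplectic_realization[OF Ac ds(2) pos cp])
  have Nc: "N \<in> carrier_mat (2 * p) (2 * p)"
    unfolding N_def mult_2 using Ac by (intro four_block_carrier_mat) auto
  have "transpose_mat N = N"
    unfolding N_def using Ac by (subst transpose_four_block_mat[of _ p p _ p _ p]) (auto simp: transpose_add[of _ p p])
  hence pd: "pos_def (2 * p) N" using pos_def_if_has_symplectic_spectrum[OF Nc _ spec] by simp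
  have cards: "card (leaf_coupling ?H) = p" "card (pverts (corona ?H)) = 2 * p"
    using card_leaf_coupling[of ?H] card_corona[of ?H] by auto
  have "bij_betw L (pverts (corona ?H)) {0..<2 * p}"
  proof (intro bij_betw_imageI inj_onI)
    fix x y assume "x \<in> pverts (corona ?H)" "y \<in> pverts (corona ?H)" "L x = L y"
    thus "x = y" by (cases x; cases y) (auto simp: L_def)
  next
    show "L ` pverts (corona ?H) = {0..<2 * p}"
    proof (intro equalityI subsetI)
      fix i assume "i \<in> {0..<2 * p}"
      hence "i = L (if i < p then Inl i else Inr (i - p))" "(if i < p then Inl i else Inr (i - p)) \<in> pverts (corona ?H)"
        by (auto simp: L_def)
      thus "i \<in> L ` pverts (corona ?H)" by blast
    qed (auto simp: L_def corona_def)
  qed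
  moreover have "\<forall>P\<in>leaf_coupling ?H. \<exists>k<p. L ` P = {k, k + p}"
    by (auto simp: leaf_coupling_def L_def)
  ultimately have lab: "representative_labeling (corona ?H) (leaf_coupling ?H) L"
    unfolding representative_labeling_def cards by blast
  have "has_pattern (corona ?H) L N"
    unfolding has_pattern_def
  proof (intro ballI impI)
    fix x y assume xy: "x \<in> pverts (corona ?H)" "y \<in> pverts (corona ?H)" "x \<noteq> y"
    show "N $$ (L x, L y) \<noteq> 0 \<longleftrightarrow> (x, y) \<in> parcs (corona ?H)"
      using xy cycle_patternD[OF p A] Ac
      by (cases x; cases y) (auto simp: N_def L_def)
  qed
  thus ?thesis
    unfolding allows_symplectic_spectrum_def S_plus_def cards using lab pd spec by blast
qed

lemma realized_spectrum_admissible: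
  assumes p: "3 \<le> p" and L: "representative_labeling (corona (cycle_graph p)) (leaf_coupling (cycle_graph p)) L"
    and N: "N \<in> S_plus (corona (cycle_graph p)) L" and spec: "has_symplectic_spectrum p N \<Lambda>"
  shows "admissible p \<Lambda>"
proof -
  obtain S M where S: "symplectic p S" and M: "M \<in> carrier_mat p p" "transpose_mat M = M"
    and pat: "\<And>u v. u < p \<Longrightarrow> v < p \<Longrightarrow> u \<noteq> v \<Longrightarrow> M $$ (u, v) \<noteq> 0 \<longleftrightarrow> (u, v) \<in> parcs (cycle_graph p)"
    and SNS: "transpose_mat S * N * S = four_block_mat M (0\<^sub>m p p) (0\<^sub>m p p) (1\<^sub>m p)"
    using leaf_elimination[OF cycle_graph_verts L N] by blast
  have Nc: "N \<in> carrier_mat (2 * p) (2 * p)"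
    using N card_corona[of "cycle_graph p"] by (simp add: S_plus_def pos_def_def)
  obtain ds where ds: "\<Lambda> = mset ds" "length ds = p" "\<forall>d\<in>set ds. 0 < d"
    and cp: "char_poly (- M) = (\<Prod>d\<leftarrow>ds. [:d\<^sup>2, 1:])"
    using symplectic_spectrum_char_poly[OF S Nc M(1) SNS spec] by blast
  have "cycle_pattern p (- M)"
    using M pat by (intro cycle_patternI[OF p]) (auto simp: transpose_uminus)
  thus ?thesis unfolding ds(1) using ds cp by (intro cycle_spectrum_admissible[OF p]) auto
qed

text \<open>
The witness is \<open>{1, 1, 2, \<dots>, p - 1}\<close>; with one double value the parity condition is void.
\<close>

lemma admissible_with_double:
  assumes p: "3 \<le> p"
  obtains \<Lambda> where "admissible p \<Lambda>" "count \<Lambda> 1 = 2"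
proof -
  define X where "X = real ` {1..p - 1}"
  define \<Lambda> where "\<Lambda> = add_mset 1 (mset_set X)"
  have fin: "finite X" and one: "1 \<in> X" and pos: "\<And>x. x \<in> X \<Longrightarrow> 0 < x"
    using p by (auto simp: X_def intro!: image_eqI[of _ _ 1])
  have c: "count \<Lambda> x = (if x \<in> X then 1 else 0) + (if x = 1 then 1 else 0)" for x
    using fin by (simp add: \<Lambda>_def)
  have "card X = p - 1" by (simp add: X_def card_image)
  hence size: "size \<Lambda> = p" using p by (simp add: \<Lambda>_def)
  have pos': "\<forall>x\<in>#\<Lambda>. 0 < x" using fin pos by (simp add: \<Lambda>_def)
  have le: "\<forall>x. count \<Lambda> x \<le> 2" by (simp add: c)
  have only_1: "x = 1" if "count \<Lambda> x = 2" for x using that unfolding c by (simp split: if_splits)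
  have "\<not> (x < y \<and> count \<Lambda> x = 2 \<and> count \<Lambda> y = 2)" for x y
    using only_1[of x] only_1[of y] by auto
  hence "admissible p \<Lambda>" unfolding admissible_def using size pos' le by blast
  moreover have "count \<Lambda> 1 = 2" using c[of 1] one by simp
  ultimately show ?thesis by (rule that)
qed

lemma max_symplectic_multiplicity_cycle:
  assumes p: "3 \<le> p"
  shows "max_symplectic_multiplicity (corona (cycle_graph p)) (leaf_coupling (cycle_graph p)) = 2"
proof -
  let ?G = "corona (cycle_graph p)" and ?C = "leaf_coupling (cycle_graph p)"
  let ?S = "{count \<Lambda> x | \<Lambda> x L N. representative_labeling ?G ?C L \<and> N \<in> S_plus ?G L \<and>
     has_symplectic_spectrum (card ?C) N \<Lambda> \<and> x \<in># \<Lambda>}"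
  have card: "card ?C = p" using card_leaf_coupling[of "cycle_graph p"] by simp
  have bound: "m \<le> 2" if "m \<in> ?S" for m
  proof -
    from that obtain \<Lambda> x L N where m: "m = count \<Lambda> x" and real: "representative_labeling ?G ?C L"
        "N \<in> S_plus ?G L" "has_symplectic_spectrum (card ?C) N \<Lambda>"
      unfolding mem_Collect_eq by (elim exE conjE)
    have "admissible p \<Lambda>" using realized_spectrum_admissible[OF p real(1,2)] real(3) unfolding card .
    thus ?thesis unfolding m admissible_def by (elim conjE allE)
  qed
  obtain \<Lambda> :: "real multiset" where \<Lambda>: "admissible p \<Lambda>" "count \<Lambda> 1 = 2" by (rule admissible_with_double[OF p])
  hence "1 \<in># \<Lambda>" by (metis not_in_iff zero_neq_numeral)
  moreover obtain L N where "representative_labeling ?G ?C L" "N \<in> S_plus ?G L"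
      "has_symplectic_spectrum (card ?C) N \<Lambda>"
    using admissible_spectrum_allowed[OF p \<Lambda>(1)] unfolding allows_symplectic_spectrum_def by (elim exE conjE)
  ultimately have "count \<Lambda> 1 \<in> ?S"
    by (intro CollectI exI[of _ \<Lambda>] exI[of _ 1] exI[of _ L] exI[of _ N] conjI refl)
  hence "2 \<in> ?S" unfolding \<Lambda>(2) .
  moreover have "finite ?S"
  proof (rule finite_subset[of _ "{..2}"])
    show "?S \<subseteq> {..2}" using bound by (intro subsetI) (simp only: atMost_iff)
  qed simp
  ultimately show ?thesis
    unfolding max_symplectic_multiplicity_def by (intro Max_eqI bound)
qed

text \<open>
The lower bound shifts a cycle matrix with a double eigenvalue so that this eigenvalue becomes zero.
\<close>

lemma max_nullity_cycle:
  assumes p: "3 \<le> p"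
  shows "max_nullity (cycle_graph p) = 2"
proof -
  let ?H = "cycle_graph p"
  let ?S = "{kernel_dim A | A L. bij_betw L (pverts ?H) {0..<card (pverts ?H)} \<and>
     A \<in> carrier_mat (card (pverts ?H)) (card (pverts ?H)) \<and> transpose_mat A = A \<and> has_pattern ?H L A}"
  have card: "card (pverts ?H) = p" by simp
  have bound: "m \<le> 2" if "m \<in> ?S" for m
  proof -
    from that obtain A :: "real mat" and L where m: "m = kernel_dim A" and L: "bij_betw L {0..<p} {0..<p}"
      and A: "A \<in> carrier_mat p p" "transpose_mat A = A" and pat: "has_pattern ?H L A"
      unfolding mem_Collect_eq cycle_graph_verts card_atLeastLessThan diff_zero by (elim exE conjE)
    have Lp: "L v < p" if "v < p" for v using bij_betwE[OF L] that by auto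
    define B where "B = mat p p (\<lambda>(u, v). A $$ (L u, L v))"
    have symA: "A $$ (i, j) = A $$ (j, i)" if "i < p" "j < p" for i j
      using arg_cong[OF A(2), of "\<lambda>X. X $$ (i, j)"] that A(1) by simp
    have B: "cycle_pattern p B"
    proof (rule cycle_patternI[OF p])
      show "transpose_mat B = B" by (rule eq_matI) (auto simp: B_def symA Lp)
      fix u v assume "u < p" "v < p" "u \<noteq> v"
      thus "B $$ (u, v) \<noteq> 0 \<longleftrightarrow> (u, v) \<in> parcs ?H" using pat by (simp add: B_def has_pattern_def)
    qed (simp add: B_def)
    have ends: "0 < p" "p - 1 < p" using p by auto
    have "kernel_dim A \<le> 2"
    proof (rule kernel_dim_le_2[OF A(1) Lp[OF ends(1)] Lp[OF ends(2)]])
      fix x assume x: "x \<in> carrier_vec p" "A *\<^sub>v x = 0\<^sub>v p" "x $ L 0 = 0" "x $ L (p - 1) = 0"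
      have "x $ L v = 0" if "v < p" for v
      proof (rule cycle_kernel_eq_0[OF B p _ x(3,4) that, where l = 0])
        fix u assume u: "u < p"
        have "(\<Sum>v<p. B $$ (u, v) * x $ L v) = (\<Sum>v\<in>{0..<p}. A $$ (L u, L v) * x $ L v)"
          using u by (intro sum.cong) (auto simp: B_def)
        also have "\<dots> = (\<Sum>j\<in>{0..<p}. A $$ (L u, j) * x $ j)"
          by (rule sum.reindex_bij_betw[OF L])
        also have "\<dots> = (A *\<^sub>v x) $ L u" using A(1) x(1) Lp[OF u] by (simp add: scalar_prod_def)
        finally show "(\<Sum>v<p. B $$ (u, v) * x $ L v) = 0 * x $ L u" using x(2) Lp[OF u] by simp
      qed
      moreover have "i \<in> L ` {0..<p}" if "i < p" for i using bij_betw_imp_surj_on[OF L] that by simp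
      ultimately show "x = 0\<^sub>v p" using x(1) by (intro eq_vecI) force+
    qed
    thus ?thesis using m by simp
  qed
  obtain \<Lambda> :: "real multiset" where \<Lambda>: "admissible p \<Lambda>" "count \<Lambda> 1 = 2" by (rule admissible_with_double[OF p])
  obtain A ds where A: "cycle_pattern p A" and ds: "mset ds = \<Lambda>" "length ds = p"
    and cp: "char_poly A = (\<Prod>d\<leftarrow>ds. [:- d\<^sup>2, 1:])"
    by (rule admissible_cycle_matrix[OF p \<Lambda>(1)])
  have Ac: "A \<in> carrier_mat p p" "transpose_mat A = A" using A by (auto simp: cycle_pattern_def)
  have "char_poly A = (\<Prod>a\<leftarrow>map power2 ds. [:- a, 1:])" unfolding cp by (simp add: o_def)
  from real_symmetric_diagonalization[OF Ac this] obtain Q where Q: "Q \<in> carrier_mat p p"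
    "transpose_mat Q * Q = 1\<^sub>m p" "transpose_mat Q * A * Q = mat_diag p (\<lambda>i. map power2 ds ! i)" by blast
  note ent = orthonormal_eigenbasis_entries[OF Ac(1) Q]
  have "card {i. i < p \<and> ds ! i = 1} = 2"
  proof -
    have "count \<Lambda> 1 = size (filter_mset (\<lambda>e. e = 1) \<Lambda>)" by (simp add: filter_eq_replicate_mset)
    also have "\<dots> = card {i. i < p \<and> ds ! i = 1}"
      unfolding ds(1)[symmetric] mset_filter[symmetric] size_mset length_filter_conv_card ds(2) ..
    finally show ?thesis using \<Lambda>(2) by simp
  qed
  then obtain a b where "{i. i < p \<and> ds ! i = 1} = {a, b}" "a \<noteq> b" by (auto simp: card_2_iff)
  hence ab: "a < p" "b < p" "ds ! a = 1" "ds ! b = 1" "a \<noteq> b" by blast+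
  define B where "B = A + (- 1) \<cdot>\<^sub>m 1\<^sub>m p"
  have Bc: "B \<in> carrier_mat p p" using Ac by (simp add: B_def)
  have ker: "B *\<^sub>v col Q c = 0\<^sub>v p" if "c < p" "ds ! c = 1" for c
  proof (rule eq_vecI)
    fix i assume "i < dim_vec (0\<^sub>v p :: real vec)"
    hence i: "i < p" by simp
    have "(B *\<^sub>v col Q c) $ i = (\<Sum>j<p. A $$ (i, j) * Q $$ (j, c)) - (\<Sum>j<p. if i = j then Q $$ (j, c) else 0)"
      unfolding sum_subtractf[symmetric]
      using i that Q(1) Ac(1) by (auto simp: B_def scalar_prod_def atLeast0LessThan left_diff_distrib intro!: sum.cong)
    also have "\<dots> = 0" using ent(3)[OF i that(1)] that i ds(2) by simp
    finally show "(B *\<^sub>v col Q c) $ i = 0\<^sub>v p $ i" using i by simp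
  qed (use Bc in auto)
  have dot: "col Q c \<bullet> col Q d = (if c = d then 1 else 0)" if "c < p" "d < p" for c d
    using ent(1)[OF that] that Q(1) by (simp add: scalar_prod_def atLeast0LessThan)
  have colQ: "col Q c \<in> carrier_vec p" if "c < p" for c using Q(1) that by auto
  have ge: "2 \<le> kernel_dim B"
    using kernel_dim_ge_2[OF Bc ker[OF ab(1,3)] ker[OF ab(2,4)] colQ[OF ab(1)] colQ[OF ab(2)]] dot ab by simp
  have mem: "kernel_dim B \<in> ?S"
  proof -
    have "transpose_mat B = B"
    proof (rule eq_matI)
      fix i j assume "i < dim_row B" "j < dim_col B"
      hence ij: "i < p" "j < p" using Bc by auto
      show "transpose_mat B $$ (i, j) = B $$ (i, j)"
        using ij Ac(1) cycle_pattern_sym[OF A ij] by (simp add: B_def)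
    qed (use Bc in auto)
    moreover have "has_pattern ?H id B"
      unfolding has_pattern_def using cycle_patternD[OF p A] Ac(1) by (auto simp: B_def)
    ultimately show ?thesis using Bc unfolding cycle_graph_verts card_atLeastLessThan diff_zero
      by (intro CollectI exI[of _ B] exI[of _ id] conjI refl bij_betw_id)
  qed
  have dim: "kernel_dim B = 2" using bound[OF mem] ge by (rule le_antisym)
  have "2 \<in> ?S" using mem unfolding dim .
  moreover have "finite ?S"
  proof (rule finite_subset[of _ "{..2}"])
    show "?S \<subseteq> {..2}" using bound by (intro subsetI) (simp only: atMost_iff)
  qed simp
  ultimately show ?thesis unfolding max_nullity_def by (intro Max_eqI bound)
qed

theorem corollary6p16:
  fixes p :: nat
  assumes "3 \<le> p"
  shows "(\<forall>\<Lambda> :: real multiset.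
      allows_symplectic_spectrum (corona (cycle_graph p)) (leaf_coupling (cycle_graph p)) \<Lambda> \<longleftrightarrow>
      (\<forall>x \<in># \<Lambda>. 0 < x) \<and>
      (let m = ordered_multiplicity_list \<Lambda>; q = length m in
        (\<forall>i<q. m ! i = 1 \<or> m ! i = 2) \<and>
        p = (\<Sum>i<q. m ! i) \<and>
        (\<forall>k k'. k < k' \<and> k' < q \<and> m ! k = 2 \<and> m ! k' = 2 \<longrightarrow> even (\<Sum>i=k..k'. m ! i)))) \<and>
    max_nullity (cycle_graph p) =
      max_symplectic_multiplicity (corona (cycle_graph p)) (leaf_coupling (cycle_graph p)) \<and>
    max_symplectic_multiplicity (corona (cycle_graph p)) (leaf_coupling (cycle_graph p)) =
      Z_C_number (corona (cycle_graph p)) (leaf_coupling (cycle_graph p)) \<and>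
    Z_C_number (corona (cycle_graph p)) (leaf_coupling (cycle_graph p)) =
      Z_ell_number (corona (cycle_graph p)) \<and>
    Z_ell_number (corona (cycle_graph p)) = Z_number (cycle_graph p) \<and>
    Z_number (cycle_graph p) = 2"
proof -
  have card: "card (leaf_coupling (cycle_graph p)) = p"
    using card_leaf_coupling[of "cycle_graph p"] by simp
  have allows: "allows_symplectic_spectrum (corona (cycle_graph p)) (leaf_coupling (cycle_graph p)) \<Lambda> \<longleftrightarrow> admissible p \<Lambda>"
    for \<Lambda> :: "real multiset"
  proof
    assume "allows_symplectic_spectrum (corona (cycle_graph p)) (leaf_coupling (cycle_graph p)) \<Lambda>"
    thus "admissible p \<Lambda>"
      unfolding allows_symplectic_spectrum_def card by (elim exE conjE) (rule realized_spectrum_admissible[OF assms])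
  qed (rule admissible_spectrum_allowed[OF assms])
  show ?thesis
    unfolding allows max_nullity_cycle[OF assms] max_symplectic_multiplicity_cycle[OF assms] Z_C_number_corona
      Z_ell_number_corona_cycle[OF assms] Z_number_cycle_graph[OF assms]
    using admissible_iff_ordered_multiplicity_list by (intro conjI allI refl)
qed

end
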